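(* Let $B$ be an open ball of $\mathbb{R}^d$ centered at $0$ and let $\varphi:[0,\infty[\to[0,\infty[$ be a locally Lipschitz nondecreasing function with $\varphi(0)=0$, not identically zero. For every nonnegative continuous function $f$ on $\partial B$, the semilinear Dirichlet problem $$\Delta_ku=\varphi(u)\ \text{ in } B,\qquad u=f\ \text{ on }\partial B,$$ admits one and only one solution $u$ among the nonnegative continuous functions on $\overline B$.
   Context: Dunkl setting. $\langle\cdot,\cdot\rangle$ is the Euclidean inner product on $\mathbb{R}^d$, $|\cdot|$ its norm. For $\alpha\in\mathbb{R}^d\setminus\{0\}$, $\sigma_\alpha(x)=x-2\frac{\langle\alpha,x\rangle}{|\alpha|^2}\alpha$. $R$ is a fixed root system: a finite subset of $\mathbb{R}^d\setminus\{0\}$ with $R\cap\mathbb{R}\alpha=\{\pm\alpha\}$ and $\sigma_\alpha(R)=R$ for all $\alpha\in R$. $k:R\to]0,\infty[$ is a fixed (strictly positive) multiplicity function, i.e. $k(\sigma_\alpha\beta)=k(\beta)$ for all $\alpha,\beta\in R$. Assume $m:=d+\sum_{\alpha\in R}k(\alpha)>2$. Put $w_k(x)=\prod_{\alpha\in R}|\langle x,\alpha\rangle|^{k(\alpha)}$. The Dunkl Laplacian is, for $u\in C^2$, $\Delta_ku(x)=\Delta u(x)+\sum_{\alpha\in R}k(\alpha)\left(\frac{\langle\nabla u(x),\alpha\rangle}{\langle\alpha,x\rangle}-\frac{|\alpha|^2}{2}\frac{u(x)-u(\sigma_\alpha x)}{\langle\alpha,x\rangle^2}\right)$ (extended by continuity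 where $\langle\alpha,x\rangle=0$). A solution of $\Delta_ku=\varphi(u)$ in $B$ is a function $u\in C(B)$ (with values in $[0,\infty[$) such that $\int_Bu(x)\,\Delta_k\psi(x)\,w_k(x)\,dx=\int_B\varphi(u(x))\,\psi(x)\,w_k(x)\,dx$ for every $\psi\in C_c^\infty(B)$. *)

theory Defs
  imports "HOL-Analysis.Analysis"
begin

definition reflect :: "'a::euclidean_space \<Rightarrow> 'a \<Rightarrow> 'a" where
  "reflect \<alpha> x = x - (2 * (\<alpha> \<bullet> x) / (norm \<alpha>)\<^sup>2) *\<^sub>R \<alpha>"

definition root_system :: "'a::euclidean_space set \<Rightarrow> bool" where
  "root_system R \<longleftrightarrow> finite R \<and> 0 \<notin> R \<and>
     (\<forall>\<alpha>\<in>R. R \<inter> range (\<lambda>t. t *\<^sub>R \<alpha>) = {\<alpha>, - \<alpha>} \<and> reflect \<alpha> ` R = R)"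

definition multiplicity_function :: "'a::euclidean_space set \<Rightarrow> ('a \<Rightarrow> real) \<Rightarrow> bool" where
  "multiplicity_function R k \<longleftrightarrow>
     (\<forall>\<alpha>\<in>R. 0 < k \<alpha>) \<and> (\<forall>\<alpha>\<in>R. \<forall>\<beta>\<in>R. k (reflect \<alpha> \<beta>) = k \<beta>)"

definition dunkl_weight :: "'a::euclidean_space set \<Rightarrow> ('a \<Rightarrow> real) \<Rightarrow> 'a \<Rightarrow> real" where
  "dunkl_weight R k x = (\<Prod>\<alpha>\<in>R. \<bar>x \<bullet> \<alpha>\<bar> powr k \<alpha>)"

definition partial_deriv :: "'a::euclidean_space \<Rightarrow> ('a \<Rightarrow> real) \<Rightarrow> 'a \<Rightarrow> real" where
  "partial_deriv b u x = frechet_derivative u (at x) b"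

definition gradient :: "('a::euclidean_space \<Rightarrow> real) \<Rightarrow> 'a \<Rightarrow> 'a" where
  "gradient u x = (\<Sum>b\<in>Basis. partial_deriv b u x *\<^sub>R b)"

definition laplacian :: "('a::euclidean_space \<Rightarrow> real) \<Rightarrow> 'a \<Rightarrow> real" where
  "laplacian u x = (\<Sum>b\<in>Basis. partial_deriv b (partial_deriv b u) x)"

primrec Ck :: "nat \<Rightarrow> ('a::euclidean_space \<Rightarrow> real) \<Rightarrow> bool" where
  "Ck 0 u \<longleftrightarrow> continuous_on UNIV u"
| "Ck (Suc n) u \<longleftrightarrow> (\<forall>x. u differentiable (at x)) \<and> (\<forall>b\<in>Basis. Ck n (partial_deriv b u))"

(* Elements of C_c^infinity(B) are represented by their extension by zero to the whole space. *)
definition test_function_on :: "'a::euclidean_space set \<Rightarrow> ('a \<Rightarrow> real) \<Rightarrow> bool" where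
  "test_function_on B \<psi> \<longleftrightarrow>
     (\<forall>n. Ck n \<psi>) \<and> compact (closure {x. \<psi> x \<noteq> 0}) \<and> closure {x. \<psi> x \<noteq> 0} \<subseteq> B"

definition regular_points :: "'a::euclidean_space set \<Rightarrow> 'a set" where
  "regular_points R = {x. \<forall>\<alpha>\<in>R. \<alpha> \<bullet> x \<noteq> 0}"

definition dunkl_laplacian_reg ::
    "'a::euclidean_space set \<Rightarrow> ('a \<Rightarrow> real) \<Rightarrow> ('a \<Rightarrow> real) \<Rightarrow> 'a \<Rightarrow> real" where
  "dunkl_laplacian_reg R k u x = laplacian u x +
     (\<Sum>\<alpha>\<in>R. k \<alpha> * ((gradient u x \<bullet> \<alpha>) / (\<alpha> \<bullet> x)
        - (norm \<alpha>)\<^sup>2 / 2 * ((u x - u (reflect \<alpha> x)) / (\<alpha> \<bullet> x)\<^sup>2)))"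

(* On the reflecting hyperplanes the value is the limit taken along regular points; for C^2
   functions this limit exists, and the regular points are dense since R is finite. *)
definition dunkl_laplacian ::
    "'a::euclidean_space set \<Rightarrow> ('a \<Rightarrow> real) \<Rightarrow> ('a \<Rightarrow> real) \<Rightarrow> 'a \<Rightarrow> real" where
  "dunkl_laplacian R k u x =
     (if x \<in> regular_points R then dunkl_laplacian_reg R k u x
      else Lim (at x within regular_points R) (dunkl_laplacian_reg R k u))"

definition dunkl_semilinear_solution ::
    "'a::euclidean_space set \<Rightarrow> ('a \<Rightarrow> real) \<Rightarrow> (real \<Rightarrow> real) \<Rightarrow> 'a set \<Rightarrow> ('a \<Rightarrow> real) \<Rightarrow> bool" where
  "dunkl_semilinear_solution R k \<phi> B u \<longleftrightarrow>
     continuous_on B u \<and> (\<forall>x\<in>B. 0 \<le> u x) \<and>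
     (\<forall>\<psi>. test_function_on B \<psi> \<longrightarrow>
        (LINT x:B|lborel. u x * dunkl_laplacian R k \<psi> x * dunkl_weight R k x)
      = (LINT x:B|lborel. \<phi> (u x) * \<psi> x * dunkl_weight R k x))"

definition dunkl_dirichlet_solution ::
    "'a::euclidean_space set \<Rightarrow> ('a \<Rightarrow> real) \<Rightarrow> (real \<Rightarrow> real) \<Rightarrow> real \<Rightarrow> ('a \<Rightarrow> real) \<Rightarrow> ('a \<Rightarrow> real) \<Rightarrow> bool"
  where
  "dunkl_dirichlet_solution R k \<phi> r f u \<longleftrightarrow>
     continuous_on (cball 0 r) u \<and> (\<forall>x\<in>cball 0 r. 0 \<le> u x) \<and>
     dunkl_semilinear_solution R k \<phi> (ball 0 r) u \<and> (\<forall>x\<in>sphere 0 r. u x = f x)"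

(* local_lipschitz is stated for families indexed by a metric space; here the family is constant. *)
definition locally_lipschitz_on :: "real set \<Rightarrow> (real \<Rightarrow> real) \<Rightarrow> bool" where
  "locally_lipschitz_on S g \<longleftrightarrow> local_lipschitz (UNIV :: real set) S (\<lambda>_. g)"

end

theory Submission
  imports Defs
begin

text \<open>
  The proof works with polynomials: the Dirichlet problem for the Dunkl Laplacian on a centred ball is
  solved exactly for polynomial data, and everything else follows by uniform approximation and duality.

  The operator maps polynomials to polynomials: for a root \<open>\<alpha>\<close> the first-order term and the difference
  term combine into a second-order Taylor quotient in direction \<open>\<alpha>\<close>, which is polynomial. The relation
  \<open>L (|x|\<^sup>2 u) = |x|\<^sup>2 L u + 2 m u + 4 \<langle>x, \<nabla>u\<rangle>\<close>, where \<open>m\<close> is the dimension increased by the sum of the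
  multiplicities, allows solving \<open>L ((r\<^sup>2 - |x|\<^sup>2) q) = p\<close> for every polynomial \<open>p\<close> by induction on the
  degree (\<open>L_hom_solvable\<close>, \<open>L_surj_ball\<close>). So the Dirichlet problem with polynomial data has a
  polynomial solution.

  All summands of the operator are second-order differences with positive coefficients, and reflections
  preserve the ball. Hence there is a maximum principle (\<open>L_nonpos_at_max\<close>), which survives passage to the
  closure \<open>graph\<close> of the operator in the uniform norm (\<open>graph_max_principle\<close>). With the
  Stone--Weierstrass theorem it gives the linear Dirichlet problem for continuous data
  (\<open>linear_dirichlet\<close>). The maximum principle also shows that the solution of \<open>L u = t \<phi>(u) + g\<close>
  is Lipschitz in \<open>g\<close>, uniformly in \<open>t\<close>, because \<open>\<phi>\<close> is nondecreasing; a continuation in \<open>t\<close> from \<open>0\<close> to \<open>1\<close> by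
  contractions therefore solves the semilinear problem in the closure (\<open>semilinear_dirichlet\<close>).

  Solutions in the closure are weak solutions, by Green's identity \<open>dunkl_green\<close> for the weight and
  approximation. Conversely, let \<open>v\<close> be a weak solution and \<open>z\<close> the solution in the closure of the linear
  problem with right-hand side \<open>\<phi>(v)\<close> and the same boundary values. The difference \<open>w = v - z\<close> is
  continuous, weakly harmonic and zero on the sphere. Testing with cutoffs of the polynomials
  \<open>(r\<^sup>2 - |x|\<^sup>2) q\<close> shows that \<open>w\<close> is orthogonal to every polynomial: the cutoff error is of order \<open>1/d\<close> on
  a shell of width \<open>d\<close> on which \<open>w\<close> is uniformly small. So \<open>w = 0\<close> (\<open>weakly_harmonic_eq_0\<close>), every weak
  solution lies in the closure, and the maximum principle gives uniqueness.
\<close>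

section \<open>Partial derivatives and polynomial functions\<close>

lemmas rpf_linear = real_polynomial_function.intros(1)
lemmas rpf_const = real_polynomial_function.intros(2)
lemmas rpf_add = real_polynomial_function.intros(3)
lemmas rpf_mult = real_polynomial_function.intros(4)

lemma partial_deriv_eq:
  "(u has_derivative D) (at x) \<Longrightarrow> partial_deriv b u x = D b"
  unfolding partial_deriv_def by (metis frechet_derivative_at)

lemma has_derivative_partial_deriv:
  "u differentiable (at x) \<Longrightarrow> (u has_derivative (\<lambda>h. partial_deriv h u x)) (at x)"
  unfolding partial_deriv_def by (simp add: frechet_derivative_works)

lemma partial_deriv_const [simp]: "partial_deriv b (\<lambda>x. c) x = 0"
  by (rule partial_deriv_eq) (rule has_derivative_const)

lemma partial_deriv_add:
  assumes "u differentiable (at x)" "v differentiable (at x)"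
  shows "partial_deriv b (\<lambda>x. u x + v x) x = partial_deriv b u x + partial_deriv b v x"
  by (rule partial_deriv_eq) (intro has_derivative_add has_derivative_partial_deriv assms)

lemma partial_deriv_mult:
  assumes "u differentiable (at x)" "v differentiable (at x)"
  shows "partial_deriv b (\<lambda>x. u x * v x) x = u x * partial_deriv b v x + partial_deriv b u x * v x"
  by (rule partial_deriv_eq) (intro has_derivative_mult has_derivative_partial_deriv assms)

lemma partial_deriv_scaleR:
  "u differentiable (at x) \<Longrightarrow> partial_deriv (c *\<^sub>R b) u x = c * partial_deriv b u x"
  using linear_scale[OF bounded_linear.linear[OF has_derivative_bounded_linear[OF has_derivative_partial_deriv]], of u x c b]
  by simp

lemma partial_deriv_sum_direction:
  "u differentiable (at x) \<Longrightarrow> partial_deriv (\<Sum>i\<in>I. g i) u x = (\<Sum>i\<in>I. partial_deriv (g i) u x)"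
  by (rule linear_sum[OF bounded_linear.linear[OF has_derivative_bounded_linear[OF has_derivative_partial_deriv]]])

lemma inner_gradient:
  assumes "u differentiable (at x)"
  shows "gradient u x \<bullet> a = partial_deriv a u x"
proof -
  have "partial_deriv a u x = partial_deriv (\<Sum>b\<in>Basis. (a \<bullet> b) *\<^sub>R b) u x"
    by (simp add: euclidean_representation)
  also have "\<dots> = (\<Sum>b\<in>Basis. (a \<bullet> b) * partial_deriv b u x)"
    by (simp add: partial_deriv_sum_direction assms partial_deriv_scaleR)
  finally show ?thesis
    by (simp add: gradient_def inner_sum_left inner_sum_right inner_commute mult.commute)
qed

text \<open>Iterated derivatives in the direction of a root reduce to derivatives along the standard
  basis, which are the only ones that the regularity assumptions control.\<close>
lemma partial_deriv_sum_basis: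
  "u differentiable (at x) \<Longrightarrow> partial_deriv a u x = (\<Sum>b\<in>Basis. (a \<bullet> b) * partial_deriv b u x)"
  using inner_gradient[of u x a] unfolding gradient_def inner_sum_left inner_scaleR_left
  by (simp add: inner_commute mult.commute)

lemma partial_deriv_eq_0_open:
  assumes "open U" "\<And>x. x \<in> U \<Longrightarrow> u x = 0" "x \<in> U"
  shows "partial_deriv b u x = 0"
proof -
  have "((\<lambda>x. 0) has_derivative (\<lambda>h. 0)) (at x)" by simp
  then have "(u has_derivative (\<lambda>h. 0)) (at x)"
    by (rule has_derivative_transform_within_open[OF _ assms(1,3)]) (simp add: assms(2))
  then show ?thesis by (rule partial_deriv_eq)
qed

lemma has_derivative_norm_power2:
  "((\<lambda>x. (norm x)\<^sup>2) has_derivative (\<lambda>h. 2 * (x \<bullet> h))) (at x)"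
  unfolding power2_norm_eq_inner
  by (auto intro!: derivative_eq_intros simp: inner_commute)

lemma rpf_differentiable [simp]:
  fixes u :: "'a::euclidean_space \<Rightarrow> real"
  shows "real_polynomial_function u \<Longrightarrow> u differentiable (at x)"
  by (rule differentiable_at_real_polynomial_function)

lemma rpf_partial_deriv:
  fixes u :: "'a::euclidean_space \<Rightarrow> real"
  assumes "real_polynomial_function u"
  shows "real_polynomial_function (partial_deriv b u)"
  using assms
proof (induction u)
  case (linear f)
  have "partial_deriv b f = (\<lambda>x. f b)"
    by (rule ext) (rule partial_deriv_eq[OF bounded_linear_imp_has_derivative[OF linear]])
  then show ?case by (simp only: rpf_const)
next
  case (const c)
  have "partial_deriv b (\<lambda>x::'a. c) = (\<lambda>x. 0)" by (intro ext) simp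
  then show ?case by (simp only: rpf_const)
next
  case (add f g)
  have "partial_deriv b (\<lambda>x. f x + g x) = (\<lambda>x. partial_deriv b f x + partial_deriv b g x)"
    by (rule ext) (rule partial_deriv_add; rule rpf_differentiable; fact)
  from rpf_add[OF add.IH, folded this] show ?case .
next
  case (mult f g)
  have "partial_deriv b (\<lambda>x. f x * g x) = (\<lambda>x. f x * partial_deriv b g x + partial_deriv b f x * g x)"
    by (rule ext) (rule partial_deriv_mult; rule rpf_differentiable; fact)
  from rpf_add[OF rpf_mult[OF mult.hyps(1) mult.IH(2)] rpf_mult[OF mult.IH(1) mult.hyps(2)], folded this]
  show ?case .
qed

lemma rpf_compose:
  "real_polynomial_function g \<Longrightarrow> polynomial_function f \<Longrightarrow> real_polynomial_function (\<lambda>x. g (f x))"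
  using real_polynomial_function_compose[of f g] by (simp add: o_def)

lemma polynomial_function_fst: "polynomial_function (fst :: 'a::real_normed_vector \<times> 'b::real_normed_vector \<Rightarrow> 'a)"
  by (rule polynomial_function_bounded_linear) (rule bounded_linear_fst)

lemma rpf_snd: "real_polynomial_function (snd :: 'a::real_normed_vector \<times> real \<Rightarrow> real)"
  by (rule rpf_linear) (rule bounded_linear_snd)

text \<open>This is what allows substituting a polynomial step length for the second variable of a
  polynomial in \<open>(x, t)\<close>.\<close>
lemma polynomial_function_Pair:
  assumes "polynomial_function f" "real_polynomial_function g"
  shows "polynomial_function (\<lambda>x. (f x, g x :: real))"
proof -
  have g: "polynomial_function g" using assms(2) by (simp only: real_polynomial_function_eq)
  have "polynomial_function ((\<lambda>y. (y, 0::real)) \<circ> f)"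
    by (rule polynomial_function_compose[OF assms(1) polynomial_function_bounded_linear[OF
          bounded_linear_Pair[OF bounded_linear_ident bounded_linear_zero]]])
  moreover have "polynomial_function ((\<lambda>t. (0::'b, t)) \<circ> g)"
    by (rule polynomial_function_compose[OF g polynomial_function_bounded_linear[OF
          bounded_linear_Pair[OF bounded_linear_zero bounded_linear_ident]]])
  ultimately have "polynomial_function (\<lambda>x. ((\<lambda>y. (y, 0::real)) \<circ> f) x + ((\<lambda>t. (0::'b, t)) \<circ> g) x)"
    by (rule polynomial_function_add)
  then show ?thesis by (simp add: o_def)
qed

section \<open>Second-order Taylor quotients and the Dunkl operator\<close>

text \<open>The coefficient of \<open>t\<^sup>2\<close> in the expansion of \<open>u (x + t
  *\<^sub>R b)\<close>. The value at \<open>t = 0\<close> is the continuous extension for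
  \<open>u\<close> of class \<open>C\<^sup>2\<close>, so that one function carries both the second
  derivatives and the difference terms of the Dunkl Laplacian.\<close>
definition taylor2 :: "'a::euclidean_space \<Rightarrow> ('a \<Rightarrow> real) \<Rightarrow> 'a \<Rightarrow> real \<Rightarrow> real" where
  "taylor2 b u x t = (if t = 0 then partial_deriv b (partial_deriv b u) x / 2
     else (u (x + t *\<^sub>R b) - u x - t * partial_deriv b u x) / t\<^sup>2)"

lemma taylor2: "u (x + t *\<^sub>R b) = u x + t * partial_deriv b u x + t\<^sup>2 * taylor2 b u x t"
  by (simp add: taylor2_def)

text \<open>Proved by induction on the construction of the polynomial: expanding the product of two
  second-order Taylor formulas shows that the quotients are again polynomial, jointly in the point
  and the step length.\<close>
lemma rpf_taylor2_aux:
  fixes u :: "'a::euclidean_space \<Rightarrow> real"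
  assumes "real_polynomial_function u"
  shows "\<exists>q. real_polynomial_function q \<and>
    (\<forall>x t. u (x + t *\<^sub>R b) = u x + t * partial_deriv b u x + t\<^sup>2 * q (x, t)) \<and>
    (\<forall>x. partial_deriv b (partial_deriv b u) x = 2 * q (x, 0))"
  using assms
proof (induction u)
  case (linear f)
  have d: "partial_deriv b f = (\<lambda>x. f b)"
    by (rule ext) (rule partial_deriv_eq[OF bounded_linear_imp_has_derivative[OF linear]])
  show ?case
    by (rule exI[of _ "\<lambda>_. 0"])
      (use linear in \<open>auto simp: d linear_simps bounded_linear.linear rpf_const\<close>)
next
  case (const c)
  have d: "partial_deriv b (\<lambda>x::'a. c) = (\<lambda>x. 0)" by (intro ext) simp
  show ?case
    by (rule exI[of _ "\<lambda>_. 0"]) (auto simp: d rpf_const)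
next
  case (add f g)
  then obtain p q where p: "real_polynomial_function p"
    "\<And>x t. f (x + t *\<^sub>R b) = f x + t * partial_deriv b f x + t\<^sup>2 * p (x, t)"
    "\<And>x. partial_deriv b (partial_deriv b f) x = 2 * p (x, 0)"
    and q: "real_polynomial_function q"
    "\<And>x t. g (x + t *\<^sub>R b) = g x + t * partial_deriv b g x + t\<^sup>2 * q (x, t)"
    "\<And>x. partial_deriv b (partial_deriv b g) x = 2 * q (x, 0)" by blast
  have d: "partial_deriv b (\<lambda>x. f x + g x) = (\<lambda>x. partial_deriv b f x + partial_deriv b g x)"
    by (rule ext) (rule partial_deriv_add; rule rpf_differentiable; fact)
  have dd: "partial_deriv b (\<lambda>x. partial_deriv b f x + partial_deriv b g x) x
     = partial_deriv b (partial_deriv b f) x + partial_deriv b (partial_deriv b g) x" for x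
    using add by (intro partial_deriv_add rpf_differentiable rpf_partial_deriv)
  show ?case
    by (rule exI[of _ "\<lambda>z. p z + q z"])
      (use p q in \<open>auto simp: d dd p q algebra_simps\<close>)
next
  case (mult f g)
  then obtain p q where p: "real_polynomial_function p"
    "\<And>x t. f (x + t *\<^sub>R b) = f x + t * partial_deriv b f x + t\<^sup>2 * p (x, t)"
    "\<And>x. partial_deriv b (partial_deriv b f) x = 2 * p (x, 0)"
    and q: "real_polynomial_function q"
    "\<And>x t. g (x + t *\<^sub>R b) = g x + t * partial_deriv b g x + t\<^sup>2 * q (x, t)"
    "\<And>x. partial_deriv b (partial_deriv b g) x = 2 * q (x, 0)" by blast
  have d: "partial_deriv b (\<lambda>x. f x * g x) = (\<lambda>x. f x * partial_deriv b g x + partial_deriv b f x * g x)"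
    by (rule ext) (rule partial_deriv_mult; rule rpf_differentiable; fact)
  have dd: "partial_deriv b (\<lambda>x. f x * partial_deriv b g x + partial_deriv b f x * g x) x
     = (f x * partial_deriv b (partial_deriv b g) x + partial_deriv b f x * partial_deriv b g x)
     + (partial_deriv b f x * partial_deriv b g x + partial_deriv b (partial_deriv b f) x * g x)" for x
  proof -
    note D = rpf_differentiable[OF mult(1), of x]
      rpf_differentiable[OF mult(2), of x]
      rpf_differentiable[OF rpf_partial_deriv[OF mult(1), of b], of x]
      rpf_differentiable[OF rpf_partial_deriv[OF mult(2), of b], of x]
    show ?thesis
      unfolding partial_deriv_add[OF differentiable_mult[OF D(1) D(4)] differentiable_mult[OF D(3) D(2)]]
        partial_deriv_mult[OF D(1) D(4)] partial_deriv_mult[OF D(3) D(2)] by (rule refl)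
  qed
  let ?f = "\<lambda>z::'a\<times>real. f (fst z)" and ?g = "\<lambda>z::'a\<times>real. g (fst z)"
    and ?f1 = "\<lambda>z::'a\<times>real. partial_deriv b f (fst z)" and ?g1 = "\<lambda>z::'a\<times>real. partial_deriv b g (fst z)"
  have polys: "real_polynomial_function ?f" "real_polynomial_function ?g"
    "real_polynomial_function ?f1" "real_polynomial_function ?g1"
    by (rule rpf_compose[OF _ polynomial_function_fst];
        (rule rpf_partial_deriv)?; rule mult)+
  let ?r = "\<lambda>z. ?f z * q z + ?g z * p z + ?f1 z * ?g1 z + snd z * (?f1 z * q z + p z * ?g1 z)
        + (snd z)\<^sup>2 * (p z * q z)"
  have "real_polynomial_function ?r"
    by (intro rpf_add rpf_mult real_polynomial_function_power polys p(1) q(1) rpf_snd)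
  moreover have "f (x + t *\<^sub>R b) * g (x + t *\<^sub>R b) = f x * g x
      + t * (f x * partial_deriv b g x + partial_deriv b f x * g x) + t\<^sup>2 * ?r (x, t)" for x t
    unfolding p(2) q(2) by (simp add: algebra_simps power2_eq_square)
  moreover have "partial_deriv b (partial_deriv b (\<lambda>x. f x * g x)) x = 2 * ?r (x, 0)" for x
    unfolding d dd p q by (simp add: algebra_simps)
  ultimately show ?case unfolding d by (intro exI[of _ ?r] conjI allI)
qed

lemma rpf_taylor2:
  fixes u :: "'a::euclidean_space \<Rightarrow> real"
  assumes "real_polynomial_function u"
  shows "real_polynomial_function (\<lambda>z. taylor2 b u (fst z) (snd z))"
proof -
  obtain q where q: "real_polynomial_function q"
    "\<And>x t. u (x + t *\<^sub>R b) = u x + t * partial_deriv b u x + t\<^sup>2 * q (x, t)"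
    "\<And>x. partial_deriv b (partial_deriv b u) x = 2 * q (x, 0)"
    using rpf_taylor2_aux[OF assms] by blast
  have "(\<lambda>z. taylor2 b u (fst z) (snd z)) = q"
    unfolding taylor2_def by (auto simp: q(2,3) fun_eq_iff)
  with q(1) show ?thesis by simp
qed

text \<open>The step along \<open>\<alpha>\<close> that leads from \<open>x\<close> to its mirror
  image; for \<open>\<alpha> \<noteq> 0\<close> it vanishes exactly on the mirror.\<close>
abbreviation refl_step :: "'a::euclidean_space \<Rightarrow> 'a \<Rightarrow> real" where
  "refl_step \<alpha> x \<equiv> - 2 * (\<alpha> \<bullet> x) / (norm \<alpha>)\<^sup>2"

text \<open>At a regular point the first-order term and the difference term belonging to
  \<open>\<alpha>\<close> combine into a multiple of the Taylor quotient in direction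
  \<open>\<alpha>\<close> with the reflecting step length: the first-order contributions cancel.
  This form has no singularity on the mirrors, it is polynomial when \<open>u\<close> is, and it
  makes the maximum principle visible, because every summand is a second-order difference with a
  positive coefficient.\<close>
definition dunkl_op :: "'a::euclidean_space set \<Rightarrow> ('a \<Rightarrow> real) \<Rightarrow> ('a \<Rightarrow> real) \<Rightarrow> 'a \<Rightarrow> real" where
  "dunkl_op R k u x = (\<Sum>b\<in>Basis. 2 * taylor2 b u x 0)
     + (\<Sum>\<alpha>\<in>R. k \<alpha> * (2 / (norm \<alpha>)\<^sup>2) * taylor2 \<alpha> u x (refl_step \<alpha> x))"

lemma reflect_eq: "reflect \<alpha> x = x + (refl_step \<alpha> x) *\<^sub>R \<alpha>"
  by (simp add: reflect_def)

lemma dunkl_op_eq_dunkl_laplacian_reg: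
  assumes "0 \<notin> R" "x \<in> regular_points R" "u differentiable (at x)"
  shows "dunkl_op R k u x = dunkl_laplacian_reg R k u x"
proof -
  have "2 / (norm \<alpha>)\<^sup>2 * taylor2 \<alpha> u x (refl_step \<alpha> x)
      = (gradient u x \<bullet> \<alpha>) / (\<alpha> \<bullet> x) - (norm \<alpha>)\<^sup>2 / 2 * ((u x - u (reflect \<alpha> x)) / (\<alpha> \<bullet> x)\<^sup>2)"
    if "\<alpha> \<in> R" for \<alpha>
  proof -
    have a: "\<alpha> \<bullet> x \<noteq> 0" "norm \<alpha> \<noteq> 0" using that assms by (auto simp: regular_points_def)
    then show ?thesis
      unfolding taylor2_def reflect_eq inner_gradient[OF assms(3)]
      by (simp add: divide_simps) (simp add: algebra_simps power2_eq_square)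
  qed
  then have "(\<Sum>\<alpha>\<in>R. k \<alpha> * (2 / (norm \<alpha>)\<^sup>2) * taylor2 \<alpha> u x (refl_step \<alpha> x))
     = (\<Sum>\<alpha>\<in>R. k \<alpha> * ((gradient u x \<bullet> \<alpha>) / (\<alpha> \<bullet> x)
        - (norm \<alpha>)\<^sup>2 / 2 * ((u x - u (reflect \<alpha> x)) / (\<alpha> \<bullet> x)\<^sup>2)))"
    by (intro sum.cong refl) (simp only: mult.assoc)
  moreover have "(\<Sum>b\<in>Basis. 2 * taylor2 b u x 0) = laplacian u x"
    by (simp add: taylor2_def laplacian_def)
  ultimately show ?thesis
    unfolding dunkl_op_def dunkl_laplacian_reg_def by simp
qed

lemma rpf_dunkl_op:
  fixes u :: "'a::euclidean_space \<Rightarrow> real"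
  assumes "real_polynomial_function u" "finite R"
  shows "real_polynomial_function (dunkl_op R k u)"
proof -
  have t: "real_polynomial_function (\<lambda>x. taylor2 b u x (g x))" if "real_polynomial_function g" for g b
    using rpf_compose[OF rpf_taylor2[OF assms(1), of b]
        polynomial_function_Pair[OF polynomial_function_id that]] by simp
  have l: "real_polynomial_function (\<lambda>x. - 2 * (\<alpha> \<bullet> x) / (norm \<alpha>)\<^sup>2)" for \<alpha> :: 'a
    using rpf_mult[OF rpf_const rpf_linear[OF bounded_linear_inner_right], of "- 2 / (norm \<alpha>)\<^sup>2" \<alpha>] by simp
  have "real_polynomial_function (\<lambda>x. 2 * taylor2 b u x 0)" for b
    by (rule rpf_mult[OF rpf_const t[OF rpf_const]])
  then have 1: "real_polynomial_function (\<lambda>x. \<Sum>b\<in>Basis. 2 * taylor2 b u x 0)"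
    by (rule real_polynomial_function_sum[OF finite_Basis])
  have "real_polynomial_function (\<lambda>x. k \<alpha> * (2 / (norm \<alpha>)\<^sup>2) * taylor2 \<alpha> u x (refl_step \<alpha> x))" for \<alpha>
    by (rule rpf_mult[OF rpf_const t[OF l]])
  then have 2: "real_polynomial_function (\<lambda>x. \<Sum>\<alpha>\<in>R. k \<alpha> * (2 / (norm \<alpha>)\<^sup>2) * taylor2 \<alpha> u x (refl_step \<alpha> x))"
    by (rule real_polynomial_function_sum[OF assms(2)])
  show ?thesis
    using rpf_add[OF 1 2] unfolding dunkl_op_def[abs_def] .
qed

lemma rpf_continuous_on:
  fixes u :: "'a::euclidean_space \<Rightarrow> real"
  shows "real_polynomial_function u \<Longrightarrow> continuous_on S u"
  unfolding real_polynomial_function_eq by (rule continuous_on_polymonial_function)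

lemma partial_deriv_lincomb:
  fixes u v :: "'a::euclidean_space \<Rightarrow> real"
  assumes "real_polynomial_function u" "real_polynomial_function v"
  shows "partial_deriv b (\<lambda>x. c * u x + d * v x) = (\<lambda>x. c * partial_deriv b u x + d * partial_deriv b v x)"
  by (rule ext, rule partial_deriv_eq)
    (rule has_derivative_add; rule has_derivative_mult_right; rule has_derivative_partial_deriv;
     rule rpf_differentiable; rule assms)

lemma taylor2_lincomb:
  fixes u v :: "'a::euclidean_space \<Rightarrow> real"
  assumes "real_polynomial_function u" "real_polynomial_function v"
  shows "taylor2 b (\<lambda>x. c * u x + d * v x) x t = c * taylor2 b u x t + d * taylor2 b v x t"
proof -
  have "partial_deriv b (partial_deriv b (\<lambda>x. c * u x + d * v x)) x
      = c * partial_deriv b (partial_deriv b u) x + d * partial_deriv b (partial_deriv b v) x"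
    unfolding partial_deriv_lincomb[OF assms]
      partial_deriv_lincomb[OF assms[THEN rpf_partial_deriv]] by (rule refl)
  then show ?thesis
    unfolding taylor2_def partial_deriv_lincomb[OF assms]
    by (cases "t = 0") (simp_all add: add_divide_distrib diff_divide_distrib algebra_simps)
qed

lemma dunkl_op_lincomb:
  fixes u v :: "'a::euclidean_space \<Rightarrow> real"
  assumes "real_polynomial_function u" "real_polynomial_function v"
  shows "dunkl_op R k (\<lambda>x. c * u x + d * v x) x = c * dunkl_op R k u x + d * dunkl_op R k v x"
  unfolding dunkl_op_def taylor2_lincomb[OF assms]
  by (simp add: sum.distrib sum_distrib_left algebra_simps)

lemma dunkl_op_add:
  fixes u v :: "'a::euclidean_space \<Rightarrow> real"
  assumes "real_polynomial_function u" "real_polynomial_function v"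
  shows "dunkl_op R k (\<lambda>x. u x + v x) x = dunkl_op R k u x + dunkl_op R k v x"
  using dunkl_op_lincomb[OF assms, of R k 1 1] by simp

lemma dunkl_op_const [simp]: "dunkl_op R k (\<lambda>x::'a::euclidean_space. c) x = 0"
proof -
  have d: "partial_deriv b (\<lambda>x::'a. c) = (\<lambda>x. 0)" for b by (intro ext) simp
  have "taylor2 b (\<lambda>x::'a. c) x t = 0" for b t by (simp add: taylor2_def d)
  then show ?thesis by (simp add: dunkl_op_def)
qed

lemma norm_reflect:
  assumes "\<alpha> \<noteq> 0"
  shows "norm (reflect \<alpha> x) = norm x"
proof -
  define c where "c = 2 * (\<alpha> \<bullet> x) / (norm \<alpha>)\<^sup>2"
  have c: "c * (\<alpha> \<bullet> \<alpha>) = 2 * (\<alpha> \<bullet> x)"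
    using assms by (simp add: c_def dot_square_norm)
  have "(norm (reflect \<alpha> x))\<^sup>2 = x \<bullet> x - 2 * c * (\<alpha> \<bullet> x) + c * (c * (\<alpha> \<bullet> \<alpha>))"
    unfolding reflect_def c_def[symmetric]
    unfolding power2_norm_eq_inner inner_diff_left inner_diff_right
      inner_scaleR_left inner_scaleR_right inner_commute[of x \<alpha>] by algebra
  then have "(norm (reflect \<alpha> x))\<^sup>2 = (norm x)\<^sup>2"
    unfolding c by (simp add: power2_norm_eq_inner)
  then show ?thesis by simp
qed

lemma reflect_reflect: "\<alpha> \<noteq> 0 \<Longrightarrow> reflect \<alpha> (reflect \<alpha> x) = x"
  unfolding reflect_def
  by (simp add: inner_diff_right scaleR_diff_left dot_square_norm)

lemma linear_reflect: "linear (reflect \<alpha>)"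
  by (rule linearI) (simp_all add: reflect_def inner_add_right scaleR_add_left add_divide_distrib distrib_left scaleR_right_diff_distrib mult.left_commute)

lemma inner_reflect_left: "reflect \<alpha> x \<bullet> y = x \<bullet> reflect \<alpha> y"
  unfolding reflect_def by (simp add: inner_diff_left inner_diff_right inner_commute)

lemma inner_reflect_self: "\<alpha> \<noteq> 0 \<Longrightarrow> \<alpha> \<bullet> reflect \<alpha> x = - (\<alpha> \<bullet> x)"
  unfolding reflect_def by (simp add: inner_diff_right dot_square_norm)

section \<open>Homogeneous polynomials\<close>

lemma continuous_on_euler_derivative:
  fixes u :: "'a::euclidean_space \<Rightarrow> real"
  assumes "real_polynomial_function u"
  shows "continuous_on S (\<lambda>x. partial_deriv x u x)"
proof -
  have "continuous_on S (\<lambda>x. \<Sum>b\<in>Basis. (x \<bullet> b) * partial_deriv b u x)"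
    by (rule continuous_on_sum, rule continuous_on_mult)
      (rule continuous_on_inner[OF continuous_on_id continuous_on_const],
       rule rpf_continuous_on[OF rpf_partial_deriv[OF assms]])
  moreover have "(\<lambda>x. \<Sum>b\<in>Basis. (x \<bullet> b) * partial_deriv b u x) = (\<lambda>x. partial_deriv x u x)"
    by (rule ext) (rule partial_deriv_sum_basis[symmetric, OF rpf_differentiable[OF assms]])
  ultimately show ?thesis by (simp only:)
qed

definition hom_poly :: "nat \<Rightarrow> ('a::euclidean_space \<Rightarrow> real) \<Rightarrow> bool" where
  "hom_poly n u \<longleftrightarrow> real_polynomial_function u \<and> (\<forall>c x. u (c *\<^sub>R x) = c ^ n * u x)"

text \<open>The factors \<open>c\<close> and \<open>d\<close> make the statement stable under
  differentiation, so that it can be applied twice.\<close>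
lemma partial_deriv_scaled:
  fixes u :: "'a::euclidean_space \<Rightarrow> real"
  assumes "real_polynomial_function u" "\<And>x. c * u (l *\<^sub>R x) = d * u x"
  shows "c * l * partial_deriv b u (l *\<^sub>R x) = d * partial_deriv b u x"
proof -
  have g: "((\<lambda>x. l *\<^sub>R x) has_derivative (\<lambda>h. l *\<^sub>R h)) (at x)"
    by (auto intro!: derivative_eq_intros)
  have "((\<lambda>x. c * u (l *\<^sub>R x)) has_derivative (\<lambda>h. c * partial_deriv (l *\<^sub>R h) u (l *\<^sub>R x))) (at x)"
    by (rule has_derivative_mult_right, rule has_derivative_compose[OF g])
       (simp add: assms(1) has_derivative_partial_deriv)
  moreover have "((\<lambda>x. c * u (l *\<^sub>R x)) has_derivative (\<lambda>h. d * partial_deriv h u x)) (at x)"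
    unfolding assms(2) by (rule has_derivative_mult_right) (simp add: assms(1) has_derivative_partial_deriv)
  ultimately have "(\<lambda>h. c * partial_deriv (l *\<^sub>R h) u (l *\<^sub>R x)) = (\<lambda>h. d * partial_deriv h u x)"
    by (rule has_derivative_unique)
  from fun_cong[OF this, of b] show ?thesis using assms(1)
    by (simp add: partial_deriv_scaleR)
qed

text \<open>Euler's identity, obtained by differentiating \<open>c \<mapsto> u (c *\<^sub>R
  x)\<close> at \<open>c = 1\<close>.\<close>
lemma euler_hom_poly:
  assumes "hom_poly n u"
  shows "partial_deriv x u x = real n * u x"
proof -
  have u: "real_polynomial_function u" and h: "\<And>c x. u (c *\<^sub>R x) = c ^ n * u x"
    using assms by (auto simp: hom_poly_def)
  have "((\<lambda>c. u (c *\<^sub>R x)) has_derivative (\<lambda>c. partial_deriv (c *\<^sub>R x) u (1 *\<^sub>R x))) (at 1)"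
    by (rule has_derivative_compose[where f = "\<lambda>c. c *\<^sub>R x" and f' = "\<lambda>c. c *\<^sub>R x"])
      (use u in \<open>auto intro!: derivative_eq_intros has_derivative_partial_deriv\<close>)
  moreover have "((\<lambda>c. u (c *\<^sub>R x)) has_derivative (\<lambda>c. c * real n * u x)) (at 1)"
    unfolding h by (auto intro!: derivative_eq_intros)
  ultimately have "(\<lambda>c. partial_deriv (c *\<^sub>R x) u (1 *\<^sub>R x)) = (\<lambda>c. c * real n * u x)"
    by (rule has_derivative_unique)
  from fun_cong[OF this, of 1] show ?thesis by simp
qed

text \<open>The reflecting step length is linear in the point, so all Taylor quotients that occur
  scale in the same way.\<close>
lemma dunkl_op_scaled:
  assumes "hom_poly n u" "l \<noteq> 0"
  shows "l\<^sup>2 * dunkl_op R k u (l *\<^sub>R x) = l ^ n * dunkl_op R k u x"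
proof -
  have u: "real_polynomial_function u" and h: "\<And>c x. u (c *\<^sub>R x) = c ^ n * u x"
    using assms by (auto simp: hom_poly_def)
  have d1: "l * partial_deriv b u (l *\<^sub>R x) = l ^ n * partial_deriv b u x" for b x
    using partial_deriv_scaled[OF u, of 1 l "l^n"] by (simp add: h)
  have d2: "l * l * partial_deriv b (partial_deriv b u) (l *\<^sub>R x) = l ^ n * partial_deriv b (partial_deriv b u) x" for b x
    by (rule partial_deriv_scaled[OF rpf_partial_deriv[OF u]]) (rule d1)
  have t: "l\<^sup>2 * taylor2 b u (l *\<^sub>R x) (l * t) = l ^ n * taylor2 b u x t" for b t
  proof (cases "t = 0")
    case True
    then show ?thesis using d2[of b x] by (simp add: taylor2_def power2_eq_square)
  next
    case False
    have "u (l *\<^sub>R x + (l * t) *\<^sub>R b) = l ^ n * u (x + t *\<^sub>R b)"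
      using h[of l "x + t *\<^sub>R b"] by (simp add: scaleR_add_right)
    then have "u (l *\<^sub>R x + (l * t) *\<^sub>R b) - u (l *\<^sub>R x) - l * t * partial_deriv b u (l *\<^sub>R x)
       = l ^ n * (u (x + t *\<^sub>R b) - u x - t * partial_deriv b u x)"
      using d1[of b x] by (simp add: h algebra_simps)
    with False assms(2) show ?thesis by (simp add: taylor2_def power_mult_distrib)
  qed
  have "(- 2 * (\<alpha> \<bullet> (l *\<^sub>R x)) / (norm \<alpha>)\<^sup>2) = l * (refl_step \<alpha> x)" for \<alpha> by simp
  then have t': "l\<^sup>2 * taylor2 \<alpha> u (l *\<^sub>R x) (- 2 * (\<alpha> \<bullet> (l *\<^sub>R x)) / (norm \<alpha>)\<^sup>2)
     = l ^ n * taylor2 \<alpha> u x (refl_step \<alpha> x)" for \<alpha> using t by metis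
  have t0: "l\<^sup>2 * taylor2 b u (l *\<^sub>R x) 0 = l ^ n * taylor2 b u x 0" for b
    using t[of b 0] by simp
  have "l\<^sup>2 * (c * taylor2 \<alpha> u (l *\<^sub>R x) (- 2 * (\<alpha> \<bullet> (l *\<^sub>R x)) / (norm \<alpha>)\<^sup>2))
     = l ^ n * (c * taylor2 \<alpha> u x (refl_step \<alpha> x))" for \<alpha> c
    using t'[of \<alpha>] by (metis mult.left_commute)
  moreover have "l\<^sup>2 * (2 * taylor2 b u (l *\<^sub>R x) 0) = l ^ n * (2 * taylor2 b u x 0)" for b
    using t0[of b] by simp
  ultimately show ?thesis
    unfolding dunkl_op_def distrib_left sum_distrib_left by (simp only:)
qed

lemma isCont_ray:
  fixes v :: "'a::euclidean_space \<Rightarrow> real"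
  assumes "real_polynomial_function v"
  shows "((\<lambda>l. v (l *\<^sub>R x)) \<longlongrightarrow> v 0) (at 0)"
proof -
  have "continuous_on UNIV (\<lambda>l::real. v (l *\<^sub>R x))"
    by (rule continuous_on_compose2[OF rpf_continuous_on[OF assms]])
      (auto intro!: continuous_intros)
  then have "isCont (\<lambda>l. v (l *\<^sub>R x)) 0" by (simp add: continuous_on_eq_continuous_at)
  then show ?thesis by (simp add: isCont_def)
qed

lemma hom_poly_lincomb:
  "hom_poly n u \<Longrightarrow> hom_poly n v \<Longrightarrow> hom_poly n (\<lambda>x. c * u x + d * v x)"
  unfolding hom_poly_def
  by (intro conjI rpf_add[OF rpf_mult[OF rpf_const] rpf_mult[OF rpf_const]]; simp add: algebra_simps)

lemma rpf_norm_power2: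
  "real_polynomial_function (\<lambda>x::'a::euclidean_space. (norm x)\<^sup>2)"
proof -
  have "(\<lambda>x::'a. (norm x)\<^sup>2) = (\<lambda>x. \<Sum>b\<in>Basis. (x \<bullet> b) * (x \<bullet> b))"
    by (simp add: fun_eq_iff power2_norm_eq_inner euclidean_inner[symmetric])
  moreover have "real_polynomial_function (\<lambda>x::'a. \<Sum>b\<in>Basis. (x \<bullet> b) * (x \<bullet> b))"
    by (rule real_polynomial_function_sum[OF finite_Basis rpf_mult[OF rpf_linear rpf_linear]];
        rule bounded_linear_inner_left)
  ultimately show ?thesis by simp
qed

lemma hom_poly_norm_mult:
  "hom_poly n u \<Longrightarrow> hom_poly (Suc (Suc n)) (\<lambda>x. (norm x)\<^sup>2 * u x)"
  unfolding hom_poly_def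
  by (intro conjI rpf_mult[OF rpf_norm_power2];
      simp add: power_mult_distrib power2_eq_square abs_mult_self_eq)

text \<open>Sums of homogeneous polynomials; every polynomial has this form, which reduces linear
  problems for polynomials to one degree at a time.\<close>
inductive hom_sum :: "('a::euclidean_space \<Rightarrow> real) \<Rightarrow> bool" where
  hom: "hom_poly n u \<Longrightarrow> hom_sum u"
| sum: "hom_sum u \<Longrightarrow> hom_sum v \<Longrightarrow> hom_sum (\<lambda>x. u x + v x)"

lemma hom_poly_mult: "hom_poly n u \<Longrightarrow> hom_poly j v \<Longrightarrow> hom_poly (n + j) (\<lambda>x. u x * v x)"
  unfolding hom_poly_def by (intro conjI rpf_mult; simp add: power_add)

lemma hom_sum_mult:
  assumes "hom_sum u" "hom_sum v"
  shows "hom_sum (\<lambda>x. u x * v x)"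
  using assms(1)
proof induction
  case (hom n u)
  from assms(2) show ?case
  proof induction
    case (hom j v)
    with \<open>hom_poly n u\<close> show ?case by (blast intro: hom_sum.hom hom_poly_mult)
  next
    case (sum v w)
    from hom_sum.sum[OF sum.IH] show ?case by (simp add: distrib_left)
  qed
next
  case (sum u w)
  from hom_sum.sum[OF sum.IH] show ?case by (simp add: distrib_right)
qed

lemma hom_sum_rpf:
  "real_polynomial_function u \<Longrightarrow> hom_sum u"
proof (induction u rule: real_polynomial_function.induct)
  case (linear f)
  then have "hom_poly 1 f" unfolding hom_poly_def by (simp add: rpf_linear[OF linear] linear_simps)
  then show ?case by (rule hom_sum.hom)
next
  case (const c)
  have "hom_poly 0 (\<lambda>x::'a. c)" unfolding hom_poly_def by (simp only: rpf_const) simp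
  then show ?case by (rule hom_sum.hom)
qed (rule hom_sum.sum hom_sum_mult; assumption)+

section \<open>Smooth functions and a smooth cutoff\<close>

lemma Ck_SucD: "Ck (Suc n) u \<Longrightarrow> Ck n u"
proof (induction n arbitrary: u)
  case 0
  then have "\<And>x. u differentiable (at x)" by simp
  then show ?case
    by (auto intro!: differentiable_imp_continuous_on simp: differentiable_on_def differentiable_at_withinI)
next
  case (Suc n)
  from Suc.prems have "u differentiable (at x)" for x by simp
  moreover have "Ck n (partial_deriv b u)" if "b \<in> Basis" for b
    using Suc.prems that by (intro Suc.IH) simp
  ultimately show ?case by simp
qed

lemma Ck_add: "Ck n u \<Longrightarrow> Ck n v \<Longrightarrow> Ck n (\<lambda>x. u x + v x)"
proof (induction n arbitrary: u v)
  case 0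
  then show ?case by (auto intro: continuous_on_add)
next
  case (Suc n)
  have d: "u differentiable (at x)" "v differentiable (at x)" for x using Suc.prems by simp_all
  have "partial_deriv b (\<lambda>x. u x + v x) = (\<lambda>x. partial_deriv b u x + partial_deriv b v x)" for b
    by (rule ext) (rule partial_deriv_add[OF d])
  moreover have "Ck n (\<lambda>x. partial_deriv b u x + partial_deriv b v x)" if "b \<in> Basis" for b
    using Suc.prems that by (intro Suc.IH) simp_all
  ultimately show ?case using d by (simp add: differentiable_add)
qed

lemma Ck_mult: "Ck n u \<Longrightarrow> Ck n v \<Longrightarrow> Ck n (\<lambda>x. u x * v x)"
proof (induction n arbitrary: u v)
  case 0
  then show ?case by (auto intro: continuous_on_mult)
next
  case (Suc n)
  have d: "u differentiable (at x)" "v differentiable (at x)" for x using Suc.prems by simp_all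
  have "partial_deriv b (\<lambda>x. u x * v x) = (\<lambda>x. u x * partial_deriv b v x + partial_deriv b u x * v x)" for b
    by (rule ext) (rule partial_deriv_mult[OF d])
  moreover have "Ck n (\<lambda>x. u x * partial_deriv b v x + partial_deriv b u x * v x)" if "b \<in> Basis" for b
    using Suc.prems that by (intro Ck_add Suc.IH Ck_SucD[of n u] Ck_SucD[of n v]) simp_all
  ultimately show ?case using d by (simp add: differentiable_mult)
qed

lemma Ck_const: "Ck n (\<lambda>x. c)"
proof (induction n arbitrary: c)
  case (Suc n)
  have "partial_deriv b (\<lambda>x::'a. c) = (\<lambda>x. 0)" for b by (rule ext) simp
  with Suc show ?case by simp
qed simp

lemma Ck_rpf: "real_polynomial_function p \<Longrightarrow> Ck n p"
proof (induction n arbitrary: p)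
  case 0
  then show ?case by (simp add: rpf_continuous_on)
next
  case (Suc n)
  have "Ck n (partial_deriv b p)" for b
    by (rule Suc.IH[OF rpf_partial_deriv[OF Suc.prems]])
  then show ?case by (simp add: rpf_differentiable[OF Suc.prems])
qed

lemma partial_deriv_compose_real:
  fixes f :: "real \<Rightarrow> real"
  assumes f: "(f has_real_derivative f') (at (g x))" and g: "g differentiable (at x)"
  shows "partial_deriv b (\<lambda>x. f (g x)) x = f' * partial_deriv b g x"
proof (rule partial_deriv_eq)
  have "(f has_derivative (\<lambda>h. f' * h)) (at (g x))"
    using f by (simp add: has_field_derivative_def)
  from has_derivative_compose[of g "\<lambda>h. partial_deriv h g x" x UNIV f "\<lambda>h. f' * h", OF has_derivative_partial_deriv[OF g] this]
  show "((\<lambda>x. f (g x)) has_derivative (\<lambda>h. f' * partial_deriv h g x)) (at x)" .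
qed

lemma has_real_derivative_partial_deriv:
  fixes f :: "real \<Rightarrow> real"
  assumes "f differentiable (at x)"
  shows "(f has_real_derivative partial_deriv 1 f x) (at x)"
  unfolding has_field_derivative_def
proof (rule has_derivative_eq_rhs[OF has_derivative_partial_deriv[OF assms]])
  show "(\<lambda>h. partial_deriv h f x) = (*) (partial_deriv 1 f x)"
  proof
    fix h
    from partial_deriv_scaleR[OF assms, of h 1] show "partial_deriv h f x = partial_deriv 1 f x * h"
      by (simp only: real_scaleR_def mult_1_right mult_1_left mult.commute)
  qed
qed

lemma partial_deriv_real:
  "(f has_real_derivative f') (at x) \<Longrightarrow> partial_deriv 1 f x = f'"
  using partial_deriv_eq[of f "(*) f'" x 1] by (simp add: has_field_derivative_def)

lemma Ck_Suc_real:
  assumes "\<And>t. (f has_real_derivative f' t) (at t)" "Ck n f'"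
  shows "Ck (Suc n) f"
proof -
  have "partial_deriv 1 f = f'" by (rule ext) (rule partial_deriv_real[OF assms(1)])
  moreover have "f differentiable (at t)" for t
    using assms(1)[of t] by (auto simp: has_field_derivative_def differentiable_def)
  ultimately show ?thesis using assms(2) by simp
qed

lemma Ck_compose_real:
  fixes f :: "real \<Rightarrow> real"
  shows "Ck n f \<Longrightarrow> Ck n g \<Longrightarrow> Ck n (\<lambda>x. f (g x))"
proof (induction n arbitrary: f)
  case 0
  then show ?case using continuous_on_compose2[of UNIV f UNIV g] by simp
next
  case (Suc n)
  have f: "f differentiable (at x)" for x using Suc.prems(1) by simp
  have g: "g differentiable (at x)" for x using Suc.prems(2) by simp
  have "partial_deriv b (\<lambda>x. f (g x)) = (\<lambda>x. partial_deriv 1 f (g x) * partial_deriv b g x)" for b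
    by (rule ext) (rule partial_deriv_compose_real[OF has_real_derivative_partial_deriv[OF f] g])
  moreover have "Ck n (\<lambda>x. partial_deriv 1 f (g x) * partial_deriv b g x)" if "b \<in> Basis" for b
  proof (rule Ck_mult)
    show "Ck n (\<lambda>x. partial_deriv 1 f (g x))"
      by (rule Suc.IH[OF _ Ck_SucD[OF Suc.prems(2)]]) (use Suc.prems(1) in simp)
    show "Ck n (partial_deriv b g)" using Suc.prems(2) that by simp
  qed
  moreover have "(\<lambda>x. f (g x)) differentiable (at x)" for x
    using differentiable_chain_at[of g x f] f g by (simp add: o_def)
  ultimately show ?case by simp
qed

lemma Ck_inverse:
  fixes f :: "real \<Rightarrow> real"
  assumes "\<And>x. f x \<noteq> 0"
  shows "Ck n f \<Longrightarrow> Ck n (\<lambda>x. inverse (f x))"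
proof (induction n)
  case 0
  then show ?case using assms by (auto intro: continuous_on_inverse)
next
  case (Suc n)
  have f: "f differentiable (at x)" for x using Suc.prems by simp
  show ?case
  proof (rule Ck_Suc_real)
    fix t
    show "((\<lambda>x. inverse (f x)) has_real_derivative (-1) * (partial_deriv 1 f t * (inverse (f t) * inverse (f t)))) (at t)"
      using DERIV_inverse_fun[OF has_real_derivative_partial_deriv[OF f] assms, of t]
      by (simp add: mult.assoc mult.left_commute)
    have "Ck n (\<lambda>x. inverse (f x))" by (rule Suc.IH[OF Ck_SucD[OF Suc.prems]])
    moreover have "Ck n (partial_deriv 1 f)" using Suc.prems by simp
    ultimately show "Ck n (\<lambda>t. (-1) * (partial_deriv 1 f t * (inverse (f t) * inverse (f t))))"
      by (intro Ck_mult Ck_const)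
  qed
qed

text \<open>For \<open>n = 0\<close> this is the classical smooth function that is flat at the
  origin; the other members of the family are needed because differentiation produces powers of
  \<open>1/t\<close>, and the family is closed under differentiation up to linear
  combinations.\<close>
definition flat :: "nat \<Rightarrow> real \<Rightarrow> real" where
  "flat n t = (if t > 0 then (1/t) ^ n / exp (1/t) else 0)"

lemma flat_tendsto_0: "(flat n \<longlongrightarrow> 0) (at 0)"
proof (rule filterlim_split_at)
  have "\<forall>\<^sub>F t in at_left 0. 0 = flat n t"
    by (auto simp: flat_def eventually_at_filter intro!: always_eventually)
  then show "(flat n \<longlongrightarrow> 0) (at_left 0)" by (rule tendsto_eventually[OF eventually_mono]) simp
  have "((\<lambda>t. inverse t ^ n / exp (inverse t)) \<longlongrightarrow> 0) (at_right (0::real))"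
    by (rule filterlim_compose[OF tendsto_power_div_exp_0 filterlim_inverse_at_top_right])
  moreover have "\<forall>\<^sub>F t in at_right 0. inverse t ^ n / exp (inverse t) = flat n t"
    by (auto simp: flat_def eventually_at_filter inverse_eq_divide intro!: always_eventually)
  ultimately show "(flat n \<longlongrightarrow> 0) (at_right 0)" by (rule Lim_transform_eventually)
qed

lemma flat_deriv: "(flat n has_real_derivative (- real n) * flat (Suc n) t + flat (Suc (Suc n)) t) (at t)"
proof (cases t "0::real" rule: linorder_cases)
  case less
  have "((\<lambda>t. 0) has_real_derivative 0) (at t)" by simp
  then have "(flat n has_real_derivative 0) (at t)"
    by (rule has_field_derivative_transform_within_open[of _ _ _ "{..<0}"]) (use less in \<open>auto simp: flat_def\<close>)
  then show ?thesis using less by (simp add: flat_def)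
next
  case equal
  have "(\<lambda>h. (flat n (0 + h) - flat n 0) / h) = flat (Suc n)"
    by (auto simp: flat_def fun_eq_iff)
  then have "(flat n has_real_derivative 0) (at 0)"
    unfolding DERIV_def using flat_tendsto_0[of "Suc n"] by simp
  then show ?thesis using equal by (simp add: flat_def)
next
  case greater
  have "((\<lambda>t. (1/t) ^ n * exp (- (1/t))) has_real_derivative
     (- real n) * ((1/t) ^ Suc n * exp (- (1/t))) + (1/t) ^ Suc (Suc n) * exp (- (1/t))) (at t)"
  proof -
    have i: "((\<lambda>t. 1/t) has_real_derivative - ((1/t) * (1/t))) (at t)"
      using greater by (auto intro!: derivative_eq_intros)
    have p: "((\<lambda>t. (1/t) ^ n) has_real_derivative (- real n) * (1/t) ^ Suc n) (at t)"
    proof (cases n)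
      case (Suc m)
      have "real n * (- (1 / t * (1 / t)) * (1 / t) ^ (n - Suc 0)) = (- real n) * (1/t) ^ Suc n"
        unfolding Suc diff_Suc_Suc diff_zero power_Suc by algebra
      then show ?thesis using DERIV_power[OF i, of n] by (simp only:)
    qed simp
    have e: "((\<lambda>t. exp (- (1/t))) has_real_derivative exp (- (1/t)) * ((1/t) * (1/t))) (at t)"
      using DERIV_chain2[OF DERIV_exp DERIV_minus[OF i]] by simp
    have "(- real n) * (1/t) ^ Suc n * exp (- (1/t)) + exp (- (1/t)) * ((1/t) * (1/t)) * (1/t) ^ n
       = (- real n) * ((1/t) ^ Suc n * exp (- (1/t))) + (1/t) ^ Suc (Suc n) * exp (- (1/t))"
      unfolding power_Suc by algebra
    with DERIV_mult[OF p e] show ?thesis by (simp only:)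
  qed
  then have "(flat n has_real_derivative (- real n) * ((1/t) ^ Suc n * exp (- (1/t))) + (1/t) ^ Suc (Suc n) * exp (- (1/t))) (at t)"
    by (rule has_field_derivative_transform_within_open[of _ _ _ "{0<..}"])
      (use greater in \<open>auto simp: flat_def exp_minus divide_inverse\<close>)
  then show ?thesis using greater by (simp add: flat_def exp_minus divide_inverse)
qed

lemma Ck_flat: "Ck m (flat n)"
proof (induction m arbitrary: n)
  case 0
  have "isCont (flat n) t" for t by (rule DERIV_isCont[OF flat_deriv])
  then show ?case by (simp add: continuous_on_eq_continuous_at)
next
  case (Suc m)
  show ?case
    by (rule Ck_Suc_real[OF flat_deriv]) (intro Ck_add Ck_mult Ck_const Suc.IH)
qed

text \<open>The quotient \<open>a / (a + b)\<close> of shifted flat functions. Its first two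
  derivatives are bounded because they vanish outside a compact interval; beyond \<open>2\<close>
  they vanish since the function is locally constant there.\<close>
lemma smooth_step:
  obtains \<theta> \<theta>' \<theta>'' :: "real \<Rightarrow> real" and M where
    "\<And>n. Ck n \<theta>" "\<And>t. t \<le> 1 \<Longrightarrow> \<theta> t = 0" "\<And>t. t \<ge> 2 \<Longrightarrow> \<theta> t = 1" "\<And>t. 0 \<le> \<theta> t" "\<And>t. \<theta> t \<le> 1"
    "\<And>t. (\<theta> has_real_derivative \<theta>' t) (at t)" "\<And>t. (\<theta>' has_real_derivative \<theta>'' t) (at t)"
    "\<And>t. t > 2 \<Longrightarrow> \<theta>' t = 0" "\<And>t. t > 2 \<Longrightarrow> \<theta>'' t = 0"
    "\<And>t. \<bar>\<theta>' t\<bar> \<le> M" "\<And>t. \<bar>\<theta>'' t\<bar> \<le> M"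
proof -
  define a where "a t = flat 0 (t - 1)" for t
  define b where "b t = flat 0 (2 - t)" for t
  define \<theta> where "\<theta> t = a t * inverse (a t + b t)" for t
  have lin: "Ck n (\<lambda>t::real. c * t + d)" for n c d
  proof (cases n)
    case (Suc m)
    show ?thesis unfolding Suc
      by (rule Ck_Suc_real[of _ "\<lambda>_. c"]) (auto intro!: derivative_eq_intros Ck_const)
  qed (auto intro!: continuous_intros)
  have Ca: "Ck n a" and Cb: "Ck n b" for n
    using Ck_compose_real[OF Ck_flat lin[of n 1 "-1"], of 0] Ck_compose_real[OF Ck_flat lin[of n "-1" 2], of 0]
    by (simp_all add: a_def[abs_def] b_def[abs_def])
  have a0: "a t \<ge> 0" "b t \<ge> 0" "a t + b t > 0" for t
    by (auto simp: a_def b_def flat_def add_pos_pos)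
  have C: "Ck n \<theta>" for n
    unfolding \<theta>_def[abs_def] using a0(3) by (intro Ck_mult Ca Ck_inverse Ck_add Cb) (metis less_irrefl)
  have t1: "\<theta> t = 0" if "t \<le> 1" for t using that by (simp add: \<theta>_def a_def flat_def)
  have t2: "\<theta> t = 1" if "t \<ge> 2" for t
    using that a0(3)[of t] by (simp add: \<theta>_def b_def flat_def)
  have b01: "0 \<le> \<theta> t" "\<theta> t \<le> 1" for t
    using a0[of t] by (auto simp: \<theta>_def field_simps)
  let ?d = "partial_deriv (1::real)"
  have d: "(\<theta> has_real_derivative ?d \<theta> t) (at t)" "(?d \<theta> has_real_derivative ?d (?d \<theta>) t) (at t)" for t
    using C[of 2] by (auto intro!: has_real_derivative_partial_deriv simp: numeral_2_eq_2)
  have c: "continuous_on UNIV (?d \<theta>)" "continuous_on UNIV (?d (?d \<theta>))"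
    using Ck_SucD[of 0 "?d \<theta>"] C[of 2] by (auto simp: numeral_2_eq_2)
  have locc: "(v has_real_derivative y) (at t) \<Longrightarrow> open S \<Longrightarrow> t \<in> S \<Longrightarrow> (\<And>s. s \<in> S \<Longrightarrow> v s = c) \<Longrightarrow> y = 0"
    for v :: "real \<Rightarrow> real" and y t S c
  proof -
    assume v: "(v has_real_derivative y) (at t)" and S: "open S" "t \<in> S" "\<And>s. s \<in> S \<Longrightarrow> v s = c"
    have "((\<lambda>s. c) has_real_derivative 0) (at t)" by simp
    then have "(v has_real_derivative 0) (at t)"
      by (rule has_field_derivative_transform_within_open[OF _ S(1,2)]) (simp add: S(3))
    with v show "y = 0" by (rule DERIV_unique)
  qed
  have z1: "?d \<theta> t = 0" if "t > 2" for t
    by (rule locc[OF d(1), of "{2<..}" t 1]) (use that t2 in auto)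
  have z2: "?d (?d \<theta>) t = 0" if "t > 2" for t
    by (rule locc[OF d(2), of "{2<..}" t 0]) (use that z1 in auto)
  have y1: "?d \<theta> t = 0" if "t < 1" for t
    by (rule locc[OF d(1), of "{..<1}" t 0]) (use that t1 in auto)
  have y2: "?d (?d \<theta>) t = 0" if "t < 1" for t
    by (rule locc[OF d(2), of "{..<1}" t 0]) (use that y1 in auto)
  have bd: "\<exists>M. \<forall>t. \<bar>v t\<bar> \<le> M" if "continuous_on UNIV v" "\<And>t. t > 2 \<Longrightarrow> v t = 0" "\<And>t. t < 1 \<Longrightarrow> v t = 0"
    for v :: "real \<Rightarrow> real"
  proof -
    have "compact (v ` {1..2})"
      by (rule compact_continuous_image[OF continuous_on_subset[OF that(1) subset_UNIV] compact_Icc])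
    from compact_imp_bounded[OF this] obtain M where M: "\<forall>y\<in>v ` {1..2}. norm y \<le> M"
      unfolding bounded_iff by blast
    have "\<bar>v t\<bar> \<le> \<bar>M\<bar>" for t
    proof (cases "t \<in> {1..2}")
      case True
      then have "\<bar>v t\<bar> \<le> M" using M by simp
      then show ?thesis by simp
    qed (use that(2)[of t] that(3)[of t] in auto)
    then show ?thesis by blast
  qed
  obtain M1 where M1: "\<And>t. \<bar>?d \<theta> t\<bar> \<le> M1" using bd[OF c(1) z1 y1] by blast
  obtain M2 where M2: "\<And>t. \<bar>?d (?d \<theta>) t\<bar> \<le> M2" using bd[OF c(2) z2 y2] by blast
  show thesis
    by (rule that[of \<theta> "?d \<theta>" "?d (?d \<theta>)" "max M1 M2", OF C t1 t2 b01 d z1 z2])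
      (use M1 M2 in \<open>auto simp: le_max_iff_disj\<close>)
qed

text \<open>The argument of the step function is at most \<open>1\<close> as soon as \<open>(norm
  x)\<^sup>2 \<ge> r\<^sup>2 - d\<close>, which keeps the support away from the sphere.\<close>
lemma test_function_cutoff:
  fixes v :: "'a::euclidean_space \<Rightarrow> real"
  assumes \<theta>: "\<And>n. Ck n \<theta>" "\<And>t. t \<le> 1 \<Longrightarrow> \<theta> t = 0" and d: "d > 0" and r: "r > 0" and v: "real_polynomial_function v"
  shows "test_function_on (ball 0 r) (\<lambda>x. \<theta> ((r\<^sup>2 - (norm x)\<^sup>2) / d) * v x)"
  unfolding test_function_on_def
proof (intro conjI allI)
  let ?\<psi> = "\<lambda>x. \<theta> ((r\<^sup>2 - (norm x)\<^sup>2) / d) * v x"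
  have "real_polynomial_function (\<lambda>x::'a. (r\<^sup>2 - (norm x)\<^sup>2) / d)"
    by (rule real_polynomial_function_divide[OF real_polynomial_function_diff[OF rpf_const rpf_norm_power2]])
  then have "Ck n (\<lambda>x::'a. (r\<^sup>2 - (norm x)\<^sup>2) / d)" for n by (rule Ck_rpf)
  then show "Ck n ?\<psi>" for n
    by (rule Ck_mult[OF Ck_compose_real[OF \<theta>(1)] Ck_rpf[OF v]])
  let ?S = "{x::'a. (norm x)\<^sup>2 \<le> r\<^sup>2 - d}"
  have S: "closed ?S" by (intro closed_Collect_le continuous_intros)
  have "{x. ?\<psi> x \<noteq> 0} \<subseteq> ?S"
  proof
    fix x assume "x \<in> {x. ?\<psi> x \<noteq> 0}"
    then have "\<theta> ((r\<^sup>2 - (norm x)\<^sup>2) / d) \<noteq> 0" by simp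
    then have "(r\<^sup>2 - (norm x)\<^sup>2) / d > 1" using \<theta>(2) by (metis not_le)
    then show "x \<in> ?S" using d by (simp add: field_simps)
  qed
  then have cl: "closure {x. ?\<psi> x \<noteq> 0} \<subseteq> ?S" by (rule closure_minimal[OF _ S])
  have SB: "?S \<subseteq> ball 0 r"
  proof
    fix x assume "x \<in> ?S"
    then have "(norm x)\<^sup>2 < r\<^sup>2" using d by simp
    then show "x \<in> ball 0 r" using r by (simp add: power2_less_imp_less)
  qed
  with cl show "closure {x. ?\<psi> x \<noteq> 0} \<subseteq> ball 0 r" by blast
  with bounded_ball[of 0 r] have "bounded (closure {x. ?\<psi> x \<noteq> 0})" by (rule bounded_subset)
  then show "compact (closure {x. ?\<psi> x \<noteq> 0})" by (simp add: compact_eq_bounded_closed)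
qed

section \<open>The Dunkl operator on twice continuously differentiable functions\<close>

lemma Ck2D:
  assumes "Ck 2 u"
  shows "u differentiable (at x)" "b \<in> Basis \<Longrightarrow> partial_deriv b u differentiable (at x)"
    "b \<in> Basis \<Longrightarrow> c \<in> Basis \<Longrightarrow> continuous_on UNIV (partial_deriv c (partial_deriv b u))"
  using assms by (auto simp: numeral_2_eq_2)

lemma Ck2_partial_deriv:
  assumes "Ck 2 u"
  shows "partial_deriv a u differentiable (at x)"
    "continuous_on UNIV (partial_deriv a (partial_deriv a u))"
proof -
  have e: "partial_deriv a u = (\<lambda>x. \<Sum>b\<in>Basis. (a \<bullet> b) * partial_deriv b u x)"
    using Ck2D(1)[OF assms] by (intro ext partial_deriv_sum_basis)
  have d: "((\<lambda>x. \<Sum>b\<in>Basis. (a \<bullet> b) * partial_deriv b u x) has_derivative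
      (\<lambda>h. \<Sum>b\<in>Basis. (a \<bullet> b) * partial_deriv h (partial_deriv b u) x)) (at x)" for x
    by (intro has_derivative_sum has_derivative_mult_right has_derivative_partial_deriv Ck2D(2)[OF assms])
  show "partial_deriv a u differentiable (at x)"
    unfolding e using d[of x] by (auto simp: differentiable_def)
  have "partial_deriv a (partial_deriv a u) x = (\<Sum>b\<in>Basis. (a \<bullet> b) * partial_deriv a (partial_deriv b u) x)" for x
    unfolding e by (rule partial_deriv_eq[OF d])
  also have "\<dots> x = (\<Sum>b\<in>Basis. (a \<bullet> b) * (\<Sum>c\<in>Basis. (a \<bullet> c) * partial_deriv c (partial_deriv b u) x))" for x
    by (intro sum.cong refl arg_cong[where f = "\<lambda>y. _ * y"] partial_deriv_sum_basis Ck2D(2)[OF assms])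
  finally have e2: "partial_deriv a (partial_deriv a u)
     = (\<lambda>x. \<Sum>b\<in>Basis. (a \<bullet> b) * (\<Sum>c\<in>Basis. (a \<bullet> c) * partial_deriv c (partial_deriv b u) x))"
    by (rule ext)
  show "continuous_on UNIV (partial_deriv a (partial_deriv a u))"
    unfolding e2 by (intro continuous_intros Ck2D(3)[OF assms])
qed

lemma has_real_derivative_along_line:
  assumes v: "v differentiable (at (x + s *\<^sub>R b))"
  shows "((\<lambda>s. v (x + s *\<^sub>R b)) has_real_derivative partial_deriv b v (x + s *\<^sub>R b)) (at s)"
  unfolding has_field_derivative_def
proof (rule has_derivative_eq_rhs)
  show "((\<lambda>s. v (x + s *\<^sub>R b)) has_derivative (\<lambda>h. partial_deriv (h *\<^sub>R b) v (x + s *\<^sub>R b))) (at s)"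
    by (rule has_derivative_compose[of "\<lambda>s. x + s *\<^sub>R b" "\<lambda>h. h *\<^sub>R b" s UNIV v
          "\<lambda>h. partial_deriv h v (x + s *\<^sub>R b)"])
      (auto intro!: derivative_eq_intros has_derivative_partial_deriv v)
qed (simp add: fun_eq_iff partial_deriv_scaleR[OF v])

text \<open>Lagrange's remainder writes the Taylor quotient as a second derivative at an
  intermediate point; this controls it where the step length tends to zero.\<close>
lemma taylor2_Lagrange:
  assumes u: "Ck 2 u"
  shows "\<exists>\<xi>. \<bar>\<xi>\<bar> \<le> \<bar>t\<bar> \<and> taylor2 b u x t = partial_deriv b (partial_deriv b u) (x + \<xi> *\<^sub>R b) / 2"
proof (cases "t = 0")
  case True
  then show ?thesis by (intro exI[of _ 0]) (simp add: taylor2_def)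
next
  case False
  define diff where "diff = (\<lambda>(m::nat) s. if m = 0 then u (x + s *\<^sub>R b) else if m = 1 then partial_deriv b u (x + s *\<^sub>R b)
     else partial_deriv b (partial_deriv b u) (x + s *\<^sub>R b))"
  have "\<exists>s. \<bar>s\<bar> \<le> \<bar>t\<bar> \<and> u (x + t *\<^sub>R b) = (\<Sum>m<2. diff m 0 / fact m * t ^ m) + diff 2 s / fact 2 * t ^ 2"
  proof (rule Maclaurin_bi_le)
    show "\<forall>m s. m < 2 \<and> \<bar>s\<bar> \<le> \<bar>t\<bar> \<longrightarrow> (diff m has_real_derivative diff (Suc m) s) (at s)"
    proof (intro allI impI)
      fix m :: nat and s assume "m < 2 \<and> \<bar>s\<bar> \<le> \<bar>t\<bar>"
      then have "m = 0 \<or> m = 1" by auto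
      then show "(diff m has_real_derivative diff (Suc m) s) (at s)"
        using has_real_derivative_along_line[of u x s b] has_real_derivative_along_line[of "partial_deriv b u" x s b] Ck2D(1)[OF u] Ck2_partial_deriv(1)[OF u]
        by (auto simp: diff_def)
    qed
  qed (simp add: diff_def)
  then obtain s where s: "\<bar>s\<bar> \<le> \<bar>t\<bar>" "u (x + t *\<^sub>R b) = u x + t * partial_deriv b u x
     + t\<^sup>2 * (partial_deriv b (partial_deriv b u) (x + s *\<^sub>R b) / 2)"
    by (auto simp: numeral_2_eq_2 diff_def mult.commute)
  from s(2) have "t\<^sup>2 * taylor2 b u x t = t\<^sup>2 * (partial_deriv b (partial_deriv b u) (x + s *\<^sub>R b) / 2)"
    unfolding taylor2[of u x t b] by simp
  with s(1) False show ?thesis by auto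
qed

text \<open>Away from the mirror this is a quotient with nonzero denominator. At a point of the
  mirror the intermediate point of the Lagrange remainder is squeezed towards that point, because
  the step length tends to zero.\<close>
lemma continuous_taylor2_reflect:
  assumes u: "Ck 2 u"
  shows "continuous_on UNIV (\<lambda>x. taylor2 \<alpha> u x (refl_step \<alpha> x))"
    (is "continuous_on UNIV ?T")
proof -
  let ?s = "\<lambda>x. - 2 * (\<alpha> \<bullet> x) / (norm \<alpha>)\<^sup>2"
  let ?D = "\<lambda>x. partial_deriv \<alpha> (partial_deriv \<alpha> u) x / 2"
  have cs: "continuous_on UNIV ?s" by (cases "\<alpha> = 0") (auto intro!: continuous_intros)
  have cu: "continuous_on S u" "continuous_on S (partial_deriv \<alpha> u)" for S
    using Ck2D(1)[OF u] Ck2_partial_deriv(1)[OF u]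
    by (auto intro!: differentiable_imp_continuous_on simp: differentiable_on_def differentiable_at_withinI)
  have "isCont ?T x0" for x0
  proof (cases "?s x0 = 0")
    case False
    have o: "open {x. ?s x \<noteq> 0}"
      by (rule open_Collect_neq[OF cs]) (intro continuous_intros)
    have "continuous_on {x. ?s x \<noteq> 0} (\<lambda>x. (u (x + ?s x *\<^sub>R \<alpha>) - u x - ?s x * partial_deriv \<alpha> u x) / (?s x)\<^sup>2)"
      by (intro continuous_intros cu continuous_on_subset[OF cs] continuous_on_compose2[OF cu(1)[of UNIV]]) auto
    then have "continuous_on {x. ?s x \<noteq> 0} ?T"
      by (rule continuous_on_eq) (simp add: taylor2_def)
    with o False show ?thesis by (simp add: continuous_on_eq_continuous_at)
  next
    case True
    obtain \<xi> where xi: "\<And>x. \<bar>\<xi> x\<bar> \<le> \<bar>?s x\<bar>" "\<And>x. ?T x = ?D (x + \<xi> x *\<^sub>R \<alpha>)"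
    proof -
      have "\<forall>x. \<exists>\<xi>. \<bar>\<xi>\<bar> \<le> \<bar>?s x\<bar> \<and> ?T x = ?D (x + \<xi> *\<^sub>R \<alpha>)"
        by (intro allI taylor2_Lagrange[OF u])
      from choice[OF this] that show thesis by blast
    qed
    have "isCont ?s x0" using cs by (simp add: continuous_on_eq_continuous_at)
    then have "(?s \<longlongrightarrow> ?s x0) (at x0)" unfolding isCont_def .
    then have "(?s \<longlongrightarrow> 0) (at x0)" by (simp only: True)
    then have "((\<lambda>x. \<bar>?s x\<bar>) \<longlongrightarrow> 0) (at x0)" by (rule tendsto_rabs_zero)
    then have "(\<xi> \<longlongrightarrow> 0) (at x0)"
      by (rule Lim_null_comparison[rotated]) (use xi(1) in \<open>auto intro!: always_eventually\<close>)
    then have "((\<lambda>x. x + \<xi> x *\<^sub>R \<alpha>) \<longlongrightarrow> x0 + 0 *\<^sub>R \<alpha>) (at x0)" by (intro tendsto_intros)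
    then have lim: "((\<lambda>x. x + \<xi> x *\<^sub>R \<alpha>) \<longlongrightarrow> x0) (at x0)" by simp
    have "isCont ?D x0"
      using Ck2_partial_deriv(2)[OF u, of \<alpha>] by (auto simp: continuous_on_eq_continuous_at intro!: continuous_intros)
    from isCont_tendsto_compose[OF this lim] have "(?T \<longlongrightarrow> ?D x0) (at x0)" by (simp only: xi(2))
    moreover have "?T x0 = ?D x0" using True by (simp add: taylor2_def)
    ultimately show ?thesis unfolding isCont_def by (simp only:)
  qed
  then show ?thesis by (simp add: continuous_on_eq_continuous_at)
qed

lemma continuous_on_dunkl_op:
  assumes u: "Ck 2 u"
  shows "continuous_on UNIV (dunkl_op R k u)"
proof -
  have "(\<lambda>x. 2 * taylor2 b u x 0) = partial_deriv b (partial_deriv b u)" for b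
    by (simp add: taylor2_def fun_eq_iff)
  then have "continuous_on UNIV (\<lambda>x. 2 * taylor2 b u x 0)" for b
    by (simp only: Ck2_partial_deriv(2)[OF u, of b])
  then have "continuous_on UNIV (\<lambda>x. \<Sum>b\<in>Basis. 2 * taylor2 b u x 0)"
    by (intro continuous_on_sum)
  moreover have "continuous_on UNIV (\<lambda>x. \<Sum>\<alpha>\<in>R. k \<alpha> * (2 / (norm \<alpha>)\<^sup>2) * taylor2 \<alpha> u x (refl_step \<alpha> x))"
    by (intro continuous_on_sum continuous_on_mult continuous_on_const continuous_taylor2_reflect u)
  ultimately show ?thesis
    unfolding dunkl_op_def[abs_def] by (rule continuous_on_add)
qed

section \<open>Integration over Euclidean space\<close>

lemma nn_integral_lborel_translate:
  fixes g :: "'a::euclidean_space \<Rightarrow> ennreal"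
  assumes [measurable]: "g \<in> borel_measurable borel"
  shows "(\<integral>\<^sup>+x. g (x + a) \<partial>lborel) = (\<integral>\<^sup>+x. g x \<partial>lborel)"
proof -
  have "(\<integral>\<^sup>+x. g x \<partial>lborel) = (\<integral>\<^sup>+x. g x \<partial>distr lborel borel ((+) a))"
    by (simp add: lborel_distr_plus)
  also have "\<dots> = (\<integral>\<^sup>+x. g (x + a) \<partial>lborel)"
    by (subst nn_integral_distr) (auto simp: add.commute)
  finally show ?thesis by simp
qed

text \<open>Averaging over the translates \<open>x + t *\<^sub>R b\<close> with \<open>0 \<le> t
  \<le> 1\<close> does not change an integral over the whole space. This turns a statement about
  integration along lines in direction \<open>b\<close> into one about the full integral, without
  choosing coordinates adapted to \<open>b\<close>.\<close>
lemma nn_integral_average_translates: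
  fixes g :: "'a::euclidean_space \<Rightarrow> ennreal"
  assumes [measurable]: "g \<in> borel_measurable borel"
  shows "(\<integral>\<^sup>+x. (\<integral>\<^sup>+t. indicator {0..1} t * g (x + t *\<^sub>R b) \<partial>lborel) \<partial>lborel) = (\<integral>\<^sup>+x. g x \<partial>lborel)"
proof -
  have "(\<integral>\<^sup>+x. (\<integral>\<^sup>+t. indicator {0..1} t * g (x + t *\<^sub>R b) \<partial>lborel) \<partial>lborel)
      = (\<integral>\<^sup>+t. (\<integral>\<^sup>+x. indicator {0..1::real} t * g (x + t *\<^sub>R b) \<partial>lborel) \<partial>lborel)"
    by (rule lborel_pair.Fubini'[symmetric]) measurable
  also have "\<dots> = (\<integral>\<^sup>+t. (\<integral>\<^sup>+x. g x \<partial>lborel) * indicator {0..1::real} t \<partial>lborel)"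
    by (intro nn_integral_cong) (simp add: nn_integral_cmult nn_integral_lborel_translate mult.commute)
  also have "\<dots> = (\<integral>\<^sup>+x. g x \<partial>lborel)"
    by (simp add: nn_integral_cmult_indicator)
  finally show ?thesis .
qed

lemma integrable_average_translates:
  fixes g :: "'a::euclidean_space \<Rightarrow> real"
  assumes g: "integrable lborel g"
  shows "integrable (lborel \<Otimes>\<^sub>M lborel) (\<lambda>(x, t). indicator {0..1} t * g (x + t *\<^sub>R b))"
proof (rule integrableI_bounded)
  have [measurable]: "g \<in> borel_measurable borel" using g by simp
  show "(\<lambda>(x, t). indicator {0..1} t * g (x + t *\<^sub>R b)) \<in> borel_measurable (lborel \<Otimes>\<^sub>M lborel)"
    by measurable
  have "(\<integral>\<^sup>+z. ennreal (norm (case z of (x, t) \<Rightarrow> indicator {0..1} t * g (x + t *\<^sub>R b))) \<partial>(lborel \<Otimes>\<^sub>M lborel))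
     = (\<integral>\<^sup>+z. (case z of (x, t) \<Rightarrow> indicator {0..1::real} t * ennreal (norm (g (x + t *\<^sub>R b)))) \<partial>(lborel \<Otimes>\<^sub>M lborel))"
    by (intro nn_integral_cong) (auto simp: indicator_def)
  also have "\<dots> = (\<integral>\<^sup>+x. (\<integral>\<^sup>+t. indicator {0..1} t * ennreal (norm (g (x + t *\<^sub>R b))) \<partial>lborel) \<partial>lborel)"
    by (subst lborel.nn_integral_fst[symmetric]) auto
  also have "\<dots> = (\<integral>\<^sup>+x. ennreal (norm (g x)) \<partial>lborel)"
    by (rule nn_integral_average_translates[where g = "\<lambda>x. ennreal (norm (g x))"]) measurable
  also have "\<dots> < \<infinity>" using g by (simp add: integrable_iff_bounded)
  finally show "(\<integral>\<^sup>+z. ennreal (norm (case z of (x, t) \<Rightarrow> indicator {0..1} t * g (x + t *\<^sub>R b))) \<partial>(lborel \<Otimes>\<^sub>M lborel)) < \<infinity>" .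
qed

lemma integral_lborel_translate:
  fixes g :: "'a::euclidean_space \<Rightarrow> real"
  assumes [measurable]: "g \<in> borel_measurable borel"
  shows "(\<integral>x. g (x + a) \<partial>lborel) = (\<integral>x. g x \<partial>lborel)"
proof -
  have "(\<integral>x. g x \<partial>lborel) = (\<integral>x. g x \<partial>distr lborel borel ((+) a))"
    by (simp add: lborel_distr_plus)
  also have "\<dots> = (\<integral>x. g (x + a) \<partial>lborel)"
    by (subst integral_distr) (auto simp: add.commute)
  finally show ?thesis by simp
qed

lemma integral_average_translates:
  fixes g :: "'a::euclidean_space \<Rightarrow> real"
  assumes g: "integrable lborel g"
  shows "(\<integral>x. (\<integral>t. indicator {0..1} t * g (x + t *\<^sub>R b) \<partial>lborel) \<partial>lborel) = (\<integral>x. g x \<partial>lborel)"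
proof -
  have [measurable]: "g \<in> borel_measurable borel" using g by simp
  have "(\<integral>x. (\<integral>t. indicator {0..1} t * g (x + t *\<^sub>R b) \<partial>lborel) \<partial>lborel)
      = (\<integral>t. (\<integral>x. indicator {0..1} t * g (x + t *\<^sub>R b) \<partial>lborel) \<partial>lborel)"
    by (rule lborel_pair.Fubini_integral[symmetric, OF integrable_average_translates[OF g]])
  also have "\<dots> = (\<integral>t. indicator {0..1::real} t *\<^sub>R (\<integral>x. g x \<partial>lborel) \<partial>lborel)"
    by (intro Bochner_Integration.integral_cong refl) (simp add: integral_lborel_translate)
  also have "\<dots> = (\<integral>x. g x \<partial>lborel)"
    by simp
  finally show ?thesis .
qed

text \<open>By the fundamental theorem of calculus the average of \<open>G\<close> over a segment is
  the difference of \<open>F\<close> at its end points, and the two resulting integrals of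
  \<open>F\<close> agree by translation invariance. The derivative may fail to exist at finitely
  many points of each line, which is what happens where the line crosses a mirror.\<close>
lemma integral_directional_derivative_eq_0:
  fixes F G :: "'a::euclidean_space \<Rightarrow> real"
  assumes F: "continuous_on UNIV F" "integrable lborel F" and G: "integrable lborel G"
    and S: "AE x in lborel. x \<in> S"
    and fin: "\<And>x. x \<in> S \<Longrightarrow> finite {t. x + t *\<^sub>R b \<notin> S}"
    and deriv: "\<And>x. x \<in> S \<Longrightarrow> ((\<lambda>t. F (x + t *\<^sub>R b)) has_real_derivative G x) (at 0)"
  shows "(\<integral>x. G x \<partial>lborel) = 0"
proof -
  have [measurable]: "F \<in> borel_measurable borel" "G \<in> borel_measurable borel" using F G by auto
  have "AE x in lborel. integrable lborel (\<lambda>t. indicator {0..1} t * G (x + t *\<^sub>R b))"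
    using lborel_pair.AE_integrable_fst[OF integrable_average_translates[OF G]] by simp
  with S have "AE x in lborel. (\<integral>t. indicator {0..1} t * G (x + t *\<^sub>R b) \<partial>lborel) = F (x + b) - F x"
  proof eventually_elim
    case (elim x)
    have "((\<lambda>t. G (x + t *\<^sub>R b)) has_integral F (x + 1 *\<^sub>R b) - F (x + 0 *\<^sub>R b)) {0..1}"
    proof (rule fundamental_theorem_of_calculus_interior_strong[OF fin[OF elim(1)]])
      show "continuous_on {0..1} (\<lambda>t. F (x + t *\<^sub>R b))"
        by (intro continuous_on_compose2[OF F(1)] continuous_intros) auto
      fix t :: real assume t: "t \<in> {0<..<1} - {t. x + t *\<^sub>R b \<notin> S}"
      then have "((\<lambda>s. F ((x + t *\<^sub>R b) + s *\<^sub>R b)) has_real_derivative G (x + t *\<^sub>R b)) (at 0)"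
        by (intro deriv) auto
      then have "((\<lambda>s. F (x + (s + t) *\<^sub>R b)) has_real_derivative G (x + t *\<^sub>R b)) (at 0)"
        by (simp add: algebra_simps)
      then have "((\<lambda>s. F (x + s *\<^sub>R b)) has_real_derivative G (x + t *\<^sub>R b)) (at (0 + t))"
        by (subst DERIV_shift)
      then show "((\<lambda>t. F (x + t *\<^sub>R b)) has_vector_derivative G (x + t *\<^sub>R b)) (at t)"
        by (simp add: has_real_derivative_iff_has_vector_derivative)
    qed simp
    moreover have "((\<lambda>t. G (x + t *\<^sub>R b)) has_integral (\<integral>t. indicator {0..1} t * G (x + t *\<^sub>R b) \<partial>lborel)) {0..1}"
    proof -
      have "(\<lambda>t. indicator {0..1} t * G (x + t *\<^sub>R b)) = (\<lambda>t. if t \<in> {0..1} then G (x + t *\<^sub>R b) else 0)"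
        by (auto simp: fun_eq_iff indicator_def)
      with has_integral_integral_lborel[OF elim(2)] show ?thesis
        by (simp only: has_integral_restrict_UNIV)
    qed
    ultimately show ?case by (auto dest: has_integral_unique)
  qed
  then have "(\<integral>x. (\<integral>t. indicator {0..1} t * G (x + t *\<^sub>R b) \<partial>lborel) \<partial>lborel) = (\<integral>x. F (x + b) - F x \<partial>lborel)"
    by (intro integral_cong_AE) auto
  also have "\<dots> = (\<integral>x. F (x + b) \<partial>lborel) - (\<integral>x. F x \<partial>lborel)"
  proof (rule Bochner_Integration.integral_diff[OF _ F(2)])
    have "integrable (distr lborel borel ((+) b)) F" using F(2) by (simp add: lborel_distr_plus)
    then show "integrable lborel (\<lambda>x. F (x + b))"
      by (subst (asm) integrable_distr_eq) (auto simp: add.commute)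
  qed
  also have "\<dots> = 0" by (simp add: integral_lborel_translate)
  finally show ?thesis by (simp add: integral_average_translates[OF G])
qed

text \<open>The usual argument for uniqueness of Haar measure: integrate \<open>g (\<sigma>
  x)\<close> against the indicator of the unit ball, translate in both variables, and use that this
  indicator is even and invariant under \<open>\<sigma>\<close>.\<close>
lemma lborel_distr_linear_isometry_involution:
  fixes \<sigma> :: "'a::euclidean_space \<Rightarrow> 'a"
  assumes lin: "linear \<sigma>" and inv: "\<And>x. \<sigma> (\<sigma> x) = x" and iso: "\<And>x. norm (\<sigma> x) = norm x"
  shows "distr lborel borel \<sigma> = lborel"
proof -
  have bl: "bounded_linear \<sigma>" using lin by (simp add: linear_conv_bounded_linear)
  have "continuous_on UNIV \<sigma>" by (rule linear_continuous_on[OF bl])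
  then have [measurable]: "\<sigma> \<in> borel_measurable borel" by (rule borel_measurable_continuous_onI)
  have add: "\<sigma> (x + y) = \<sigma> x + \<sigma> y" for x y using lin by (rule linear_add)
  \<comment> \<open>Any function of the norm with finite positive integral would serve as \<open>?f\<close>.\<close>
  let ?f = "indicator (ball (0::'a) 1) :: 'a \<Rightarrow> ennreal"
  have [measurable]: "ball (0::'a) 1 \<in> sets borel" by simp
  let ?c = "\<integral>\<^sup>+x. ?f x \<partial>lborel"
  have c: "?c = emeasure lborel (ball (0::'a) 1)" by simp
  have c0: "?c \<noteq> 0" unfolding c using content_ball_pos[of 1 "0::'a"] by (auto simp: measure_def)
  have cinf: "?c \<noteq> \<infinity>" unfolding c using emeasure_lborel_ball_finite[of "0::'a" 1] by simp
  have feven: "?f (- x) = ?f x" "?f (\<sigma> x) = ?f x" for x using iso by (auto simp: indicator_def)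
  have main: "(\<integral>\<^sup>+x. g (\<sigma> x) \<partial>lborel) = (\<integral>\<^sup>+x. g x \<partial>lborel)" if [measurable]: "g \<in> borel_measurable borel" for g :: "'a \<Rightarrow> ennreal"
  proof -
    have "(\<integral>\<^sup>+x. g (\<sigma> x) \<partial>lborel) * ?c = (\<integral>\<^sup>+x. g (\<sigma> x) * ?c \<partial>lborel)"
      by (simp add: nn_integral_multc)
    also have "\<dots> = (\<integral>\<^sup>+x. (\<integral>\<^sup>+y. g (\<sigma> x) * ?f (y + (- \<sigma> x)) \<partial>lborel) \<partial>lborel)"
    proof (rule nn_integral_cong)
      fix x :: 'a
      have "(\<integral>\<^sup>+y. ?f (y + (- \<sigma> x)) \<partial>lborel) = ?c"
        by (rule nn_integral_lborel_translate) measurable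
      moreover have "(\<integral>\<^sup>+y. g (\<sigma> x) * ?f (y + (- \<sigma> x)) \<partial>lborel) = g (\<sigma> x) * (\<integral>\<^sup>+y. ?f (y + (- \<sigma> x)) \<partial>lborel)"
        by (rule nn_integral_cmult) measurable
      ultimately show "g (\<sigma> x) * ?c = (\<integral>\<^sup>+y. g (\<sigma> x) * ?f (y + (- \<sigma> x)) \<partial>lborel)" by (simp only:)
    qed
    also have "\<dots> = (\<integral>\<^sup>+y. (\<integral>\<^sup>+x. g (\<sigma> x) * ?f (y + (- \<sigma> x)) \<partial>lborel) \<partial>lborel)"
      by (rule lborel_pair.Fubini'[symmetric]) measurable
    also have "\<dots> = (\<integral>\<^sup>+y. (\<integral>\<^sup>+x. g (\<sigma> x + y) * ?f x \<partial>lborel) \<partial>lborel)"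
    proof (rule nn_integral_cong)
      fix y :: 'a
      have "(\<integral>\<^sup>+x. g (\<sigma> x) * ?f (y + (- \<sigma> x)) \<partial>lborel)
          = (\<integral>\<^sup>+x. g (\<sigma> (x + \<sigma> y)) * ?f (y + (- \<sigma> (x + \<sigma> y))) \<partial>lborel)"
        by (rule nn_integral_lborel_translate[symmetric, where g = "\<lambda>x. g (\<sigma> x) * ?f (y + (- \<sigma> x))"]) measurable
      also have "\<dots> = (\<integral>\<^sup>+x. g (\<sigma> x + y) * ?f x \<partial>lborel)"
        by (intro nn_integral_cong) (simp add: add inv feven)
      finally show "(\<integral>\<^sup>+x. g (\<sigma> x) * ?f (y + (- \<sigma> x)) \<partial>lborel) = (\<integral>\<^sup>+x. g (\<sigma> x + y) * ?f x \<partial>lborel)" .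
    qed
    also have "\<dots> = (\<integral>\<^sup>+x. (\<integral>\<^sup>+y. g (y + \<sigma> x) * ?f x \<partial>lborel) \<partial>lborel)"
      by (subst add.commute, rule lborel_pair.Fubini') measurable
    also have "\<dots> = (\<integral>\<^sup>+x. (\<integral>\<^sup>+y. g y \<partial>lborel) * ?f x \<partial>lborel)"
      by (intro nn_integral_cong, subst nn_integral_multc) (simp_all add: nn_integral_lborel_translate)
    also have "\<dots> = (\<integral>\<^sup>+x. g x \<partial>lborel) * ?c"
      by (rule nn_integral_cmult) measurable
    finally have "?c * (\<integral>\<^sup>+x. g (\<sigma> x) \<partial>lborel) = ?c * (\<integral>\<^sup>+x. g x \<partial>lborel)"
      by (simp only: mult.commute)
    then show ?thesis using c0 cinf unfolding ennreal_mult_cancel_left by auto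
  qed
  show ?thesis
  proof (rule measure_eqI)
    fix A assume "A \<in> sets (distr lborel borel \<sigma>)"
    then have A [measurable]: "A \<in> sets borel" by simp
    have "emeasure (distr lborel borel \<sigma>) A = (\<integral>\<^sup>+x. indicator A x \<partial>distr lborel borel \<sigma>)"
      using A by simp
    also have "\<dots> = (\<integral>\<^sup>+x. indicator A (\<sigma> x) \<partial>lborel)"
      by (rule nn_integral_distr) measurable
    also have "\<dots> = (\<integral>\<^sup>+x. indicator A x \<partial>lborel)" by (rule main) measurable
    also have "\<dots> = emeasure lborel A" using A by simp
    finally show "emeasure (distr lborel borel \<sigma>) A = emeasure lborel A" .
  qed simp
qed

lemma nn_integral_abs_powr_interval_finite:
  assumes s: "s > (-1::real)"
  shows "(\<integral>\<^sup>+t. indicator {-M..M} t * ennreal (\<bar>t\<bar> powr s) \<partial>lborel) < \<infinity>"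
proof (cases "M \<ge> 0")
  case True
  have 1: "((\<lambda>t. \<bar>t\<bar> powr s) has_integral (M powr (s+1) / (s+1))) {0..M}"
    by (rule has_integral_eq[OF _ has_integral_powr_from_0[OF s True]]) auto
  then have "((\<lambda>t. \<bar>- t\<bar> powr s) has_integral (M powr (s+1) / (s+1))) {- M..- 0}"
    by (subst has_integral_reflect_real) simp
  then have "((\<lambda>t. \<bar>t\<bar> powr s) has_integral (M powr (s+1) / (s+1))) {- M..0}" by simp
  from has_integral_combine[OF _ _ this 1] True
  have "((\<lambda>t. \<bar>t\<bar> powr s) has_integral (M powr (s+1) / (s+1) + M powr (s+1) / (s+1))) {-M..M}" by simp
  from nn_integral_has_integral_lebesgue[OF _ this]
  have "(\<integral>\<^sup>+t. ennreal (indicator {-M..M} t * (\<bar>t\<bar> powr s)) \<partial>lborel)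
     = ennreal (M powr (s+1) / (s+1) + M powr (s+1) / (s+1))" by simp
  moreover have "ennreal (indicator {-M..M} t * (\<bar>t\<bar> powr s)) = indicator {-M..M} t * ennreal (\<bar>t\<bar> powr s)" for t
    by (auto simp: indicator_def)
  ultimately show ?thesis by simp
next
  case False
  then have "{-M..M} = {}" by auto
  then show ?thesis by simp
qed

text \<open>Averaging over translates in the direction normal to the hyperplane reduces the claim to
  the integrability of \<open>\<bar>t\<bar> powr s\<close> near zero on the line.\<close>
lemma integrable_abs_inner_powr_ball:
  fixes a :: "'a::euclidean_space"
  assumes a: "a \<noteq> 0" and s: "s > (-1::real)"
  shows "integrable lborel (\<lambda>x. indicator (ball 0 r) x * \<bar>a \<bullet> x\<bar> powr s)"
proof (rule integrableI_bounded)
  have [measurable]: "ball (0::'a) r \<in> sets borel" by simp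
  have [measurable]: "(\<lambda>x. \<bar>a \<bullet> x\<bar> powr s) \<in> borel_measurable borel" by simp
  show "(\<lambda>x. indicator (ball 0 r) x * \<bar>a \<bullet> x\<bar> powr s) \<in> borel_measurable lborel" by simp
  \<comment> \<open>Normalised so that moving by \<open>t *\<^sub>R b\<close> changes \<open>a \<bullet> x\<close> by \<open>t\<close>.\<close>
  define b where "b = (1 / (a \<bullet> a)) *\<^sub>R a"
  have ab: "a \<bullet> b = 1" using a by (simp add: b_def)
  define M where "M = norm a * \<bar>r\<bar>"
  define C where "C = (\<integral>\<^sup>+t. indicator {-M..M} t * ennreal (\<bar>t\<bar> powr s) \<partial>lborel)"
  have C: "C < \<infinity>" unfolding C_def by (rule nn_integral_abs_powr_interval_finite[OF s])
  let ?g = "\<lambda>x::'a. indicator (ball 0 r) x * ennreal (\<bar>a \<bullet> x\<bar> powr s)"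
  have "(\<integral>\<^sup>+x. ennreal (norm (indicator (ball 0 r) x * \<bar>a \<bullet> x\<bar> powr s)) \<partial>lborel) = (\<integral>\<^sup>+x. ?g x \<partial>lborel)"
    by (intro nn_integral_cong) (auto simp: indicator_def)
  also have "\<dots> = (\<integral>\<^sup>+x. (\<integral>\<^sup>+t. indicator {0..1} t * ?g (x + t *\<^sub>R b) \<partial>lborel) \<partial>lborel)"
    by (rule nn_integral_average_translates[symmetric]) measurable
  also have "\<dots> \<le> (\<integral>\<^sup>+x. C * indicator (ball (0::'a) (r + norm b)) x \<partial>lborel)"
  proof (rule nn_integral_mono)
    fix x :: 'a
    show "(\<integral>\<^sup>+t. indicator {0..1} t * ?g (x + t *\<^sub>R b) \<partial>lborel) \<le> C * indicator (ball (0::'a) (r + norm b)) x"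
    proof (cases "x \<in> ball 0 (r + norm b)")
      case False
      have z: "indicator {0..1} t * ?g (x + t *\<^sub>R b) = 0" for t
      proof (cases "t \<in> {0..1} \<and> x + t *\<^sub>R b \<in> ball 0 r")
        case True
        have "norm x \<le> norm (x + t *\<^sub>R b) + norm (t *\<^sub>R b)"
          by (metis add_diff_cancel_right' norm_triangle_ineq4)
        moreover have "norm (t *\<^sub>R b) \<le> norm b" using True by (simp add: mult_left_le_one_le)
        ultimately show ?thesis using True False by simp
      qed (auto simp: indicator_def)
      show ?thesis unfolding z by simp
    next
      case True
      have "(\<integral>\<^sup>+t. indicator {0..1} t * ?g (x + t *\<^sub>R b) \<partial>lborel)
         \<le> (\<integral>\<^sup>+t. indicator {-M..M} (t + a \<bullet> x) * ennreal (\<bar>t + a \<bullet> x\<bar> powr s) \<partial>lborel)"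
      proof (rule nn_integral_mono)
        fix t :: real
        have e: "a \<bullet> (x + t *\<^sub>R b) = t + a \<bullet> x" by (simp add: inner_add_right ab)
        have "t + a \<bullet> x \<in> {-M..M}" if "x + t *\<^sub>R b \<in> ball 0 r"
        proof -
          have "\<bar>a \<bullet> (x + t *\<^sub>R b)\<bar> \<le> norm a * norm (x + t *\<^sub>R b)" by (rule Cauchy_Schwarz_ineq2)
          also have "\<dots> \<le> M" unfolding M_def using that by (intro mult_left_mono) auto
          finally show ?thesis unfolding e by (simp add: abs_le_iff)
        qed
        then show "indicator {0..1} t * ?g (x + t *\<^sub>R b)
           \<le> indicator {-M..M} (t + a \<bullet> x) * ennreal (\<bar>t + a \<bullet> x\<bar> powr s)"
          unfolding e by (auto simp: indicator_def)
      qed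
      also have "\<dots> = C" unfolding C_def
        by (rule nn_integral_lborel_translate[where g = "\<lambda>t. indicator {-M..M} t * ennreal (\<bar>t\<bar> powr s)"]) measurable
      finally show ?thesis using True by simp
    qed
  qed
  also have "\<dots> = C * emeasure lborel (ball (0::'a) (r + norm b))"
    by (simp add: nn_integral_cmult_indicator)
  also have "\<dots> < \<infinity>"
    using C emeasure_lborel_ball_finite[of "0::'a" "r + norm b"] by (simp add: ennreal_mult_less_top)
  finally show "(\<integral>\<^sup>+x. ennreal (norm (indicator (ball 0 r) x * \<bar>a \<bullet> x\<bar> powr s)) \<partial>lborel) < \<infinity>" .
qed

lemma AE_dense:
  assumes "AE y in lborel. P y" "e > 0"
  shows "\<exists>y::'a::euclidean_space. P y \<and> dist y x < e"
proof (rule ccontr)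
  assume "\<not> ?thesis"
  then have "\<not> P y" if "y \<in> ball x e" for y using that by (auto simp: dist_commute)
  with assms(1) have "AE y in lborel. y \<notin> ball x e"
    by (auto elim!: eventually_mono)
  then have "emeasure lborel (ball x e) = 0"
    by (subst (asm) AE_iff_measurable[of "ball x e"]) auto
  with content_ball_pos[OF assms(2), of x] show False by (simp add: measure_def)
qed

lemma continuous_on_eq_0_AE:
  fixes v :: "'a::euclidean_space \<Rightarrow> real"
  assumes "open S" "continuous_on S v" "AE x in lborel. x \<in> S \<longrightarrow> v x = 0" "x \<in> S"
  shows "v x = 0"
proof (rule ccontr)
  assume n: "v x \<noteq> 0"
  have "open (S \<inter> v -` (- {0}))"
    by (rule continuous_open_preimage[OF assms(2,1)]) auto
  then obtain e where e: "e > 0" "ball x e \<subseteq> S \<inter> v -` (- {0})"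
    using n assms(4) openE[of "S \<inter> v -` (- {0})" x] by auto
  obtain y where y: "y \<in> S \<longrightarrow> v y = 0" "dist y x < e" using AE_dense[OF assms(3) e(1)] by blast
  then have "y \<in> ball x e" by (simp add: dist_commute)
  then have "y \<in> S" "v y \<noteq> 0" using e(2) by auto
  with y(1) show False by simp
qed

lemma integrable_continuous_vanishing_outside_ball:
  fixes v :: "'a::euclidean_space \<Rightarrow> real"
  assumes "continuous_on UNIV v" "\<And>x. x \<notin> ball 0 r \<Longrightarrow> v x = 0"
  shows "integrable lborel v"
proof -
  have "integrable lborel (\<lambda>x. indicator (cball 0 r) x *\<^sub>R v x)"
    by (intro borel_integrable_compact compact_cball continuous_on_subset[OF assms(1)]) auto
  moreover have "(\<lambda>x. indicator (cball 0 r) x *\<^sub>R v x) = v"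
    using assms(2) by (fastforce simp: indicator_def)
  ultimately show ?thesis by simp
qed

lemma lborel_integral_reflect:
  fixes g :: "'a::euclidean_space \<Rightarrow> real"
  assumes "\<alpha> \<noteq> 0" and [measurable]: "g \<in> borel_measurable borel"
  shows "(\<integral>x. g (reflect \<alpha> x) \<partial>lborel) = (\<integral>x. g x \<partial>lborel)"
proof -
  have d: "distr lborel borel (reflect \<alpha>) = lborel"
    by (rule lborel_distr_linear_isometry_involution[OF linear_reflect reflect_reflect norm_reflect]) fact+
  have [measurable]: "reflect \<alpha> \<in> borel_measurable borel"
    by (intro borel_measurable_continuous_onI linear_continuous_on)
      (simp add: linear_reflect flip: linear_conv_bounded_linear)
  have "(\<integral>x. g x \<partial>lborel) = (\<integral>x. g x \<partial>distr lborel borel (reflect \<alpha>))" by (simp only: d)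
  also have "\<dots> = (\<integral>x. g (reflect \<alpha> x) \<partial>lborel)" by (rule integral_distr) auto
  finally show ?thesis by simp
qed

lemma le_0_if_le_all_mult:
  fixes a c :: real
  assumes "\<And>e. e > 0 \<Longrightarrow> a \<le> c * e"
  shows "a \<le> 0"
proof (rule tendsto_lowerbound)
  have "((\<lambda>e. c * e) \<longlongrightarrow> c * 0) (at_right 0)" by (intro tendsto_intros)
  then show "((\<lambda>e. c * e) \<longlongrightarrow> 0) (at_right 0)" by simp
  show "\<forall>\<^sub>F e in at_right 0. a \<le> c * e"
    using assms by (simp add: eventually_at_filter)
qed simp

lemma abs_integral_le_measure:
  fixes g :: "'a::euclidean_space \<Rightarrow> real"
  assumes g: "integrable lborel g" and E: "E \<in> sets borel" "emeasure lborel E < \<infinity>"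
    and le: "AE x in lborel. \<bar>g x\<bar> \<le> c * indicator E x"
  shows "\<bar>\<integral>x. g x \<partial>lborel\<bar> \<le> c * measure lborel E"
proof -
  have i: "integrable lborel (\<lambda>x. c * indicator E x :: real)"
    by (rule integrable_mult_right) (use E in simp)
  have "\<bar>\<integral>x. g x \<partial>lborel\<bar> \<le> (\<integral>x. \<bar>g x\<bar> \<partial>lborel)" by (rule integral_abs_bound)
  also have "\<dots> \<le> (\<integral>x. c * indicator E x \<partial>lborel)"
    by (rule integral_mono_AE[OF integrable_abs[OF g] i le])
  also have "\<dots> = c * measure lborel E" using E by simp
  finally show ?thesis .
qed

lemma integrable_on_ball:
  fixes g :: "'a::euclidean_space \<Rightarrow> real"
  assumes "continuous_on (cball 0 r) g"
  shows "integrable lborel (\<lambda>x. indicator (ball 0 r) x * g x)"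
proof -
  have "set_integrable lborel (cball 0 r) g"
    unfolding set_integrable_def by (rule borel_integrable_compact[OF compact_cball assms])
  then have "set_integrable lborel (ball 0 r) g" by (rule set_integrable_subset) auto
  then show ?thesis by (simp add: set_integrable_def)
qed

lemma continuous_on_cball_bounded:
  fixes g :: "'a::euclidean_space \<Rightarrow> real"
  assumes "continuous_on (cball 0 r) g"
  obtains K where "K \<ge> 0" "\<And>x. x \<in> cball 0 r \<Longrightarrow> \<bar>g x\<bar> \<le> K"
proof -
  from compact_imp_bounded[OF compact_continuous_image[OF assms compact_cball]]
  obtain K where "\<forall>y\<in>g ` cball 0 r. norm y \<le> K" unfolding bounded_iff by blast
  then have K: "\<bar>g x\<bar> \<le> K" if "x \<in> cball 0 r" for x using that by simp
  have "\<bar>g x\<bar> \<le> \<bar>K\<bar>" if "x \<in> cball 0 r" for x using K[OF that] by linarith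
  then show thesis by (intro that[of "\<bar>K\<bar>"]) auto
qed

text \<open>The shell lies between two concentric balls whose radii differ by \<open>2 * d /
  r\<close>; Bernoulli's inequality bounds the difference of their volumes.\<close>
lemma measure_shell_le:
  assumes r: "r > 0" and d: "0 < d" "d \<le> r\<^sup>2 / 4"
  shows "measure lborel {x\<in>ball (0::'a::euclidean_space) r. r\<^sup>2 - (norm x)\<^sup>2 \<le> 2 * d}
     \<le> (measure lborel (ball (0::'a) r) * (2 * real DIM('a) / r\<^sup>2)) * d"
proof -
  define t where "t = 2 * d / r\<^sup>2"
  define \<rho> where "\<rho> = r * (1 - t)"
  define n where "n = DIM('a)"
  have rt: "r\<^sup>2 * t = 2 * d" using r by (simp add: t_def)
  have t: "0 \<le> t" "t \<le> 1/2" using r d by (simp_all add: t_def pos_divide_le_eq)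
  have "1 - t > 0" using t by linarith
  with r have \<rho>0: "\<rho> > 0" unfolding \<rho>_def by (rule mult_pos_pos)
  have \<rho>r: "\<rho> \<le> r" using mult_left_mono[of "1 - t" 1 r] t r by (simp add: \<rho>_def)
  have \<rho>2: "\<rho>\<^sup>2 \<le> r\<^sup>2 - 2 * d"
  proof -
    have "\<rho>\<^sup>2 = r\<^sup>2 - 2 * (r\<^sup>2 * t) + (r\<^sup>2 * t) * t" unfolding \<rho>_def by algebra
    also have "(r\<^sup>2 * t) * t \<le> (2 * d) * (1/2)" unfolding rt using d t by (intro mult_left_mono) auto
    finally show ?thesis using d unfolding rt by simp
  qed
  have "{x\<in>ball (0::'a) r. r\<^sup>2 - (norm x)\<^sup>2 \<le> 2 * d} \<subseteq> ball 0 r - ball 0 \<rho>"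
  proof
    fix x :: 'a assume x: "x \<in> {x\<in>ball (0::'a) r. r\<^sup>2 - (norm x)\<^sup>2 \<le> 2 * d}"
    then have "\<rho>\<^sup>2 \<le> (norm x)\<^sup>2" using \<rho>2 by simp
    then have "\<rho> \<le> norm x" by (rule power2_le_imp_le) simp
    with x show "x \<in> ball 0 r - ball 0 \<rho>" by simp
  qed
  moreover have "ball (0::'a) r - ball 0 \<rho> \<in> fmeasurable lborel"
    using emeasure_lborel_ball_finite[of "0::'a" r] emeasure_lborel_ball_finite[of "0::'a" \<rho>]
    by (intro fmeasurable.Diff fmeasurableI) auto
  moreover have "{x\<in>ball (0::'a) r. r\<^sup>2 - (norm x)\<^sup>2 \<le> 2 * d} \<in> sets lborel"
  proof -
    have "closed {x::'a. r\<^sup>2 - (norm x)\<^sup>2 \<le> 2 * d}"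
      by (intro closed_Collect_le continuous_intros)
    then have "ball 0 r \<inter> {x::'a. r\<^sup>2 - (norm x)\<^sup>2 \<le> 2 * d} \<in> sets borel" by simp
    moreover have "{x\<in>ball (0::'a) r. r\<^sup>2 - (norm x)\<^sup>2 \<le> 2 * d} = ball 0 r \<inter> {x. r\<^sup>2 - (norm x)\<^sup>2 \<le> 2 * d}" by auto
    ultimately show ?thesis by simp
  qed
  ultimately have "measure lborel {x\<in>ball (0::'a) r. r\<^sup>2 - (norm x)\<^sup>2 \<le> 2 * d} \<le> measure lborel (ball (0::'a) r - ball 0 \<rho>)"
    by (intro measure_mono_fmeasurable)
  also have "\<dots> = measure lborel (ball (0::'a) r) - measure lborel (ball (0::'a) \<rho>)"
    using emeasure_lborel_ball_finite[of "0::'a" \<rho>] emeasure_lborel_ball_finite[of "0::'a" r] \<rho>r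
    by (intro measure_Diff) auto
  also have "\<dots> = measure lborel (ball (0::'a) r) * (1 - (1 - t) ^ n)"
  proof -
    have 1: "measure lborel (ball (0::'a) r) = r ^ n * measure lborel (ball (0::'a) 1)"
      unfolding n_def by (rule content_ball_conv_unit_ball) (use r in simp)
    have 2: "measure lborel (ball (0::'a) \<rho>) = \<rho> ^ n * measure lborel (ball (0::'a) 1)"
      unfolding n_def by (rule content_ball_conv_unit_ball) (use \<rho>0 in simp)
    show ?thesis unfolding 1 2 unfolding \<rho>_def power_mult_distrib by algebra
  qed
  also have "\<dots> \<le> measure lborel (ball (0::'a) r) * (real n * t)"
  proof (rule mult_left_mono)
    show "1 - (1 - t) ^ n \<le> real n * t"
      using Bernoulli_inequality[of "- t" n] t by simp
  qed simp
  also have "\<dots> = (measure lborel (ball (0::'a) r) * (2 * real DIM('a) / r\<^sup>2)) * d"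
    by (simp add: n_def t_def)
  finally show ?thesis .
qed

text \<open>Continuity of a uniform limit, in the form in which the closure of an operator provides
  the approximations.\<close>
lemma continuous_on_uniform_approx:
  fixes w :: "'b::metric_space \<Rightarrow> real"
  assumes "\<And>e. e > 0 \<Longrightarrow> \<exists>p. continuous_on S p \<and> (\<forall>x\<in>S. \<bar>p x - w x\<bar> < e)"
  shows "continuous_on S w"
proof -
  have "\<forall>n. \<exists>p. continuous_on S p \<and> (\<forall>x\<in>S. \<bar>p x - w x\<bar> < inverse (real (Suc n)))"
    using assms by simp
  then obtain p where p: "\<And>n. continuous_on S (p n)" "\<And>n x. x \<in> S \<Longrightarrow> \<bar>p n x - w x\<bar> < inverse (real (Suc n))"
    by metis
  have "uniform_limit S p w sequentially"
  proof (rule uniform_limitI)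
    fix e :: real assume "e > 0"
    then obtain N where N: "inverse (real (Suc N)) < e" using reals_Archimedean by blast
    have "dist (p n x) (w x) < e" if "n \<ge> N" "x \<in> S" for n x
    proof -
      have "inverse (real (Suc n)) \<le> inverse (real (Suc N))" using that by simp
      with p(2)[OF that(2), of n] N show ?thesis unfolding dist_real_def by linarith
    qed
    then show "\<forall>\<^sub>F n in sequentially. \<forall>x\<in>S. dist (p n x) (w x) < e"
      unfolding eventually_sequentially by blast
  qed
  then show ?thesis
    by (rule uniform_limit_theorem[rotated]) (auto simp: p)
qed

section \<open>The Dunkl operator of a root system\<close>

locale dunkl_data =
  fixes R :: "'a::euclidean_space set" and k :: "'a \<Rightarrow> real"
  assumes root_system: "root_system R" and multiplicity: "multiplicity_function R k"
begin

lemma finite_R: "finite R" and zero_notin_R: "0 \<notin> R"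
  using root_system by (auto simp: root_system_def)

lemma k_pos: "\<alpha> \<in> R \<Longrightarrow> 0 < k \<alpha>"
  using multiplicity by (auto simp: multiplicity_function_def)

abbreviation L :: "('a \<Rightarrow> real) \<Rightarrow> 'a \<Rightarrow> real" where "L \<equiv> dunkl_op R k"

text \<open>The homogeneous dimension of the weighted space.\<close>
definition hdim :: real where "hdim = real DIM('a) + (\<Sum>\<alpha>\<in>R. k \<alpha>)"

lemma hdim_pos: "hdim > 0"
  unfolding hdim_def by (intro add_pos_nonneg sum_nonneg) (auto simp: k_pos less_imp_le)

lemma rpf_L: "real_polynomial_function u \<Longrightarrow> real_polynomial_function (L u)"
  by (rule rpf_dunkl_op[OF _ finite_R])

lemma nonzero_R: "\<alpha> \<in> R \<Longrightarrow> \<alpha> \<noteq> 0"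
  using zero_notin_R by auto

lemma AE_regular: "AE x in lborel. x \<in> regular_points R"
proof -
  have "AE x in lborel. \<alpha> \<bullet> x \<noteq> 0" if "\<alpha> \<in> R" for \<alpha>
  proof (rule AE_I')
    have "{x. \<alpha> \<bullet> x = 0} \<in> null_sets lebesgue"
      using negligible_hyperplane[of \<alpha> 0] nonzero_R[OF that] by (simp add: negligible_iff_null_sets)
    moreover have "{x. \<alpha> \<bullet> x = 0} \<in> sets lborel"
      using closed_hyperplane[of \<alpha> 0] by simp
    ultimately show "{x. \<alpha> \<bullet> x = 0} \<in> null_sets lborel"
      by (simp add: null_sets_completion_iff)
  qed auto
  then have "AE x in lborel. \<forall>\<alpha>\<in>R. \<alpha> \<bullet> x \<noteq> 0"
    by (simp add: AE_finite_all[OF finite_R])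
  then show ?thesis by (simp add: regular_points_def)
qed

text \<open>A radial factor is invariant under every reflection, hence the difference terms act on
  \<open>v\<close> only, and the first-order terms belonging to the roots contribute \<open>k
  \<alpha>\<close> each, as if the dimension were \<open>hdim\<close>.\<close>
lemma L_radial_mult:
  assumes h: "\<And>t. (\<eta> has_real_derivative \<eta>' t) (at t)" "\<And>t. (\<eta>' has_real_derivative \<eta>'' t) (at t)"
    and v: "real_polynomial_function v" and x: "x \<in> regular_points R"
  shows "L (\<lambda>x. \<eta> ((norm x)\<^sup>2) * v x) x = \<eta> ((norm x)\<^sup>2) * L v x + 4 * \<eta>' ((norm x)\<^sup>2) * partial_deriv x v x
     + v x * (4 * (norm x)\<^sup>2 * \<eta>'' ((norm x)\<^sup>2) + 2 * hdim * \<eta>' ((norm x)\<^sup>2))"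
proof -
  define c0 c1 c2 where "c0 = \<eta> ((norm x)\<^sup>2)" and "c1 = \<eta>' ((norm x)\<^sup>2)" and "c2 = \<eta>'' ((norm x)\<^sup>2)"
  let ?u = "\<lambda>x. \<eta> ((norm x)\<^sup>2) * v x"
  have comp: "((\<lambda>x. f ((norm x)\<^sup>2)) has_derivative (\<lambda>h. y * (2 * (z \<bullet> h)))) (at z)"
    if "(f has_real_derivative y) (at ((norm z)\<^sup>2))" for f :: "real \<Rightarrow> real" and y and z :: 'a
  proof -
    have "(f has_derivative (\<lambda>h. y * h)) (at ((norm z)\<^sup>2))" using that by (simp add: has_field_derivative_def)
    from has_derivative_compose[of "\<lambda>x. (norm x)\<^sup>2" "\<lambda>h. 2 * (z \<bullet> h)" z UNIV f "\<lambda>h. y * h", OF has_derivative_norm_power2 this]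
    show ?thesis .
  qed
  have dv: "(v has_derivative (\<lambda>h. partial_deriv h v z)) (at z)" for z
    by (rule has_derivative_partial_deriv[OF rpf_differentiable[OF v]])
  have dv2: "(partial_deriv b v has_derivative (\<lambda>h. partial_deriv h (partial_deriv b v) z)) (at z)" for z b
    by (rule has_derivative_partial_deriv[OF rpf_differentiable[OF rpf_partial_deriv[OF v]]])
  have d1: "partial_deriv b ?u = (\<lambda>z. \<eta> ((norm z)\<^sup>2) * partial_deriv b v z + ((2 * (z \<bullet> b)) * \<eta>' ((norm z)\<^sup>2)) * v z)" for b
  proof
    fix z
    show "partial_deriv b ?u z = \<eta> ((norm z)\<^sup>2) * partial_deriv b v z + ((2 * (z \<bullet> b)) * \<eta>' ((norm z)\<^sup>2)) * v z"
      using partial_deriv_eq[OF has_derivative_mult[OF comp[OF h(1)] dv], of b z] by (simp only: mult.commute)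
  qed
  have di: "((\<lambda>x. 2 * (x \<bullet> b)) has_derivative (\<lambda>h. 2 * (h \<bullet> b))) (at z)" for z b :: 'a
    by (auto intro!: derivative_eq_intros)
  have d2: "partial_deriv b (partial_deriv b ?u) x = c0 * partial_deriv b (partial_deriv b v) x
      + 4 * c1 * ((x \<bullet> b) * partial_deriv b v x) + v x * (4 * c2 * ((x \<bullet> b) * (x \<bullet> b)) + 2 * c1)" if "b \<in> Basis" for b
  proof -
    have bb: "b \<bullet> b = 1" using that by simp
    have hd: "((\<lambda>z. \<eta> ((norm z)\<^sup>2) * partial_deriv b v z + ((2 * (z \<bullet> b)) * \<eta>' ((norm z)\<^sup>2)) * v z) has_derivative
       (\<lambda>h. (c0 * partial_deriv h (partial_deriv b v) x + (c1 * (2 * (x \<bullet> h))) * partial_deriv b v x)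
         + (((2 * (x \<bullet> b)) * c1) * partial_deriv h v x + ((2 * (x \<bullet> b)) * (c2 * (2 * (x \<bullet> h))) + (2 * (h \<bullet> b)) * c1) * v x))) (at x)"
      unfolding c0_def c1_def c2_def
      by (rule has_derivative_add[OF has_derivative_mult[OF comp[OF h(1)] dv2]
          has_derivative_mult[OF has_derivative_mult[OF di comp[OF h(2)]] dv]])
    show ?thesis unfolding d1 partial_deriv_eq[OF hd] bb by algebra
  qed
  have S: "(\<Sum>b\<in>Basis. (x \<bullet> b) * partial_deriv b v x) = partial_deriv x v x"
    by (rule partial_deriv_sum_basis[symmetric, OF rpf_differentiable[OF v]])
  have N: "(\<Sum>b\<in>Basis. (x \<bullet> b) * (x \<bullet> b)) = (norm x)\<^sup>2"
    by (simp add: power2_norm_eq_inner euclidean_inner[symmetric])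
  have t0: "2 * taylor2 b u x 0 = partial_deriv b (partial_deriv b u) x" for b and u :: "'a \<Rightarrow> real"
    by (simp add: taylor2_def)
  have "(\<Sum>b\<in>Basis. 2 * taylor2 b ?u x 0) = (\<Sum>b\<in>Basis. c0 * partial_deriv b (partial_deriv b v) x
      + 4 * c1 * ((x \<bullet> b) * partial_deriv b v x) + v x * (4 * c2 * ((x \<bullet> b) * (x \<bullet> b)) + 2 * c1))"
    unfolding t0 by (rule sum.cong[OF refl d2])
  also have "\<dots> = c0 * (\<Sum>b\<in>Basis. 2 * taylor2 b v x 0) + 4 * c1 * partial_deriv x v x
      + v x * (4 * c2 * (norm x)\<^sup>2 + real DIM('a) * (2 * c1))"
    unfolding t0 sum.distrib sum_distrib_left[symmetric] S N by simp
  finally have Lap: "(\<Sum>b\<in>Basis. 2 * taylor2 b ?u x 0) = c0 * (\<Sum>b\<in>Basis. 2 * taylor2 b v x 0) + 4 * c1 * partial_deriv x v x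
      + v x * (4 * c2 * (norm x)\<^sup>2 + real DIM('a) * (2 * c1))" .
  have "k \<alpha> * (2 / (norm \<alpha>)\<^sup>2) * taylor2 \<alpha> ?u x (refl_step \<alpha> x)
     = c0 * (k \<alpha> * (2 / (norm \<alpha>)\<^sup>2) * taylor2 \<alpha> v x (refl_step \<alpha> x)) + 2 * c1 * v x * k \<alpha>"
    if a: "\<alpha> \<in> R" for \<alpha>
  proof -
    define s where "s = - 2 * (\<alpha> \<bullet> x) / (norm \<alpha>)\<^sup>2"
    have ax: "\<alpha> \<bullet> x \<noteq> 0" using x a by (auto simp: regular_points_def)
    have na: "(norm \<alpha>)\<^sup>2 \<noteq> 0" using nonzero_R[OF a] by simp
    have s0: "s \<noteq> 0" using ax na by (simp add: s_def)
    have sn: "2 * (x \<bullet> \<alpha>) = - (norm \<alpha>)\<^sup>2 * s" using na by (simp add: s_def inner_commute)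
    have nr: "norm (x + s *\<^sub>R \<alpha>) = norm x"
      unfolding s_def reflect_eq[symmetric] by (rule norm_reflect[OF nonzero_R[OF a]])
    have "c0 * v (x + s *\<^sub>R \<alpha>) = c0 * v x + s * (c0 * partial_deriv \<alpha> v x + (2 * (x \<bullet> \<alpha>) * c1) * v x) + s\<^sup>2 * taylor2 \<alpha> ?u x s"
      using taylor2[of ?u x s \<alpha>] unfolding d1 nr c0_def[symmetric] c1_def[symmetric] .
    then have "s\<^sup>2 * taylor2 \<alpha> ?u x s = s\<^sup>2 * (c0 * taylor2 \<alpha> v x s + (norm \<alpha>)\<^sup>2 * c1 * v x)"
      unfolding taylor2[of v x s \<alpha>] sn by algebra
    then have T: "taylor2 \<alpha> ?u x s = c0 * taylor2 \<alpha> v x s + (norm \<alpha>)\<^sup>2 * c1 * v x"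
      using s0 by simp
    show ?thesis unfolding s_def[symmetric] T using na by (simp add: field_simps)
  qed
  then have "(\<Sum>\<alpha>\<in>R. k \<alpha> * (2 / (norm \<alpha>)\<^sup>2) * taylor2 \<alpha> ?u x (refl_step \<alpha> x))
     = (\<Sum>\<alpha>\<in>R. c0 * (k \<alpha> * (2 / (norm \<alpha>)\<^sup>2) * taylor2 \<alpha> v x (refl_step \<alpha> x)) + 2 * c1 * v x * k \<alpha>)"
    by (rule sum.cong[OF refl])
  then have J: "(\<Sum>\<alpha>\<in>R. k \<alpha> * (2 / (norm \<alpha>)\<^sup>2) * taylor2 \<alpha> ?u x (refl_step \<alpha> x))
     = c0 * (\<Sum>\<alpha>\<in>R. k \<alpha> * (2 / (norm \<alpha>)\<^sup>2) * taylor2 \<alpha> v x (refl_step \<alpha> x)) + 2 * c1 * v x * (\<Sum>\<alpha>\<in>R. k \<alpha>)"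
    unfolding sum.distrib sum_distrib_left[symmetric] .
  show ?thesis
    unfolding dunkl_op_def Lap J hdim_def c0_def[symmetric] c1_def[symmetric] c2_def[symmetric] by algebra
qed

text \<open>The commutation relation between the operator and multiplication by the squared norm. It
  extends from the regular points to the whole space because both sides are continuous.\<close>
lemma L_norm_mult:
  assumes u: "real_polynomial_function u"
  shows "L (\<lambda>x. (norm x)\<^sup>2 * u x) x = (norm x)\<^sup>2 * L u x + 2 * hdim * u x + 4 * partial_deriv x u x"
proof -
  let ?D = "\<lambda>x. L (\<lambda>x. (norm x)\<^sup>2 * u x) x - ((norm x)\<^sup>2 * L u x + 2 * hdim * u x + 4 * partial_deriv x u x)"
  have "?D x = 0" if "x \<in> regular_points R" for x
    using L_radial_mult[where \<eta> = "\<lambda>t. t" and \<eta>' = "\<lambda>_. 1" and \<eta>'' = "\<lambda>_. 0", OF DERIV_ident DERIV_const u that]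
    by simp
  then have ae: "AE x in lborel. x \<in> UNIV \<longrightarrow> ?D x = 0"
    using AE_regular by (auto elim!: eventually_mono)
  have "continuous_on UNIV (L (\<lambda>x. (norm x)\<^sup>2 * u x))"
    by (rule rpf_continuous_on[OF rpf_L[OF rpf_mult[OF rpf_norm_power2 u]]])
  then have "continuous_on UNIV ?D"
    by (intro continuous_on_diff continuous_on_add continuous_on_mult continuous_on_const
        rpf_continuous_on[OF rpf_norm_power2] rpf_continuous_on[OF rpf_L[OF u]] rpf_continuous_on[OF u]
        continuous_on_euler_derivative[OF u])
  from continuous_on_eq_0_AE[OF open_UNIV this ae, of x] show ?thesis by simp
qed

lemma L_norm_power2: "L (\<lambda>x. (norm x)\<^sup>2) x = 2 * hdim"
  using L_norm_mult[OF rpf_const[of 1], of x] by simp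

section \<open>The Dirichlet problem with polynomial data\<close>

lemma L_eq_0_low_degree:
  assumes "hom_poly n u" "n < 2"
  shows "L u x = 0"
proof -
  have v: "real_polynomial_function (L u)"
    using assms rpf_L unfolding hom_poly_def by metis
  have e: "L u x = l ^ (2 - n) * L u (l *\<^sub>R x)" if "l \<noteq> 0" for l
  proof -
    have "l ^ n * (l ^ (2 - n) * L u (l *\<^sub>R x)) = l ^ n * L u x"
      using dunkl_op_scaled[OF assms(1) that, of R k x] assms(2)
      by (simp flip: mult.assoc power_add)
    with that show ?thesis by simp
  qed
  have "((\<lambda>l. l ^ (2 - n) * L u (l *\<^sub>R x)) \<longlongrightarrow> 0 ^ (2 - n) * L u 0) (at 0)"
    by (intro tendsto_intros isCont_ray[OF v])
  moreover have "0 ^ (2 - n) = (0::real)" using assms(2) by simp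
  moreover have "eventually (\<lambda>l. l ^ (2 - n) * L u (l *\<^sub>R x) = L u x) (at 0)"
    using e by (auto simp: eventually_at_filter)
  ultimately have "((\<lambda>l::real. L u x) \<longlongrightarrow> 0) (at 0)"
    using tendsto_cong by fastforce
  then show ?thesis using tendsto_const_iff[of "at (0::real)"] by auto
qed

lemma hom_poly_L:
  assumes "hom_poly (Suc (Suc n)) u"
  shows "hom_poly n (L u)"
proof -
  have v: "real_polynomial_function (L u)"
    using assms rpf_L unfolding hom_poly_def by metis
  have e: "L u (l *\<^sub>R x) = l ^ n * L u x" if "l \<noteq> 0" for l x
    using dunkl_op_scaled[OF assms that, of R k x] that by (simp add: power2_eq_square)
  have "L u (0 *\<^sub>R x) = 0 ^ n * L u x" for x
  proof -
    have "((\<lambda>l. l ^ n * L u x) \<longlongrightarrow> 0 ^ n * L u x) (at 0)"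
      by (intro tendsto_intros)
    moreover have "eventually (\<lambda>l. l ^ n * L u x = L u (l *\<^sub>R x)) (at 0)"
      using e by (auto simp: eventually_at_filter)
    ultimately have "((\<lambda>l. L u (l *\<^sub>R x)) \<longlongrightarrow> 0 ^ n * L u x) (at 0)"
      using tendsto_cong by fastforce
    with isCont_ray[OF v, of x] show ?thesis
      using tendsto_unique[of "at (0::real)"] by fastforce
  qed
  with e v show ?thesis unfolding hom_poly_def by metis
qed

text \<open>Applying the operator to the equation gives, by the commutation relation and Euler's
  identity, an equation of the same kind for \<open>L q\<close> in degree \<open>n - 2\<close> with
  a larger constant. Solving that one by induction determines \<open>L q\<close>, and the original
  equation then determines \<open>q\<close>.\<close>
lemma L_hom_solvable:
  assumes p: "hom_poly n p" and c: "c > 0"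
  shows "\<exists>q. hom_poly n q \<and> (\<forall>x. (norm x)\<^sup>2 * L q x + c * q x = p x)"
  using p c
proof (induction n arbitrary: p c rule: less_induct)
  case (less n)
  show ?case
  proof (cases "n < 2")
    case True
    have "hom_poly n (\<lambda>x. (1/c) * p x)"
      using hom_poly_lincomb[OF less.prems(1) less.prems(1), of "1/c" 0] by simp
    moreover from L_eq_0_low_degree[OF this True]
    have "(norm x)\<^sup>2 * L (\<lambda>x. (1/c) * p x) x + c * ((1/c) * p x) = p x" for x
      using less.prems(2) by simp
    ultimately show ?thesis by blast
  next
    case False
    then obtain j where j: "n = Suc (Suc j)"
      by (metis Suc_1 add_2_eq_Suc le_Suc_ex not_less numeral_2_eq_2)
    have p: "real_polynomial_function p" using less.prems by (simp add: hom_poly_def)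
    obtain q where q: "hom_poly j q"
      "\<And>x. (norm x)\<^sup>2 * L q x + (c + 2 * hdim + 4 * real j) * q x = L p x"
      using less.IH[of j "L p" "c + 2 * hdim + 4 * real j"] hom_poly_L[of j p] less.prems j hdim_pos
      by (auto simp: add_pos_nonneg)
    have qp: "real_polynomial_function q" using q by (simp add: hom_poly_def)
    \<comment> \<open>Here \<open>q\<close> already equals \<open>L ?q\<close>, as is verified below.\<close>
    let ?q = "\<lambda>x. (1/c) * p x + (- 1/c) * ((norm x)\<^sup>2 * q x)"
    have "hom_poly n ?q"
      using less.prems(1) hom_poly_norm_mult[OF q(1)] unfolding j by (rule hom_poly_lincomb)
    moreover have "(norm x)\<^sup>2 * L ?q x + c * ?q x = p x" for x
    proof -
      have "L ?q x = (1/c) * L p x + (- 1/c) * L (\<lambda>x. (norm x)\<^sup>2 * q x) x"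
        by (rule dunkl_op_lincomb[OF p rpf_mult[OF rpf_norm_power2 qp]])
      also have "L (\<lambda>x. (norm x)\<^sup>2 * q x) x = (norm x)\<^sup>2 * L q x + 2 * hdim * q x + 4 * real j * q x"
        using L_norm_mult[OF qp, of x] euler_hom_poly[OF q(1), of x] by simp
      finally have e: "L ?q x = (1/c) * L p x + (- 1/c) * ((norm x)\<^sup>2 * L q x + 2 * hdim * q x + 4 * real j * q x)" .
      have "c * L ?q x = L p x - ((norm x)\<^sup>2 * L q x + 2 * hdim * q x + 4 * real j * q x)"
        unfolding e using less.prems(2) by (simp add: field_simps)
      then have "c * L ?q x = c * q x"
        using q(2)[of x] by algebra
      then have "L ?q x = q x" using less.prems(2) by simp
      then show ?thesis using less.prems(2) by (simp add: field_simps)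
    qed
    ultimately show ?thesis by blast
  qed
qed

text \<open>In each degree the top-order part of the equation is solved by the preceding lemma; the
  error \<open>r\<^sup>2 * L q\<close> has lower degree and is removed by induction. This is the
  polynomial form of the Green operator of the ball of radius \<open>r\<close>: the solution has
  zero boundary values by construction.\<close>
lemma L_surj_ball:
  assumes p: "real_polynomial_function p"
  shows "\<exists>q. real_polynomial_function q \<and> (\<forall>x. L (\<lambda>x. (r\<^sup>2 - (norm x)\<^sup>2) * q x) x = p x)"
  using hom_sum_rpf[OF p]
proof induction
  have lin: "L (\<lambda>x. (r\<^sup>2 - (norm x)\<^sup>2) * (u x + v x)) x
      = L (\<lambda>x. (r\<^sup>2 - (norm x)\<^sup>2) * u x) x + L (\<lambda>x. (r\<^sup>2 - (norm x)\<^sup>2) * v x) x"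
    if "real_polynomial_function u" "real_polynomial_function v" for u v x
    unfolding distrib_left
    by (rule dunkl_op_add; rule rpf_mult[OF real_polynomial_function_diff[OF rpf_const
          rpf_norm_power2]]; rule that)
  {
    case (hom n p)
    then show ?case
    proof (induction n arbitrary: p rule: less_induct)
      case (less n)
      obtain q where q: "hom_poly n q" "\<And>x. (norm x)\<^sup>2 * L q x + (2 * hdim + 4 * real n) * q x = p x"
        using L_hom_solvable[where n = n and p = p and c = "2 * hdim + 4 * real n"] less.prems hdim_pos
        by (auto simp: add_pos_nonneg)
      have qp: "real_polynomial_function q" using q by (simp add: hom_poly_def)
      have Lq: "L (\<lambda>x. (norm x)\<^sup>2 * q x) x = p x" for x
        using L_norm_mult[OF qp, of x] euler_hom_poly[OF q(1), of x] q(2)[of x]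
        by (simp add: algebra_simps)
      have Ls: "L (\<lambda>x. (r\<^sup>2 - (norm x)\<^sup>2) * (- q x)) x = p x - r\<^sup>2 * L q x" for x
      proof -
        have "L (\<lambda>x. 1 * ((norm x)\<^sup>2 * q x) + (- (r\<^sup>2)) * q x) x = 1 * L (\<lambda>x. (norm x)\<^sup>2 * q x) x + (- (r\<^sup>2)) * L q x"
          by (rule dunkl_op_lincomb[OF rpf_mult[OF rpf_norm_power2 qp] qp])
        moreover have "(\<lambda>x. (r\<^sup>2 - (norm x)\<^sup>2) * (- q x)) = (\<lambda>x. 1 * ((norm x)\<^sup>2 * q x) + (- (r\<^sup>2)) * q x)"
          by (simp add: fun_eq_iff algebra_simps)
        ultimately show ?thesis by (simp add: Lq)
      qed
      show ?case
      proof (cases "n < 2")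
        case True
        from L_eq_0_low_degree[OF q(1) True] Ls
        have "L (\<lambda>x. (r\<^sup>2 - (norm x)\<^sup>2) * (- q x)) x = p x" for x by simp
        with real_polynomial_function_minus[OF qp] show ?thesis by blast
      next
        case False
        then obtain j where j: "n = Suc (Suc j)"
          by (metis Suc_1 add_2_eq_Suc le_Suc_ex not_less numeral_2_eq_2)
        have "hom_poly j (\<lambda>x. r\<^sup>2 * L q x)"
          using hom_poly_L[of j q] q(1) j hom_poly_lincomb[of j "L q" "L q" "r\<^sup>2" 0] by simp
        then obtain s where s: "real_polynomial_function s"
          "\<And>x. L (\<lambda>x. (r\<^sup>2 - (norm x)\<^sup>2) * s x) x = r\<^sup>2 * L q x"
          using less.IH[of j] j by auto
        have "L (\<lambda>x. (r\<^sup>2 - (norm x)\<^sup>2) * (- q x + s x)) x = p x" for x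
          using lin[OF real_polynomial_function_minus[OF qp] s(1), of x] s(2)[of x] Ls[of x] by simp
        with rpf_add[OF real_polynomial_function_minus[OF qp] s(1)] show ?thesis by blast
      qed
    qed
  next
    case (sum u v)
    then obtain s t where st: "real_polynomial_function s" "real_polynomial_function t"
      "\<And>x. L (\<lambda>x. (r\<^sup>2 - (norm x)\<^sup>2) * s x) x = u x" "\<And>x. L (\<lambda>x. (r\<^sup>2 - (norm x)\<^sup>2) * t x) x = v x"
      by blast
    then have "L (\<lambda>x. (r\<^sup>2 - (norm x)\<^sup>2) * (s x + t x)) x = u x + v x" for x
      using lin[OF st(1,2), of x] by simp
    with rpf_add[OF st(1,2)] show ?case by blast
  }
qed

lemma poly_dirichlet:
  assumes "real_polynomial_function g" "real_polynomial_function h"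
  shows "\<exists>p. real_polynomial_function p \<and> (\<forall>x. L p x = h x) \<and> (\<forall>x\<in>sphere 0 r. p x = g x)"
proof -
  obtain s where s: "real_polynomial_function s"
    "\<And>x. L (\<lambda>x. (r\<^sup>2 - (norm x)\<^sup>2) * s x) x = h x - L g x"
    using L_surj_ball[where p = "\<lambda>x. h x - L g x" and r = r]
      real_polynomial_function_diff[OF assms(2) rpf_L[OF assms(1)]] by blast
  have s': "real_polynomial_function (\<lambda>x. (r\<^sup>2 - (norm x)\<^sup>2) * s x)"
    by (rule rpf_mult[OF real_polynomial_function_diff[OF rpf_const rpf_norm_power2] s(1)])
  show ?thesis
    by (rule exI[of _ "\<lambda>x. g x + (r\<^sup>2 - (norm x)\<^sup>2) * s x"])
      (simp add: rpf_add[OF assms(1) s'] dunkl_op_add[OF assms(1) s'] s(2))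
qed

section \<open>The maximum principle and the closure of the Dunkl operator\<close>

text \<open>At an interior maximum the gradient vanishes, so every Taylor quotient whose end point
  stays in the ball is at most zero; for step length zero this follows by continuity. The reflecting
  steps do stay in the ball, since reflections are isometries.\<close>
lemma L_nonpos_at_max:
  assumes u: "real_polynomial_function u" and x0: "x0 \<in> ball 0 r"
    and max: "\<And>x. x \<in> cball 0 r \<Longrightarrow> u x \<le> u x0"
  shows "L u x0 \<le> 0"
proof -
  have "(\<lambda>h. partial_deriv h u x0) = (\<lambda>h. 0)"
    by (rule differential_zero_maxmin[OF x0 open_ball has_derivative_partial_deriv[OF
          rpf_differentiable[OF u]]]) (auto intro!: max)
  then have d: "partial_deriv b u x0 = 0" for b by metis
  have neg: "taylor2 b u x0 t \<le> 0" if "x0 + t *\<^sub>R b \<in> cball 0 r" "t \<noteq> 0" for b t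
  proof -
    have "t\<^sup>2 * taylor2 b u x0 t \<le> 0"
      using taylor2[of u x0 t b] max[OF that(1)] d[of b] by simp
    with that(2) show ?thesis by (simp add: mult_le_0_iff)
  qed
  have neg0: "taylor2 b u x0 0 \<le> 0" for b
  proof (rule tendsto_upperbound[of "\<lambda>t. taylor2 b u x0 t" _ "at 0"])
    have "continuous_on UNIV (\<lambda>t. (\<lambda>z. taylor2 b u (fst z) (snd z)) (x0, t))"
      by (rule continuous_on_compose2[OF rpf_continuous_on[OF
            rpf_taylor2[OF u]]]) (auto intro!: continuous_intros)
    then have "isCont (\<lambda>t. taylor2 b u x0 t) 0" by (simp add: continuous_on_eq_continuous_at)
    then show "((\<lambda>t. taylor2 b u x0 t) \<longlongrightarrow> taylor2 b u x0 0) (at 0)" by (simp add: isCont_def)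
    have "((\<lambda>t. x0 + t *\<^sub>R b) \<longlongrightarrow> x0 + 0 *\<^sub>R b) (at 0)" by (intro tendsto_intros)
    then have "\<forall>\<^sub>F t in at 0. x0 + t *\<^sub>R b \<in> ball 0 r"
      using x0 by (intro topological_tendstoD[OF _ open_ball]) auto
    then show "\<forall>\<^sub>F t in at 0. taylor2 b u x0 t \<le> 0"
      unfolding eventually_at_filter by eventually_elim (auto intro!: neg)
  qed simp
  have "taylor2 \<alpha> u x0 (refl_step \<alpha> x0) \<le> 0" if "\<alpha> \<in> R" for \<alpha>
  proof -
    have "\<alpha> \<noteq> 0" using that zero_notin_R by auto
    then have "norm (x0 + (refl_step \<alpha> x0) *\<^sub>R \<alpha>) = norm x0"
      unfolding reflect_eq[symmetric] by (rule norm_reflect)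
    then have "x0 + (refl_step \<alpha> x0) *\<^sub>R \<alpha> \<in> cball 0 r" using x0 by simp
    then show ?thesis using neg neg0 by metis
  qed
  then have "(\<Sum>\<alpha>\<in>R. k \<alpha> * (2 / (norm \<alpha>)\<^sup>2) * taylor2 \<alpha> u x0 (refl_step \<alpha> x0)) \<le> 0"
    by (intro sum_nonpos mult_nonneg_nonpos) (auto simp: k_pos less_imp_le)
  moreover have "(\<Sum>b\<in>Basis. 2 * taylor2 b u x0 0) \<le> 0"
    using neg0 by (intro sum_nonpos) (simp add: mult_le_0_iff)
  ultimately show ?thesis unfolding dunkl_op_def by linarith
qed

text \<open>The closure of the graph of the operator on polynomials, in the uniform norm on the
  ball: \<open>w\<close> is a generalised solution of \<open>L w = h\<close>.\<close>
definition graph :: "real \<Rightarrow> ('a \<Rightarrow> real) \<Rightarrow> ('a \<Rightarrow> real) \<Rightarrow> bool" where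
  "graph r w h \<longleftrightarrow> (\<forall>e>0. \<exists>p. real_polynomial_function p \<and>
     (\<forall>x\<in>cball 0 r. \<bar>p x - w x\<bar> < e \<and> \<bar>L p x - h x\<bar> < e))"

lemma graph_poly: "real_polynomial_function p \<Longrightarrow> graph r p (L p)"
  unfolding graph_def by (intro allI impI exI[of _ p]) auto

lemma graph_closed:
  assumes "\<And>e. e > 0 \<Longrightarrow> \<exists>w' h'. graph r w' h' \<and> (\<forall>x\<in>cball 0 r. \<bar>w' x - w x\<bar> < e \<and> \<bar>h' x - h x\<bar> < e)"
  shows "graph r w h"
  unfolding graph_def
proof (intro allI impI)
  fix e :: real assume "e > 0"
  then obtain w' h' where 1: "graph r w' h'" "\<And>x. x \<in> cball 0 r \<Longrightarrow> \<bar>w' x - w x\<bar> < e/2 \<and> \<bar>h' x - h x\<bar> < e/2"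
    using assms[of "e/2"] by auto
  from 1(1) \<open>e > 0\<close> obtain p where 2: "real_polynomial_function p"
    "\<And>x. x \<in> cball 0 r \<Longrightarrow> \<bar>p x - w' x\<bar> < e/2 \<and> \<bar>L p x - h' x\<bar> < e/2"
    unfolding graph_def by (meson half_gt_zero)
  have "\<bar>p x - w x\<bar> < e \<and> \<bar>L p x - h x\<bar> < e" if "x \<in> cball 0 r" for x
    using 1(2)[OF that] 2(2)[OF that] by linarith
  with 2(1) show "\<exists>p. real_polynomial_function p \<and> (\<forall>x\<in>cball 0 r. \<bar>p x - w x\<bar> < e \<and> \<bar>L p x - h x\<bar> < e)"
    by blast
qed

lemma graph_cong:
  assumes "graph r w h" "\<And>x. x \<in> cball 0 r \<Longrightarrow> w x = w' x" "\<And>x. x \<in> cball 0 r \<Longrightarrow> h x = h' x"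
  shows "graph r w' h'"
  by (rule graph_closed, intro exI[of _ w] exI[of _ h]) (use assms in auto)

lemma graph_lincomb:
  assumes "graph r w h" "graph r w' h'"
  shows "graph r (\<lambda>x. c * w x + d * w' x) (\<lambda>x. c * h x + d * h' x)"
  unfolding graph_def
proof (intro allI impI)
  fix e :: real assume e: "e > 0"
  define K where "K = \<bar>c\<bar> + \<bar>d\<bar> + 1"
  have K: "K > 0" by (simp add: K_def)
  then have eK: "e / K > 0" using e by simp
  from assms(1) eK obtain p where p: "real_polynomial_function p"
    "\<And>x. x \<in> cball 0 r \<Longrightarrow> \<bar>p x - w x\<bar> < e/K \<and> \<bar>L p x - h x\<bar> < e/K"
    unfolding graph_def by meson
  from assms(2) eK obtain q where q: "real_polynomial_function q"
    "\<And>x. x \<in> cball 0 r \<Longrightarrow> \<bar>q x - w' x\<bar> < e/K \<and> \<bar>L q x - h' x\<bar> < e/K"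
    unfolding graph_def by meson
  have est: "\<bar>(c * a + d * b) - (c * a' + d * b')\<bar> < e" if "\<bar>a - a'\<bar> < e/K" "\<bar>b - b'\<bar> < e/K" for a b a' b'
  proof -
    have "\<bar>(c * a + d * b) - (c * a' + d * b')\<bar> = \<bar>c * (a - a') + d * (b - b')\<bar>"
      by (simp add: algebra_simps)
    also have "\<dots> \<le> \<bar>c\<bar> * \<bar>a - a'\<bar> + \<bar>d\<bar> * \<bar>b - b'\<bar>"
      by (metis abs_mult abs_triangle_ineq)
    also have "\<dots> \<le> \<bar>c\<bar> * (e/K) + \<bar>d\<bar> * (e/K)"
      using that by (intro add_mono mult_left_mono) auto
    also have "\<dots> = (K - 1) * (e/K)" unfolding distrib_right[symmetric] by (simp add: K_def)
    also have "\<dots> < K * (e/K)" using eK by (simp only: mult_less_cancel_right) simp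
    also have "\<dots> = e" using K by simp
    finally show ?thesis .
  qed
  show "\<exists>p. real_polynomial_function p \<and> (\<forall>x\<in>cball 0 r. \<bar>p x - (c * w x + d * w' x)\<bar> < e \<and>
      \<bar>L p x - (c * h x + d * h' x)\<bar> < e)"
    by (intro exI[of _ "\<lambda>x. c * p x + d * q x"] conjI ballI;
        (unfold dunkl_op_lincomb[OF p(1) q(1)])?;
        (rule rpf_add[OF rpf_mult[OF rpf_const p(1)] rpf_mult[OF rpf_const q(1)]] | rule est))
      (use p q in auto)
qed

lemma graph_diff:
  "graph r w h \<Longrightarrow> graph r w' h' \<Longrightarrow> graph r (\<lambda>x. w x - w' x) (\<lambda>x. h x - h' x)"
  using graph_lincomb[of r w h w' h' 1 "-1"] by simp

lemma graph_minus: "graph r w h \<Longrightarrow> graph r (\<lambda>x. - w x) (\<lambda>x. - h x)"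
  using graph_lincomb[of r w h w h "-1" 0] by simp

lemma graph_continuous: "graph r w h \<Longrightarrow> continuous_on (cball 0 r) w"
  by (rule continuous_on_uniform_approx) (metis graph_def rpf_continuous_on)

text \<open>Subtract the barrier \<open>(e + n) / (2 * hdim) * (r\<^sup>2 - (norm
  x)\<^sup>2)\<close>, on which the operator takes the value \<open>- (e + n)\<close>, from a close
  polynomial approximation of \<open>w\<close>. If the bound failed, the difference would have an
  interior maximum at which the operator is positive, because \<open>w > c\<close> there and so
  \<open>h \<ge> - e\<close>.\<close>
lemma graph_max_principle:
  assumes g: "graph r w h" and r: "r > 0" and e: "e \<ge> 0"
    and bd: "\<And>x. x \<in> sphere 0 r \<Longrightarrow> w x \<le> c"
    and h: "\<And>x. x \<in> cball 0 r \<Longrightarrow> w x > c \<Longrightarrow> h x \<ge> - e"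
    and x1: "x1 \<in> cball 0 r"
  shows "w x1 \<le> c + e * (r\<^sup>2 / (2 * hdim))"
proof (rule ccontr)
  assume neg: "\<not> ?thesis"
  define C where "C = 1 / (2 * hdim)"
  define D where "D = w x1 - c - e * C * r\<^sup>2"
  have D: "D > 0" using neg by (simp add: D_def C_def)
  have C: "C > 0" "C * (2 * hdim) = 1" using hdim_pos by (auto simp: C_def)
  \<comment> \<open>Slack in the barrier that uses up half of the excess \<open>D\<close>; the approximation error \<open>d\<close> has to be small against both.\<close>
  define n where "n = D / (2 * C * r\<^sup>2)"
  have n: "n > 0" "n * C * r\<^sup>2 = D / 2" using D C r by (auto simp: n_def)
  define d where "d = min (D / 8) (n / 2)"
  have d: "d > 0" "d \<le> D / 8" "d < n" using D n by (auto simp: d_def)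
  from g d(1) obtain p where p: "real_polynomial_function p"
    "\<And>x. x \<in> cball 0 r \<Longrightarrow> \<bar>p x - w x\<bar> < d \<and> \<bar>L p x - h x\<bar> < d"
    unfolding graph_def by meson
  let ?b = "\<lambda>x::'a. 1 * (norm x)\<^sup>2 + (- 1) * (r\<^sup>2 + c / ((e + n) * C))"
  define z where "z = (\<lambda>x. 1 * p x + ((e + n) * C) * ?b x)"
  have eC: "(e + n) * C > 0" using e n C by simp
  have zeq: "z x = p x - c - (e + n) * C * (r\<^sup>2 - (norm x)\<^sup>2)" for x
    using eC unfolding z_def by (simp add: field_simps)
  have b: "real_polynomial_function ?b"
    by (rule rpf_add[OF rpf_mult[OF rpf_const rpf_norm_power2] rpf_const])
  have z: "real_polynomial_function z"
    unfolding z_def by (rule rpf_add[OF rpf_mult[OF rpf_const p(1)] rpf_mult[OF rpf_const b]])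
  have "L ?b x = 1 * L (\<lambda>x. (norm x)\<^sup>2) x + (- 1) * L (\<lambda>x. r\<^sup>2 + c / ((e + n) * C)) x" for x
    by (rule dunkl_op_lincomb[OF rpf_norm_power2 rpf_const])
  then have Lb: "L ?b x = 2 * hdim" for x
    using L_norm_power2 by simp
  have "L z x = 1 * L p x + ((e + n) * C) * L ?b x" for x
    unfolding z_def by (rule dunkl_op_lincomb[OF p(1) b])
  then have "L z x = L p x + (e + n) * (C * (2 * hdim))" for x
    unfolding Lb by (simp add: mult.assoc)
  then have Lz: "L z x = L p x + e + n" for x unfolding C by simp
  obtain x0 where x0: "x0 \<in> cball 0 r" "\<And>x. x \<in> cball 0 r \<Longrightarrow> z x \<le> z x0"
    using continuous_attains_sup[OF compact_cball _ rpf_continuous_on[OF z], of 0 r] r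
    by (auto simp: not_le)
  define T where "T = (e + n) * C * (r\<^sup>2 - (norm x1)\<^sup>2)"
  have "T \<le> (e + n) * C * r\<^sup>2" unfolding T_def
    using eC by (intro mult_left_mono) auto
  also have "\<dots> = e * C * r\<^sup>2 + D / 2" using n(2) by (simp add: algebra_simps)
  finally have "z x1 \<ge> D / 2 - d"
    using p(2)[OF x1] D_def unfolding zeq T_def[symmetric] by linarith
  with x0(2)[OF x1] d D have zx0: "z x0 > 2 * d" by linarith
  have "(norm x0)\<^sup>2 \<le> r\<^sup>2" using x0(1) r by (simp add: power_mono)
  then have "(e + n) * C * (r\<^sup>2 - (norm x0)\<^sup>2) \<ge> 0" using eC by simp
  then have wx0: "w x0 > c" using p(2)[OF x0(1)] zx0 d unfolding zeq by linarith
  have "x0 \<in> ball 0 r"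
  proof (rule ccontr)
    assume "x0 \<notin> ball 0 r"
    with x0(1) have "x0 \<in> sphere 0 r" by simp
    with bd[OF this] wx0 show False by linarith
  qed
  from L_nonpos_at_max[OF z this x0(2)] have "L p x0 + e + n \<le> 0" unfolding Lz by simp
  moreover have "L p x0 > - e - d" using h[OF x0(1) wx0] p(2)[OF x0(1)] by linarith
  ultimately show False using d by linarith
qed

lemma graph_abs_bound:
  assumes g: "graph r w h" and r: "r > 0"
    and bd: "\<And>x. x \<in> sphere 0 r \<Longrightarrow> \<bar>w x\<bar> \<le> c"
    and h: "\<And>x. x \<in> cball 0 r \<Longrightarrow> \<bar>h x\<bar> \<le> e"
    and x: "x \<in> cball 0 r"
  shows "\<bar>w x\<bar> \<le> c + e * (r\<^sup>2 / (2 * hdim))"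
proof -
  have e: "e \<ge> 0" using h[OF x] by linarith
  have "w x \<le> c + e * (r\<^sup>2 / (2 * hdim))"
    by (rule graph_max_principle[OF g r e _ _ x]) (use bd h in \<open>force simp: abs_le_iff\<close>)+
  moreover have "- w x \<le> c + e * (r\<^sup>2 / (2 * hdim))"
    by (rule graph_max_principle[OF graph_minus[OF g] r e _ _ x]) (use bd h in \<open>force simp: abs_le_iff\<close>)+
  ultimately show ?thesis by linarith
qed

text \<open>Approximate both data by polynomials, solve exactly for these, and pass to the limit:
  the maximum principle makes the solutions a uniform Cauchy sequence.\<close>
lemma linear_dirichlet:
  assumes r: "r > 0" and f: "continuous_on (sphere 0 r) f" and h: "continuous_on (cball 0 r) h"
  shows "\<exists>w. graph r w h \<and> (\<forall>x\<in>sphere 0 r. w x = f x)"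
proof -
  have "\<exists>p. real_polynomial_function p \<and> (\<forall>x\<in>sphere 0 r. \<bar>p x - f x\<bar> < e) \<and> (\<forall>x\<in>cball 0 r. \<bar>L p x - h x\<bar> < e)"
    if e: "e > 0" for e
  proof -
    obtain f' where f': "real_polynomial_function f'" "\<And>x. x \<in> sphere 0 r \<Longrightarrow> \<bar>f x - f' x\<bar> < e"
      using Stone_Weierstrass_real_polynomial_function[OF compact_sphere f e] by blast
    obtain h' where h': "real_polynomial_function h'" "\<And>x. x \<in> cball 0 r \<Longrightarrow> \<bar>h x - h' x\<bar> < e"
      using Stone_Weierstrass_real_polynomial_function[OF compact_cball h e] by blast
    from poly_dirichlet[OF f'(1) h'(1), of r] f'(2) h'(2) show ?thesis
      by (metis abs_minus_commute)
  qed
  then have "\<forall>n. \<exists>p. real_polynomial_function p \<and> (\<forall>x\<in>sphere 0 r. \<bar>p x - f x\<bar> < inverse (real (Suc n)))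
      \<and> (\<forall>x\<in>cball 0 r. \<bar>L p x - h x\<bar> < inverse (real (Suc n)))" by simp
  then obtain p where p: "\<And>n. real_polynomial_function (p n)"
    "\<And>n x. x \<in> sphere 0 r \<Longrightarrow> \<bar>p n x - f x\<bar> < inverse (real (Suc n))"
    "\<And>n x. x \<in> cball 0 r \<Longrightarrow> \<bar>L (p n) x - h x\<bar> < inverse (real (Suc n))"
    by metis
  define C where "C = 1 + r\<^sup>2 / (2 * hdim)"
  have C: "C > 0" using hdim_pos by (simp add: C_def add_pos_nonneg)
  have "uniformly_Cauchy_on (cball 0 r) p"
  proof (rule uniformly_Cauchy_onI)
    fix e :: real assume e: "e > 0"
    then obtain N where N: "inverse (real (Suc N)) < e / (2 * C)"
      using reals_Archimedean[of "e / (2 * C)"] C by auto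
    show "\<exists>M. \<forall>x\<in>cball 0 r. \<forall>m\<ge>M. \<forall>n\<ge>M. dist (p m x) (p n x) < e"
    proof (intro exI[of _ N] ballI allI impI)
      fix x :: 'a and m n assume x: "x \<in> cball 0 r" and mn: "m \<ge> N" "n \<ge> N"
      let ?d = "2 * inverse (real (Suc N))"
      have i: "inverse (real (Suc m)) \<le> inverse (real (Suc N))" "inverse (real (Suc n)) \<le> inverse (real (Suc N))"
        using mn by simp_all
      have g: "graph r (\<lambda>x. p m x - p n x) (\<lambda>x. L (p m) x - L (p n) x)"
        by (intro graph_diff graph_poly p(1))
      have "\<bar>p m x - p n x\<bar> \<le> ?d + ?d * (r\<^sup>2 / (2 * hdim))"
      proof (rule graph_abs_bound[OF g r _ _ x])
        show "\<bar>p m x - p n x\<bar> \<le> ?d" if "x \<in> sphere 0 r" for x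
          using p(2)[OF that, of m] p(2)[OF that, of n] i by linarith
        show "\<bar>L (p m) x - L (p n) x\<bar> \<le> ?d" if "x \<in> cball 0 r" for x
          using p(3)[OF that, of m] p(3)[OF that, of n] i by linarith
      qed
      also have "\<dots> = (2 * C) * inverse (real (Suc N))" by (simp add: C_def algebra_simps)
      also have "\<dots> < (2 * C) * (e / (2 * C))" using N C by (intro mult_strict_left_mono) auto
      also have "\<dots> = e" using C by simp
      finally show "dist (p m x) (p n x) < e" by (simp add: dist_real_def)
    qed
  qed
  then obtain w where w: "uniform_limit (cball 0 r) p w sequentially"
    unfolding uniformly_convergent_eq_Cauchy[symmetric] uniformly_convergent_on_def by blast
  have "graph r w h"
  proof (rule graph_closed)
    fix e :: real assume e: "e > 0"
    from uniform_limitD[OF w e] obtain N where N: "\<And>n x. n \<ge> N \<Longrightarrow> x \<in> cball 0 r \<Longrightarrow> dist (p n x) (w x) < e"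
      unfolding eventually_sequentially by blast
    obtain M where M: "inverse (real (Suc M)) < e" using reals_Archimedean[OF e] by blast
    let ?n = "max N M"
    have "inverse (real (Suc ?n)) \<le> inverse (real (Suc M))" by simp
    then have "\<bar>p ?n x - w x\<bar> < e \<and> \<bar>L (p ?n) x - h x\<bar> < e" if "x \<in> cball 0 r" for x
      using N[of ?n, OF _ that] p(3)[OF that, of ?n] M unfolding dist_real_def by linarith
    with graph_poly[OF p(1)[of ?n]] show "\<exists>w' h'. graph r w' h' \<and> (\<forall>x\<in>cball 0 r. \<bar>w' x - w x\<bar> < e \<and> \<bar>h' x - h x\<bar> < e)"
      by blast
  qed
  moreover have "w x = f x" if "x \<in> sphere 0 r" for x
  proof (rule LIMSEQ_unique)
    show "(\<lambda>n. p n x) \<longlonglongrightarrow> w x"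
      by (rule tendsto_uniform_limitI[OF w]) (use that in auto)
    have "(\<lambda>n. p n x - f x) \<longlonglongrightarrow> 0"
      by (rule tendsto_rabs_zero_cancel, rule tendsto_sandwich[OF _ _ tendsto_const LIMSEQ_inverse_real_of_nat])
        (use p(2)[OF that] in \<open>auto intro!: always_eventually less_imp_le\<close>)
    then show "(\<lambda>n. p n x) \<longlonglongrightarrow> f x" by (simp add: LIM_zero_iff)
  qed
  ultimately show ?thesis by blast
qed

section \<open>The semilinear problem in the closure\<close>

text \<open>Where \<open>u > u'\<close> the nonlinear terms differ with the favourable sign by
  monotonicity, so the maximum principle applies with a constant that depends neither on
  \<open>t\<close> nor on \<open>\<phi>\<close>. This independence is what makes the continuation
  argument work.\<close>
lemma semilinear_stability:
  assumes r: "r > 0" and \<phi>: "mono \<phi>" and t: "t \<ge> 0"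
    and g: "graph r u (\<lambda>x. t * \<phi> (u x) + g x)" "graph r u' (\<lambda>x. t * \<phi> (u' x) + g' x)"
    and bd: "\<And>x. x \<in> sphere 0 r \<Longrightarrow> u x = u' x"
    and e: "\<And>x. x \<in> cball 0 r \<Longrightarrow> \<bar>g x - g' x\<bar> \<le> e"
    and x: "x \<in> cball 0 r"
  shows "\<bar>u x - u' x\<bar> \<le> e * (r\<^sup>2 / (2 * hdim))"
proof -
  have e0: "e \<ge> 0" using e[OF x] by linarith
  have one: "u x - u' x \<le> 0 + e * (r\<^sup>2 / (2 * hdim))"
    if g: "graph r u (\<lambda>x. t * \<phi> (u x) + g x)" "graph r u' (\<lambda>x. t * \<phi> (u' x) + g' x)"
      and bd: "\<And>x. x \<in> sphere 0 r \<Longrightarrow> u x = u' x" and e: "\<And>x. x \<in> cball 0 r \<Longrightarrow> \<bar>g x - g' x\<bar> \<le> e"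
    for u u' g g'
  proof (rule graph_max_principle[OF graph_diff[OF g] r e0 _ _ x])
    fix x :: 'a assume x: "x \<in> cball 0 r" and "u x - u' x > 0"
    then have "t * \<phi> (u' x) \<le> t * \<phi> (u x)" using \<phi> t by (intro mult_left_mono) (auto simp: mono_def)
    then show "t * \<phi> (u x) + g x - (t * \<phi> (u' x) + g' x) \<ge> - e" using e[OF x] by linarith
  qed (use bd in auto)
  have "\<bar>g' x - g x\<bar> \<le> e" if "x \<in> cball 0 r" for x using e[OF that] by (simp add: abs_minus_commute)
  from one[OF g bd e] one[OF g(2,1) bd[symmetric] this] show ?thesis by linarith
qed

text \<open>Treat \<open>d * \<phi>\<close> as a perturbation: the map that sends \<open>v\<close>
  to the solution with right-hand side \<open>g + d * \<phi> v\<close> is a contraction with factor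
  one half by the stability estimate. Its iterates converge uniformly, and the closure contains the
  limit.\<close>
lemma semilinear_step:
  assumes r: "r > 0" and mono: "mono \<phi>" and lip: "\<And>s t. \<bar>\<phi> s - \<phi> t\<bar> \<le> K * \<bar>s - t\<bar>"
    and t: "t \<ge> 0" and d: "d \<ge> 0" "d * K * (r\<^sup>2 / (2 * hdim)) \<le> 1/2"
    and IH: "\<And>g. continuous_on (cball 0 r) g \<Longrightarrow>
       \<exists>u. graph r u (\<lambda>x. t * \<phi> (u x) + g x) \<and> (\<forall>x\<in>sphere 0 r. u x = f x)"
    and g: "continuous_on (cball 0 r) g"
  shows "\<exists>u. graph r u (\<lambda>x. (t + d) * \<phi> (u x) + g x) \<and> (\<forall>x\<in>sphere 0 r. u x = f x)"
proof -
  let ?B = "cball (0::'a) r"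
  have K: "K \<ge> 0" using lip[of 0 1] abs_ge_zero[of "\<phi> 0 - \<phi> 1"] by simp
  have c\<phi>: "continuous_on UNIV \<phi>"
    by (rule lipschitz_on_continuous_on[of K]) (auto intro!: lipschitz_onI lip simp: dist_real_def K)
  have c: "continuous_on ?B (\<lambda>x. g x + d * \<phi> (v x))" if "continuous_on ?B v" for v
    by (intro continuous_intros g continuous_on_compose2[OF c\<phi> that]) auto
  obtain u0 where u0: "graph r u0 (\<lambda>x. t * \<phi> (u0 x) + g x)" "\<forall>x\<in>sphere 0 r. u0 x = f x"
    using IH[OF g] by blast
  have "\<exists>v. \<forall>n. (continuous_on ?B (v n) \<and> (\<forall>x\<in>sphere 0 r. v n x = f x)) \<and>
     graph r (v (Suc n)) (\<lambda>x. t * \<phi> (v (Suc n) x) + (g x + d * \<phi> (v n x)))"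
  proof (rule dependent_nat_choice)
    show "\<exists>v. continuous_on ?B v \<and> (\<forall>x\<in>sphere 0 r. v x = f x)"
      using u0 graph_continuous by blast
    show "\<exists>w. (continuous_on ?B w \<and> (\<forall>x\<in>sphere 0 r. w x = f x)) \<and>
         graph r w (\<lambda>x. t * \<phi> (w x) + (g x + d * \<phi> (v x)))"
      if "continuous_on ?B v \<and> (\<forall>x\<in>sphere 0 r. v x = f x)" for v and n :: nat
      using IH[OF c[of v]] that graph_continuous by blast
  qed
  then obtain v where v: "\<And>n. continuous_on ?B (v n)" "\<And>n x. x \<in> sphere 0 r \<Longrightarrow> v n x = f x"
    "\<And>n. graph r (v (Suc n)) (\<lambda>x. t * \<phi> (v (Suc n) x) + (g x + d * \<phi> (v n x)))" by blast
  have "bounded ((\<lambda>x. v (Suc 0) x - v 0 x) ` ?B)"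
    by (intro compact_imp_bounded compact_continuous_image continuous_intros v compact_cball)
  then obtain M where M: "\<And>x. x \<in> ?B \<Longrightarrow> \<bar>v (Suc 0) x - v 0 x\<bar> \<le> M"
    unfolding bounded_iff by force
  have M0: "M \<ge> 0" using M[of 0] r by force
  \<comment> \<open>The contraction estimate, iterated.\<close>
  have geo: "\<bar>v (Suc n) x - v n x\<bar> \<le> M * (1/2) ^ n" if "x \<in> ?B" for n x
    using that
  proof (induction n arbitrary: x)
    case (Suc n)
    have "\<bar>v (Suc (Suc n)) x - v (Suc n) x\<bar> \<le> (d * (K * (M * (1/2)^n))) * (r\<^sup>2 / (2 * hdim))"
    proof (rule semilinear_stability[OF r mono t v(3) v(3) _ _ Suc.prems])
      fix y :: 'a assume y: "y \<in> ?B"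
      have "\<bar>g y + d * \<phi> (v (Suc n) y) - (g y + d * \<phi> (v n y))\<bar> = d * \<bar>\<phi> (v (Suc n) y) - \<phi> (v n y)\<bar>"
        using d(1) by (simp add: abs_mult flip: right_diff_distrib)
      also have "\<dots> \<le> d * (K * (M * (1/2)^n))"
        using lip[of "v (Suc n) y" "v n y"] Suc.IH[OF y] d(1) K
        by (meson mult_left_mono order_trans)
      finally show "\<bar>g y + d * \<phi> (v (Suc n) y) - (g y + d * \<phi> (v n y))\<bar> \<le> d * (K * (M * (1/2)^n))" .
    qed (simp add: v)
    also have "\<dots> = (d * K * (r\<^sup>2 / (2 * hdim))) * (M * (1/2)^n)" by (simp add: algebra_simps)
    also have "\<dots> \<le> (1/2) * (M * (1/2)^n)" using d(2) M0 by (intro mult_right_mono) auto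
    finally show ?case by simp
  qed (simp add: M)
  have "uniform_limit ?B (\<lambda>n x. \<Sum>i<n. v (Suc i) x - v i x) (\<lambda>x. \<Sum>i. v (Suc i) x - v i x) sequentially"
    by (rule Weierstrass_m_test[of _ _ "\<lambda>n. M * (1/2)^n"])
      (use geo in \<open>auto intro!: summable_mult summable_geometric\<close>)
  have lim: "uniform_limit ?B (\<lambda>n x. v n x - v 0 x) (\<lambda>x. \<Sum>i. v (Suc i) x - v i x) sequentially"
  proof -
    have "(\<Sum>i<n. v (Suc i) x - v i x) = v n x - v 0 x" for n x by (induction n) auto
    with \<open>uniform_limit ?B (\<lambda>n x. \<Sum>i<n. v (Suc i) x - v i x) _ sequentially\<close> show ?thesis by simp
  qed
  define u where "u = (\<lambda>x. v 0 x + (\<Sum>i. v (Suc i) x - v i x))"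
  have close: "\<exists>n. \<forall>x\<in>?B. \<bar>v (Suc n) x - u x\<bar> < e \<and> \<bar>v n x - u x\<bar> < e" if "e > 0" for e
  proof -
    from uniform_limitD[OF lim that] obtain N where N: "\<And>n x. n \<ge> N \<Longrightarrow> x \<in> ?B \<Longrightarrow>
       dist (v n x - v 0 x) (\<Sum>i. v (Suc i) x - v i x) < e"
      unfolding eventually_sequentially by blast
    have "\<bar>v n x - u x\<bar> < e" if "n \<ge> N" "x \<in> ?B" for n x
      using N[OF that] by (simp add: u_def dist_real_def algebra_simps)
    then show ?thesis by (intro exI[of _ N]) auto
  qed
  have "graph r u (\<lambda>x. (t + d) * \<phi> (u x) + g x)"
  proof (rule graph_closed)
    fix e :: real assume e: "e > 0"
    define A where "A = (t + d) * K + 1"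
    have A: "A \<ge> 1" using t d K by (simp add: A_def)
    obtain n where n: "\<And>x. x \<in> ?B \<Longrightarrow> \<bar>v (Suc n) x - u x\<bar> < e / A \<and> \<bar>v n x - u x\<bar> < e / A"
      using close[of "e / A"] e A by force
    show "\<exists>w' h'. graph r w' h' \<and> (\<forall>x\<in>?B. \<bar>w' x - u x\<bar> < e \<and> \<bar>h' x - ((t + d) * \<phi> (u x) + g x)\<bar> < e)"
    proof (intro exI conjI ballI, rule v(3)[of n])
      fix x assume x: "x \<in> ?B"
      have "e / A \<le> e" using A e by (simp add: field_simps)
      then show "\<bar>v (Suc n) x - u x\<bar> < e" using n[OF x] by linarith
      have 1: "\<bar>\<phi> (v (Suc n) x) - \<phi> (u x)\<bar> \<le> K * (e/A)" "\<bar>\<phi> (v n x) - \<phi> (u x)\<bar> \<le> K * (e/A)"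
        using lip[of "v (Suc n) x" "u x"] lip[of "v n x" "u x"] n[OF x] K
        by (meson mult_left_mono order_trans less_imp_le)+
      have "\<bar>t * \<phi> (v (Suc n) x) + (g x + d * \<phi> (v n x)) - ((t + d) * \<phi> (u x) + g x)\<bar>
          = \<bar>t * (\<phi> (v (Suc n) x) - \<phi> (u x)) + d * (\<phi> (v n x) - \<phi> (u x))\<bar>"
        by (simp add: algebra_simps)
      also have "\<dots> \<le> t * \<bar>\<phi> (v (Suc n) x) - \<phi> (u x)\<bar> + d * \<bar>\<phi> (v n x) - \<phi> (u x)\<bar>"
        using t d by (metis abs_mult abs_of_nonneg abs_triangle_ineq)
      also have "\<dots> \<le> t * (K * (e/A)) + d * (K * (e/A))"
        using 1 t d by (intro add_mono mult_left_mono) auto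
      also have "\<dots> = (A - 1) * (e/A)"
      proof -
        have "t * (K * y) + d * (K * y) = (A - 1) * y" for y by (simp add: A_def algebra_simps)
        then show ?thesis .
      qed
      also have "\<dots> < A * (e/A)" using A e by (intro mult_strict_right_mono) auto
      also have "\<dots> = e" using A by simp
      finally show "\<bar>t * \<phi> (v (Suc n) x) + (g x + d * \<phi> (v n x)) - ((t + d) * \<phi> (u x) + g x)\<bar> < e" .
    qed
  qed
  moreover have "u x = f x" if "x \<in> sphere 0 r" for x
    using that by (simp add: u_def v)
  ultimately show ?thesis by blast
qed

text \<open>Reach \<open>\<phi>\<close> from \<open>0\<close> through \<open>N + 1\<close> equal
  steps \<open>d * \<phi>\<close>, each small enough for the contraction.\<close>
lemma semilinear_dirichlet_lipschitz:
  assumes r: "r > 0" and mono: "mono \<phi>" and lip: "\<And>s t. \<bar>\<phi> s - \<phi> t\<bar> \<le> K * \<bar>s - t\<bar>"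
    and f: "continuous_on (sphere 0 r) f"
  shows "\<exists>u. graph r u (\<lambda>x. \<phi> (u x)) \<and> (\<forall>x\<in>sphere 0 r. u x = f x)"
proof -
  define c where "c = K * (r\<^sup>2 / (2 * hdim))"
  obtain N where N: "real N > 2 * c" using reals_Archimedean2 by blast
  define d where "d = 1 / real (Suc N)"
  have d: "d \<ge> 0" "d * K * (r\<^sup>2 / (2 * hdim)) \<le> 1/2"
  proof -
    have "c / real (Suc N) \<le> 1/2" using N by (simp add: field_simps)
    moreover have "d * K * (r\<^sup>2 / (2 * hdim)) = c / real (Suc N)" by (simp add: d_def c_def)
    ultimately show "d * K * (r\<^sup>2 / (2 * hdim)) \<le> 1/2" by simp
  qed (simp add: d_def)
  have "\<exists>u. graph r u (\<lambda>x. (real j * d) * \<phi> (u x) + g x) \<and> (\<forall>x\<in>sphere 0 r. u x = f x)"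
    if "continuous_on (cball 0 r) g" for j g
    using that
  proof (induction j arbitrary: g)
    case 0
    from linear_dirichlet[OF r f 0] show ?case by simp
  next
    case (Suc j)
    have "\<exists>u. graph r u (\<lambda>x. (real j * d + d) * \<phi> (u x) + g x) \<and> (\<forall>x\<in>sphere 0 r. u x = f x)"
      by (rule semilinear_step[OF r mono lip _ d Suc.IH Suc.prems]) (use d in auto)
    then show ?case by (simp add: algebra_simps)
  qed
  from this[of "\<lambda>_. 0" "Suc N"] show ?thesis by (simp add: d_def)
qed

text \<open>Truncate \<open>\<phi>\<close> outside \<open>[0, M]\<close>, where \<open>M\<close>
  bounds the boundary values, to make it globally Lipschitz and monotone. The maximum principle
  confines the solution to \<open>[0, M]\<close>, where the truncation changes nothing.\<close>
lemma semilinear_dirichlet: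
  assumes r: "r > 0" and \<phi>: "\<phi> \<in> {0..} \<rightarrow> {0..}" "locally_lipschitz_on {0..} \<phi>" "mono_on {0..} \<phi>" "\<phi> 0 = 0"
    and f: "continuous_on (sphere 0 r) f" "\<forall>x\<in>sphere 0 r. 0 \<le> f x"
  shows "\<exists>u. graph r u (\<lambda>x. \<phi> (u x)) \<and> (\<forall>x\<in>sphere 0 r. u x = f x) \<and> (\<forall>x\<in>cball 0 r. 0 \<le> u x)"
proof -
  have "bounded (f ` sphere 0 r)"
    by (intro compact_imp_bounded compact_continuous_image f compact_sphere)
  then obtain M0 where M0: "\<And>x. x \<in> sphere 0 r \<Longrightarrow> \<bar>f x\<bar> \<le> M0"
    unfolding bounded_iff by force
  define M where "M = max M0 0"
  have M: "M \<ge> 0" "\<And>x. x \<in> sphere 0 r \<Longrightarrow> f x \<le> M" using M0 by (force simp: M_def)+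
  have "local_lipschitz {0::real} {0..M} (\<lambda>_. \<phi>)"
    using \<phi>(2) unfolding locally_lipschitz_on_def by (rule local_lipschitz_subset) auto
  then obtain K where K: "K-lipschitz_on {0..M} \<phi>"
    using local_lipschitz_compact_implies_lipschitz[of "{0::real}" "{0..M}" "\<lambda>_. \<phi>"] by auto
  \<comment> \<open>Clamping is monotone and does not increase distances.\<close>
  define \<psi> where "\<psi> t = \<phi> (min (max t 0) M)" for t
  have K0: "K \<ge> 0" using K by (rule lipschitz_on_nonneg)
  have lip: "\<bar>\<psi> s - \<psi> t\<bar> \<le> K * \<bar>s - t\<bar>" for s t
  proof -
    have "\<bar>\<psi> s - \<psi> t\<bar> \<le> K * \<bar>min (max s 0) M - min (max t 0) M\<bar>"
      using lipschitz_onD[OF K, of "min (max s 0) M" "min (max t 0) M"] M(1)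
      by (simp add: \<psi>_def dist_real_def)
    also have "\<dots> \<le> K * \<bar>s - t\<bar>" using K0 by (intro mult_left_mono) auto
    finally show ?thesis .
  qed
  have mono: "mono \<psi>"
    unfolding \<psi>_def using M(1) by (intro monoI mono_onD[OF \<phi>(3)]) auto
  obtain u where u: "graph r u (\<lambda>x. \<psi> (u x))" "\<And>x. x \<in> sphere 0 r \<Longrightarrow> u x = f x"
    using semilinear_dirichlet_lipschitz[OF r mono lip f(1)] by blast
  have nonneg: "u x \<ge> 0" if x: "x \<in> cball 0 r" for x
  proof -
    have "- u x \<le> 0 + 0 * (r\<^sup>2 / (2 * hdim))"
      by (rule graph_max_principle[OF graph_minus[OF u(1)] r _ _ _ x])
        (use u(2) f(2) M(1) in \<open>auto simp: \<psi>_def \<phi>(4)\<close>)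
    then show ?thesis by simp
  qed
  have le: "u x \<le> M" if x: "x \<in> cball 0 r" for x
  proof -
    have "u x \<le> M + 0 * (r\<^sup>2 / (2 * hdim))"
      by (rule graph_max_principle[OF u(1) r _ _ _ x])
        (use u(2) M \<phi>(1) in \<open>auto simp: \<psi>_def\<close>)
    then show ?thesis by simp
  qed
  have "graph r u (\<lambda>x. \<phi> (u x))"
    by (rule graph_cong[OF u(1)]) (use nonneg le in \<open>auto simp: \<psi>_def\<close>)
  with u(2) nonneg show ?thesis by blast
qed

section \<open>The weight and Green's identity\<close>

abbreviation W :: "'a \<Rightarrow> real" where "W \<equiv> dunkl_weight R k"

lemma weight_reflect:
  assumes "\<alpha> \<in> R"
  shows "W (reflect \<alpha> x) = W x"
proof -
  have a: "\<alpha> \<noteq> 0" using assms by (rule nonzero_R)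
  have im: "reflect \<alpha> ` R = R" using root_system assms by (auto simp: root_system_def)
  have inj: "inj_on (reflect \<alpha>) R" by (metis reflect_reflect[OF a] inj_on_inverseI)
  have "W (reflect \<alpha> x) = (\<Prod>\<beta>\<in>R. \<bar>x \<bullet> reflect \<alpha> \<beta>\<bar> powr k (reflect \<alpha> \<beta>))"
    unfolding dunkl_weight_def inner_reflect_left
    using multiplicity assms by (intro prod.cong) (auto simp: multiplicity_function_def)
  also have "\<dots> = (\<Prod>\<beta>\<in>reflect \<alpha> ` R. \<bar>x \<bullet> \<beta>\<bar> powr k \<beta>)"
    by (simp add: prod.reindex[OF inj])
  finally show ?thesis unfolding im by (simp add: dunkl_weight_def)
qed

lemma continuous_on_weight_factors:
  "S \<subseteq> R \<Longrightarrow> continuous_on UNIV (\<lambda>x. \<Prod>\<alpha>\<in>S. \<bar>x \<bullet> \<alpha>\<bar> powr k \<alpha>)"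
  by (intro continuous_on_prod continuous_on_powr' continuous_intros) (auto simp: k_pos subset_iff)

lemma continuous_weight: "continuous_on UNIV W"
  using continuous_on_weight_factors[of R] by (simp add: dunkl_weight_def[abs_def])

lemma measurable_weight [measurable]: "W \<in> borel_measurable borel"
  by (rule borel_measurable_continuous_onI[OF continuous_weight])

lemma weight_nonneg: "W x \<ge> 0"
  unfolding dunkl_weight_def by (intro prod_nonneg) auto

lemma weight_pos: "x \<in> regular_points R \<Longrightarrow> W x > 0"
  unfolding dunkl_weight_def regular_points_def by (intro prod_pos) (auto simp: inner_commute)

lemma regular_line:
  assumes "x \<in> regular_points R"
  shows "finite {t. x + t *\<^sub>R b \<notin> regular_points R}"
proof (rule finite_subset)
  show "{t. x + t *\<^sub>R b \<notin> regular_points R} \<subseteq> (\<lambda>\<alpha>. - (\<alpha> \<bullet> x) / (\<alpha> \<bullet> b)) ` R"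
  proof
    fix t assume "t \<in> {t. x + t *\<^sub>R b \<notin> regular_points R}"
    then obtain \<alpha> where \<alpha>: "\<alpha> \<in> R" "\<alpha> \<bullet> x + t * (\<alpha> \<bullet> b) = 0"
      by (auto simp: regular_points_def inner_add_right)
    then have "\<alpha> \<bullet> b \<noteq> 0" using assms by (auto simp: regular_points_def)
    with \<alpha>(2) have "t = - (\<alpha> \<bullet> x) / (\<alpha> \<bullet> b)" by (simp add: field_simps)
    with \<alpha>(1) show "t \<in> (\<lambda>\<alpha>. - (\<alpha> \<bullet> x) / (\<alpha> \<bullet> b)) ` R" by blast
  qed
qed (simp add: finite_R)

text \<open>For functions of class \<open>C\<^sup>2\<close> the limit along regular points exists on
  the mirrors and is the continuous expression in terms of Taylor quotients. In particular the Dunkl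
  Laplacian is continuous, hence measurable.\<close>
lemma dunkl_laplacian_eq:
  assumes u: "Ck 2 u"
  shows "dunkl_laplacian R k u = L u"
proof
  fix x
  have reg: "dunkl_laplacian_reg R k u y = L u y" if "y \<in> regular_points R" for y
    using dunkl_op_eq_dunkl_laplacian_reg[OF zero_notin_R that Ck2D(1)[OF u]] by simp
  show "dunkl_laplacian R k u x = L u x"
  proof (cases "x \<in> regular_points R")
    case False
    have "x islimpt regular_points R"
      unfolding islimpt_approachable using AE_dense[OF AE_regular] False by metis
    then have nt: "at x within regular_points R \<noteq> bot"
      using trivial_limit_within by blast
    have "isCont (L u) x"
      using continuous_on_dunkl_op[OF u] by (simp add: continuous_on_eq_continuous_at)
    then have "(L u \<longlongrightarrow> L u x) (at x within regular_points R)"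
      unfolding isCont_def by (rule tendsto_within_subset) simp
    moreover have "\<forall>\<^sub>F y in at x within regular_points R. L u y = dunkl_laplacian_reg R k u y"
      using reg by (auto simp: eventually_at_filter)
    ultimately have "(dunkl_laplacian_reg R k u \<longlongrightarrow> L u x) (at x within regular_points R)"
      by (simp add: tendsto_cong)
    from tendsto_Lim[OF nt this] False show ?thesis by (simp add: dunkl_laplacian_def)
  qed (simp add: dunkl_laplacian_def reg)
qed

text \<open>At regular points the weight is the exponential of \<open>\<Sum>\<alpha>\<in>R. k
  \<alpha> / 2 * ln ((\<alpha> \<bullet> x)\<^sup>2)\<close>, whose derivative is read off.\<close>
lemma weight_has_derivative:
  assumes x: "x \<in> regular_points R"
  shows "((\<lambda>t. W (x + t *\<^sub>R b)) has_real_derivative (\<Sum>\<alpha>\<in>R. k \<alpha> * ((\<alpha> \<bullet> b) / (\<alpha> \<bullet> x))) * W x) (at 0)"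
proof -
  let ?E = "\<lambda>t. exp (\<Sum>\<alpha>\<in>R. k \<alpha> / 2 * ln ((\<alpha> \<bullet> x + t * (\<alpha> \<bullet> b))\<^sup>2))"
  have ax: "\<alpha> \<bullet> x \<noteq> 0" if "\<alpha> \<in> R" for \<alpha> using x that by (auto simp: regular_points_def)
  have E: "?E t = W (x + t *\<^sub>R b)" if "x + t *\<^sub>R b \<in> regular_points R" for t
  proof -
    have "exp (k \<alpha> / 2 * ln ((\<alpha> \<bullet> x + t * (\<alpha> \<bullet> b))\<^sup>2)) = \<bar>(x + t *\<^sub>R b) \<bullet> \<alpha>\<bar> powr k \<alpha>" if "\<alpha> \<in> R" for \<alpha>
    proof -
      let ?y = "\<alpha> \<bullet> x + t * (\<alpha> \<bullet> b)"
      have y: "?y \<noteq> 0" using \<open>x + t *\<^sub>R b \<in> _\<close> that by (auto simp: regular_points_def inner_add_right)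
      have "ln (?y\<^sup>2) = 2 * ln \<bar>?y\<bar>" using y ln_realpow[of "\<bar>?y\<bar>" 2] by simp
      then show ?thesis using y
        by (simp add: powr_def inner_add_left inner_add_right inner_commute)
    qed
    then show ?thesis
      unfolding exp_sum[OF finite_R] dunkl_weight_def by (intro prod.cong) auto
  qed
  have d: "((\<lambda>t. \<Sum>\<alpha>\<in>R. k \<alpha> / 2 * ln ((\<alpha> \<bullet> x + t * (\<alpha> \<bullet> b))\<^sup>2)) has_real_derivative
     (\<Sum>\<alpha>\<in>R. k \<alpha> * ((\<alpha> \<bullet> b) / (\<alpha> \<bullet> x)))) (at 0)"
  proof (rule DERIV_sum)
    fix \<alpha> assume "\<alpha> \<in> R"
    then have "\<alpha> \<bullet> x \<noteq> 0" by (rule ax)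
    then have "0 < (\<alpha> \<bullet> x) * (\<alpha> \<bullet> x)" "\<alpha> \<bullet> x \<noteq> 0" by (metis not_real_square_gt_zero)+
    then show "((\<lambda>t. k \<alpha> / 2 * ln ((\<alpha> \<bullet> x + t * (\<alpha> \<bullet> b))\<^sup>2)) has_real_derivative k \<alpha> * ((\<alpha> \<bullet> b) / (\<alpha> \<bullet> x))) (at 0)"
      by (auto intro!: derivative_eq_intros simp: power2_eq_square field_simps)
  qed
  have "(?E has_real_derivative (\<Sum>\<alpha>\<in>R. k \<alpha> * ((\<alpha> \<bullet> b) / (\<alpha> \<bullet> x))) * ?E 0) (at 0)"
    using DERIV_chain2[OF DERIV_exp d] by (simp add: mult.commute)
  moreover have "?E 0 = W x" using E[of 0] x by simp
  ultimately have *: "(?E has_real_derivative (\<Sum>\<alpha>\<in>R. k \<alpha> * ((\<alpha> \<bullet> b) / (\<alpha> \<bullet> x))) * W x) (at 0)" by simp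
  let ?F = "{t. x + t *\<^sub>R b \<notin> regular_points R}"
  have "open (- ?F)" using finite_imp_closed[OF regular_line[OF x, of b]] by auto
  then show ?thesis
    by (rule has_field_derivative_transform_within_open[OF *]) (use x E in auto)
qed

text \<open>Dividing the weight by \<open>\<alpha> \<bullet> x\<close> leaves the factor
  \<open>\<bar>\<alpha> \<bullet> x\<bar> powr (k \<alpha> - 1)\<close>, which is integrable because
  \<open>k \<alpha> > 0\<close>; the remaining factors are bounded.\<close>
lemma integrable_weight_div:
  assumes v: "continuous_on UNIV v" "\<And>x. x \<notin> ball 0 r \<Longrightarrow> v x = 0" and a: "\<alpha> \<in> R"
  shows "integrable lborel (\<lambda>x. v x * W x / (\<alpha> \<bullet> x))"
proof -
  define V where "V = (\<lambda>x. \<Prod>\<beta>\<in>R - {\<alpha>}. \<bar>x \<bullet> \<beta>\<bar> powr k \<beta>)"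
  have W: "W x = \<bar>\<alpha> \<bullet> x\<bar> powr k \<alpha> * V x" for x
    unfolding dunkl_weight_def V_def inner_commute[of \<alpha> x] by (rule prod.remove[OF finite_R a])
  have "continuous_on UNIV V" unfolding V_def by (rule continuous_on_weight_factors) simp
  from continuous_on_mult[OF v(1) this] have "continuous_on (cball 0 r) (\<lambda>x. v x * V x)"
    by (rule continuous_on_subset) simp
  from compact_imp_bounded[OF compact_continuous_image[OF this compact_cball]]
  obtain C where "\<forall>y\<in>(\<lambda>x. v x * V x) ` cball 0 r. norm y \<le> C"
    unfolding bounded_iff by blast
  then have C: "\<bar>v x * V x\<bar> \<le> C" if "x \<in> cball 0 r" for x
    using that by simp
  show ?thesis
  proof (rule Bochner_Integration.integrable_bound)
    show "integrable lborel (\<lambda>x. C * (indicator (ball 0 r) x * \<bar>\<alpha> \<bullet> x\<bar> powr (k \<alpha> - 1)))"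
      by (intro integrable_mult_right integrable_abs_inner_powr_ball nonzero_R a) (use k_pos[OF a] in simp)
    have [measurable]: "v \<in> borel_measurable borel" by (rule borel_measurable_continuous_onI[OF v(1)])
    show "(\<lambda>x. v x * W x / (\<alpha> \<bullet> x)) \<in> borel_measurable lborel"
      by (intro borel_measurable_divide borel_measurable_times borel_measurable_inner borel_measurable_const)
        (simp_all add: measurable_weight \<open>v \<in> _\<close>)
    have "norm (v x * W x / (\<alpha> \<bullet> x)) \<le> norm (C * (indicator (ball 0 r) x * \<bar>\<alpha> \<bullet> x\<bar> powr (k \<alpha> - 1)))" for x
    proof (cases "x \<in> ball 0 r \<and> \<alpha> \<bullet> x \<noteq> 0")
      case True
      have p: "\<bar>\<alpha> \<bullet> x\<bar> powr (k \<alpha> - 1) = \<bar>\<alpha> \<bullet> x\<bar> powr k \<alpha> / \<bar>\<alpha> \<bullet> x\<bar>"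
        using True by (simp add: powr_diff)
      have "norm (v x * W x / (\<alpha> \<bullet> x)) = \<bar>v x * V x\<bar> * \<bar>\<alpha> \<bullet> x\<bar> powr (k \<alpha> - 1)"
      proof -
        have "norm (a * (b * c) / d) = \<bar>a * c\<bar> * (b / \<bar>d\<bar>)" if "b \<ge> 0" for a b c d :: real
          using that by (simp add: abs_mult)
        then show ?thesis unfolding W p by simp
      qed
      also have "\<dots> \<le> C * \<bar>\<alpha> \<bullet> x\<bar> powr (k \<alpha> - 1)"
        using C[of x] True by (intro mult_right_mono) auto
      also have "\<dots> \<le> norm (C * (indicator (ball 0 r) x * \<bar>\<alpha> \<bullet> x\<bar> powr (k \<alpha> - 1)))"
        using True by simp
      finally show ?thesis .
    next
      case False
      then have z: "v x * W x / (\<alpha> \<bullet> x) = 0" using v(2)[of x] by auto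
      show ?thesis unfolding z by simp
    qed
    then show "AE x in lborel. norm (v x * W x / (\<alpha> \<bullet> x)) \<le> norm (C * (indicator (ball 0 r) x * \<bar>\<alpha> \<bullet> x\<bar> powr (k \<alpha> - 1)))"
      by simp
  qed
qed

text \<open>\<open>G\<close> is the derivative in direction \<open>b\<close> of \<open>H *
  W\<close>, with the derivative of the weight written as a multiple of the weight.\<close>
lemma integral_ibp_direction:
  fixes b :: 'a
  assumes p: "Ck 2 p" and q: "Ck 2 q"
    and U: "open U" "\<And>x. x \<in> U \<Longrightarrow> q x = 0" "- ball 0 r \<subseteq> U"
  defines "H \<equiv> \<lambda>x. p x * partial_deriv b q x - q x * partial_deriv b p x"
  defines "G \<equiv> \<lambda>x. (p x * partial_deriv b (partial_deriv b q) x - q x * partial_deriv b (partial_deriv b p) x) * W x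
     + (\<Sum>\<alpha>\<in>R. k \<alpha> * (\<alpha> \<bullet> b) * (H x * W x / (\<alpha> \<bullet> x)))"
  shows "integrable lborel G" "(\<integral>x. G x \<partial>lborel) = 0"
proof -
  note cp = Ck2D(1)[OF p] Ck2_partial_deriv[OF p, of b] and cq = Ck2D(1)[OF q] Ck2_partial_deriv[OF q, of b]
  have dc: "continuous_on UNIV u" if "\<And>x. u differentiable (at x)" for u :: "'a \<Rightarrow> real"
    using that by (auto intro!: differentiable_imp_continuous_on simp: differentiable_on_def differentiable_at_withinI)
  note cont = dc[OF cp(1)] dc[OF cp(2)] dc[OF cq(1)] dc[OF cq(2)] cp(3) cq(3)
  have z1: "partial_deriv b q x = 0" if "x \<in> U" for x by (rule partial_deriv_eq_0_open[OF U(1,2) that])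
  have z2: "partial_deriv b (partial_deriv b q) x = 0" if "x \<in> U" for x
    by (rule partial_deriv_eq_0_open[OF U(1) z1 that])
  have U': "x \<in> U" if "x \<notin> ball 0 r" for x using U(3) that by auto
  have H: "continuous_on UNIV H" "\<And>x. x \<notin> ball 0 r \<Longrightarrow> H x = 0"
    unfolding H_def using z1 U' U(2) by (auto intro!: continuous_intros cont)
  have i1: "integrable lborel (\<lambda>x. (p x * partial_deriv b (partial_deriv b q) x - q x * partial_deriv b (partial_deriv b p) x) * W x)"
    by (rule integrable_continuous_vanishing_outside_ball[of _ r])
      (use z2 U' U(2) in \<open>auto intro!: continuous_intros cont continuous_weight\<close>)
  have i2: "integrable lborel (\<lambda>x. k \<alpha> * (\<alpha> \<bullet> b) * (H x * W x / (\<alpha> \<bullet> x)))" if "\<alpha> \<in> R" for \<alpha>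
    by (intro integrable_mult_right integrable_weight_div[OF H that])
  show G: "integrable lborel G"
    unfolding G_def by (intro Bochner_Integration.integrable_add Bochner_Integration.integrable_sum i1 i2)
  show "(\<integral>x. G x \<partial>lborel) = 0"
  proof (rule integral_directional_derivative_eq_0[OF _ _ G AE_regular regular_line])
    let ?F = "\<lambda>x. H x * W x"
    show "continuous_on UNIV ?F" by (intro continuous_intros H continuous_weight)
    then show "integrable lborel ?F"
      by (rule integrable_continuous_vanishing_outside_ball[of _ r]) (simp add: H(2))
    fix x assume x: "x \<in> regular_points R"
    have D: "((\<lambda>t. v (x + t *\<^sub>R b)) has_real_derivative partial_deriv b v x) (at 0)"
      if "\<And>y. v differentiable (at y)" for v
      using has_real_derivative_along_line[of v x 0 b] that by simp
    from DERIV_diff[OF DERIV_mult[OF D[OF cp(1)] D[OF cq(2)]] DERIV_mult[OF D[OF cq(1)] D[OF cp(2)]]]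
    have dH: "((\<lambda>t. H (x + t *\<^sub>R b)) has_real_derivative
       (p x * partial_deriv b (partial_deriv b q) x - q x * partial_deriv b (partial_deriv b p) x)) (at 0)"
      unfolding H_def by (rule DERIV_cong) (simp add: mult.commute)
    from DERIV_mult[OF dH weight_has_derivative[OF x]]
    have "((\<lambda>t. H (x + t *\<^sub>R b) * W (x + t *\<^sub>R b)) has_real_derivative
       ((p x * partial_deriv b (partial_deriv b q) x - q x * partial_deriv b (partial_deriv b p) x) * W x
        + (\<Sum>\<alpha>\<in>R. k \<alpha> * ((\<alpha> \<bullet> b) / (\<alpha> \<bullet> x))) * W x * H x)) (at 0)"
      by (rule DERIV_cong) simp
    moreover have "(\<Sum>\<alpha>\<in>R. k \<alpha> * ((\<alpha> \<bullet> b) / (\<alpha> \<bullet> x))) * W x * H x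
       = (\<Sum>\<alpha>\<in>R. k \<alpha> * (\<alpha> \<bullet> b) * (H x * W x / (\<alpha> \<bullet> x)))"
      by (simp add: sum_distrib_left sum_distrib_right mult_ac)
    ultimately show "((\<lambda>t. ?F (x + t *\<^sub>R b)) has_real_derivative G x) (at 0)"
      unfolding G_def by simp
  qed
qed

lemma dunkl_op_eq_0_outside:
  assumes U: "open U" "\<And>x. x \<in> U \<Longrightarrow> q x = 0" "- ball 0 r \<subseteq> U" and x: "x \<notin> ball 0 r"
  shows "\<alpha> \<in> R \<Longrightarrow> taylor2 \<alpha> q x (refl_step \<alpha> x) = 0" "L q x = 0"
proof -
  have z1: "partial_deriv b q x = 0" if "x \<in> U" for b x by (rule partial_deriv_eq_0_open[OF U(1,2) that])
  have z2: "partial_deriv b (partial_deriv b q) x = 0" if "x \<in> U" for b x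
    by (rule partial_deriv_eq_0_open[OF U(1) z1 that])
  have xU: "x \<in> U" using U(3) x by auto
  show T: "taylor2 \<alpha> q x (refl_step \<alpha> x) = 0" if "\<alpha> \<in> R" for \<alpha>
  proof -
    have "norm (reflect \<alpha> x) = norm x" by (rule norm_reflect[OF nonzero_R[OF that]])
    then have "reflect \<alpha> x \<in> U" using U(3) x by auto
    then have "q (x + (refl_step \<alpha> x) *\<^sub>R \<alpha>) = 0"
      unfolding reflect_eq by (rule U(2))
    then show ?thesis unfolding taylor2_def using z1[OF xU] z2[OF xU] U(2)[OF xU] by simp
  qed
  show "L q x = 0"
  proof -
    have "(\<Sum>\<alpha>\<in>R. k \<alpha> * (2 / (norm \<alpha>)\<^sup>2) * taylor2 \<alpha> q x (refl_step \<alpha> x)) = 0"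
      by (intro sum.neutral ballI) (simp only: T mult_zero_right)
    moreover have "(\<Sum>b\<in>Basis. 2 * taylor2 b q x 0) = 0"
      using z2[OF xU] by (simp add: taylor2_def)
    ultimately show ?thesis unfolding dunkl_op_def by (simp only: add_0)
  qed
qed

text \<open>The local part of the operator is in divergence form with respect to the weight, so its
  contribution is a sum of directional derivatives \<open>G b\<close> of continuous functions
  vanishing outside the ball and integrates to zero. What remains for a root \<open>\<alpha>\<close>
  is a multiple of \<open>(q x * p (reflect \<alpha> x) - p x * q (reflect \<alpha> x)) * W x /
  (\<alpha> \<bullet> x)\<^sup>2\<close>, which is odd under the reflection. Each of these functions
  has only a singularity of the type \<open>W x / (\<alpha> \<bullet> x)\<close>, so all are
  integrable separately.\<close>
lemma dunkl_green:
  assumes p: "Ck 2 p" and q: "Ck 2 q"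
    and U: "open U" "\<And>x. x \<in> U \<Longrightarrow> q x = 0" "- ball 0 r \<subseteq> U"
  shows "(\<integral>x. p x * L q x * W x \<partial>lborel) = (\<integral>x. L p x * q x * W x \<partial>lborel)"
proof -
  define s where "s = (\<lambda>\<alpha> x::'a. - 2 * (\<alpha> \<bullet> x) / (norm \<alpha>)\<^sup>2)"
  define P where "P = (\<lambda>\<alpha> x. taylor2 \<alpha> p x (s \<alpha> x))"
  define Q where "Q = (\<lambda>\<alpha> x. taylor2 \<alpha> q x (s \<alpha> x))"
  define H where "H = (\<lambda>b x. p x * partial_deriv b q x - q x * partial_deriv b p x)"
  define N where "N = (\<lambda>\<alpha> x. s \<alpha> x * (q x * P \<alpha> x - p x * Q \<alpha> x) - H \<alpha> x)"
  define J where "J = (\<lambda>\<alpha> x. N \<alpha> x * W x / (\<alpha> \<bullet> x))"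
  define A where "A = (\<lambda>b x. (p x * partial_deriv b (partial_deriv b q) x - q x * partial_deriv b (partial_deriv b p) x) * W x)"
  define G where "G = (\<lambda>b x. A b x + (\<Sum>\<alpha>\<in>R. k \<alpha> * (\<alpha> \<bullet> b) * (H b x * W x / (\<alpha> \<bullet> x))))"
  have U': "x \<in> U" if "x \<notin> ball 0 r" for x using U(3) that by auto
  have dc: "continuous_on UNIV u" if "\<And>x. u differentiable (at x)" for u :: "'a \<Rightarrow> real"
    using that by (auto intro!: differentiable_imp_continuous_on simp: differentiable_on_def differentiable_at_withinI)
  note cp = dc[OF Ck2D(1)[OF p]] dc[OF Ck2_partial_deriv(1)[OF p]]
    and cq = dc[OF Ck2D(1)[OF q]] dc[OF Ck2_partial_deriv(1)[OF q]]
  have cs: "continuous_on UNIV (s \<alpha>)" for \<alpha> :: 'a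
    unfolding s_def by (cases "\<alpha> = 0") (auto intro!: continuous_intros)
  have cP: "continuous_on UNIV (P \<alpha>)" and cQ: "continuous_on UNIV (Q \<alpha>)" for \<alpha>
    unfolding P_def Q_def s_def by (rule continuous_taylor2_reflect[OF p] continuous_taylor2_reflect[OF q])+
  have cH: "continuous_on UNIV (H b)" for b
    unfolding H_def by (intro continuous_on_diff continuous_on_mult cp cq)
  have z1: "partial_deriv b q x = 0" if "x \<notin> ball 0 r" for b x
    by (rule partial_deriv_eq_0_open[OF U(1,2) U'[OF that]])
  have iJ: "integrable lborel (J \<alpha>)" if a: "\<alpha> \<in> R" for \<alpha>
    unfolding J_def
  proof (rule integrable_weight_div[OF _ _ a])
    show "continuous_on UNIV (N \<alpha>)" unfolding N_def
      by (intro continuous_on_diff continuous_on_mult cs cp cq cP cQ cH)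
    fix x :: 'a assume x: "x \<notin> ball 0 r"
    have "Q \<alpha> x = 0" unfolding Q_def s_def by (rule dunkl_op_eq_0_outside(1)[OF U x a])
    with z1[OF x] U(2)[OF U'[OF x]] show "N \<alpha> x = 0" unfolding N_def H_def by simp
  qed
  \<comment> \<open>The function \<open>J\<close> is what the Taylor quotients leave over after the first-order terms \<open>H\<close> have been split off for the integration by parts.\<close>
  have Jodd: "J \<alpha> (reflect \<alpha> x) = - J \<alpha> x" if a: "\<alpha> \<in> R" for \<alpha> x
  proof (cases "\<alpha> \<bullet> x = 0")
    case True
    then show ?thesis by (simp add: J_def inner_reflect_self[OF nonzero_R[OF a]])
  next
    case False
    note refl = inner_reflect_self[OF nonzero_R[OF a]] reflect_reflect[OF nonzero_R[OF a]] weight_reflect[OF a]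
    have nz: "(norm \<alpha>)\<^sup>2 \<noteq> 0" using nonzero_R[OF a] by simp
    define c where "c = - ((norm \<alpha>)\<^sup>2 / 2)"
    have J: "J \<alpha> y = c * (q y * p (reflect \<alpha> y) - p y * q (reflect \<alpha> y)) * W y / (\<alpha> \<bullet> y)\<^sup>2"
      if y: "\<alpha> \<bullet> y \<noteq> 0" for y
    proof -
      have s0: "s \<alpha> y \<noteq> 0" using y nz by (simp add: s_def)
      have e: "v (reflect \<alpha> y) = v y + s \<alpha> y * partial_deriv \<alpha> v y + (s \<alpha> y)\<^sup>2 * taylor2 \<alpha> v y (s \<alpha> y)" for v
        unfolding reflect_eq s_def by (rule taylor2)
      have "q y * p (reflect \<alpha> y) - p y * q (reflect \<alpha> y) = s \<alpha> y * N \<alpha> y"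
        unfolding e[of p] e[of q] N_def H_def P_def Q_def by algebra
      then have "N \<alpha> y = (q y * p (reflect \<alpha> y) - p y * q (reflect \<alpha> y)) / s \<alpha> y"
        by (metis s0 nonzero_mult_div_cancel_left)
      moreover have "(N / (- 2 * a / n)) * w / a = - (n / 2) * N * w / a\<^sup>2" if "a \<noteq> 0" "n \<noteq> 0" for N a n w :: real
        using that by (simp add: field_simps power2_eq_square)
      ultimately show ?thesis unfolding J_def s_def c_def using y nz by metis
    qed
    have gen: "c * (q1 * p0 - p1 * q0) * w / d = - (c * (q0 * p1 - p0 * q1) * w / d)" for c q0 q1 p0 p1 w d :: real
    proof -
      have "c * (q1 * p0 - p1 * q0) * w = - (c * (q0 * p1 - p0 * q1) * w)" by algebra
      then show ?thesis by (simp only: minus_divide_left)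
    qed
    have "\<alpha> \<bullet> reflect \<alpha> x \<noteq> 0" using False by (simp add: refl)
    from J[OF this] have "J \<alpha> (reflect \<alpha> x) = c * (q (reflect \<alpha> x) * p x - p (reflect \<alpha> x) * q x) * W x / (\<alpha> \<bullet> x)\<^sup>2"
      by (simp only: refl power2_minus)
    also have "\<dots> = - (c * (q x * p (reflect \<alpha> x) - p x * q (reflect \<alpha> x)) * W x / (\<alpha> \<bullet> x)\<^sup>2)" by (rule gen)
    also have "\<dots> = - J \<alpha> x" by (simp only: J[OF False])
    finally show ?thesis .
  qed
  have J0: "(\<integral>x. J \<alpha> x \<partial>lborel) = 0" if a: "\<alpha> \<in> R" for \<alpha>
  proof -
    have "(\<integral>x. J \<alpha> x \<partial>lborel) = (\<integral>x. J \<alpha> (reflect \<alpha> x) \<partial>lborel)"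
      using lborel_integral_reflect[OF nonzero_R[OF a], of "J \<alpha>"] borel_measurable_integrable[OF iJ[OF a]] by simp
    also have "\<dots> = - (\<integral>x. J \<alpha> x \<partial>lborel)" unfolding Jodd[OF a] by simp
    finally show ?thesis by simp
  qed
  have iG: "integrable lborel (G b)" and G0: "(\<integral>x. G b x \<partial>lborel) = 0" for b
    using integral_ibp_direction[OF p q U, of b] unfolding G_def A_def H_def by auto
  define D where "D = (\<lambda>x. p x * L q x * W x - L p x * q x * W x)"
  have cont: "continuous_on UNIV (\<lambda>x. p x * L q x * W x)" "continuous_on UNIV (\<lambda>x. L p x * q x * W x)"
    by (intro continuous_on_mult continuous_on_dunkl_op p q cp cq continuous_weight)+
  have i1: "integrable lborel (\<lambda>x. p x * L q x * W x)"
    by (rule integrable_continuous_vanishing_outside_ball[OF cont(1), of r])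
      (simp add: dunkl_op_eq_0_outside(2)[OF U])
  have i2: "integrable lborel (\<lambda>x. L p x * q x * W x)"
    by (rule integrable_continuous_vanishing_outside_ball[OF cont(2), of r]) (simp add: U(2) U')
  have eq: "D x = (\<Sum>b\<in>Basis. G b x) + (\<Sum>\<alpha>\<in>R. k \<alpha> * J \<alpha> x)" if x: "x \<in> regular_points R" for x
  proof -
    have H: "(\<Sum>b\<in>Basis. (\<alpha> \<bullet> b) * H b x) = H \<alpha> x" for \<alpha>
      unfolding H_def partial_deriv_sum_basis[OF Ck2D(1)[OF p], of \<alpha>] partial_deriv_sum_basis[OF Ck2D(1)[OF q], of \<alpha>]
      by (simp add: sum_distrib_left sum_subtractf right_diff_distrib mult.left_commute)
    have "(\<Sum>b\<in>Basis. \<Sum>\<alpha>\<in>R. k \<alpha> * (\<alpha> \<bullet> b) * (H b x * W x / (\<alpha> \<bullet> x)))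
        = (\<Sum>\<alpha>\<in>R. \<Sum>b\<in>Basis. k \<alpha> * (\<alpha> \<bullet> b) * (H b x * W x / (\<alpha> \<bullet> x)))"
      by (rule sum.swap)
    also have "\<dots> = (\<Sum>\<alpha>\<in>R. k \<alpha> * (H \<alpha> x * W x / (\<alpha> \<bullet> x)))"
    proof (rule sum.cong[OF refl])
      fix \<alpha>
      have "(\<Sum>b\<in>Basis. k \<alpha> * (\<alpha> \<bullet> b) * (H b x * W x / (\<alpha> \<bullet> x)))
         = (\<Sum>b\<in>Basis. k \<alpha> * (((\<alpha> \<bullet> b) * H b x) * (W x / (\<alpha> \<bullet> x))))"
        by (intro sum.cong refl) simp
      also have "\<dots> = k \<alpha> * ((\<Sum>b\<in>Basis. (\<alpha> \<bullet> b) * H b x) * (W x / (\<alpha> \<bullet> x)))"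
        by (simp only: sum_distrib_left sum_distrib_right)
      also have "\<dots> = k \<alpha> * (H \<alpha> x * W x / (\<alpha> \<bullet> x))" unfolding H by simp
      finally show "(\<Sum>b\<in>Basis. k \<alpha> * (\<alpha> \<bullet> b) * (H b x * W x / (\<alpha> \<bullet> x))) = k \<alpha> * (H \<alpha> x * W x / (\<alpha> \<bullet> x))" .
    qed
    finally have G: "(\<Sum>b\<in>Basis. G b x) = (\<Sum>b\<in>Basis. A b x) + (\<Sum>\<alpha>\<in>R. k \<alpha> * (H \<alpha> x * W x / (\<alpha> \<bullet> x)))"
      unfolding G_def sum.distrib by (simp only:)
    have "k \<alpha> * (H \<alpha> x * W x / (\<alpha> \<bullet> x)) + k \<alpha> * J \<alpha> x
        = (k \<alpha> * (2 / (norm \<alpha>)\<^sup>2)) * (p x * Q \<alpha> x - q x * P \<alpha> x) * W x" if "\<alpha> \<in> R" for \<alpha>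
    proof -
      have ax: "\<alpha> \<bullet> x \<noteq> 0" using x that by (auto simp: regular_points_def)
      have gen: "c * (h * w / a) + c * ((- 2 * a / n * (u - v) - h) * w / a) = (c * (2 / n)) * (v - u) * w"
        if "a \<noteq> 0" for a c h w n u v :: real
      proof -
        have "h * w / a + (- 2 * a / n * (u - v) - h) * w / a = (- 2 * a / n * (u - v)) * w / a"
          by (simp add: add_divide_distrib[symmetric] algebra_simps)
        also have "\<dots> = (2 / n) * (v - u) * w" using that by (cases "n = 0") (simp_all add: field_simps)
        finally have "c * (h * w / a + (- 2 * a / n * (u - v) - h) * w / a) = c * ((2 / n) * (v - u) * w)" by (simp only:)
        then show ?thesis by (simp only: distrib_left mult.assoc)
      qed
      show ?thesis unfolding J_def N_def s_def by (rule gen[OF ax])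
    qed
    then have "(\<Sum>\<alpha>\<in>R. k \<alpha> * (H \<alpha> x * W x / (\<alpha> \<bullet> x))) + (\<Sum>\<alpha>\<in>R. k \<alpha> * J \<alpha> x)
       = (\<Sum>\<alpha>\<in>R. (k \<alpha> * (2 / (norm \<alpha>)\<^sup>2)) * (p x * Q \<alpha> x - q x * P \<alpha> x) * W x)"
      unfolding sum.distrib[symmetric] by (intro sum.cong refl)
    also have "\<dots> = (\<Sum>\<alpha>\<in>R. p x * ((k \<alpha> * (2 / (norm \<alpha>)\<^sup>2)) * Q \<alpha> x) * W x - q x * ((k \<alpha> * (2 / (norm \<alpha>)\<^sup>2)) * P \<alpha> x) * W x)"
    proof (rule sum.cong[OF refl])
      have "c * (a * u - b * v) * w = a * (c * u) * w - b * (c * v) * w" for a b c u v w :: real by algebra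
      then show "(k \<alpha> * (2 / (norm \<alpha>)\<^sup>2)) * (p x * Q \<alpha> x - q x * P \<alpha> x) * W x
        = p x * ((k \<alpha> * (2 / (norm \<alpha>)\<^sup>2)) * Q \<alpha> x) * W x - q x * ((k \<alpha> * (2 / (norm \<alpha>)\<^sup>2)) * P \<alpha> x) * W x" for \<alpha> .
    qed
    also have "\<dots> = p x * (\<Sum>\<alpha>\<in>R. k \<alpha> * (2 / (norm \<alpha>)\<^sup>2) * Q \<alpha> x) * W x
         - q x * (\<Sum>\<alpha>\<in>R. k \<alpha> * (2 / (norm \<alpha>)\<^sup>2) * P \<alpha> x) * W x"
      unfolding sum_subtractf sum_distrib_left sum_distrib_right by (rule refl)
    finally have J: "(\<Sum>\<alpha>\<in>R. k \<alpha> * (H \<alpha> x * W x / (\<alpha> \<bullet> x))) + (\<Sum>\<alpha>\<in>R. k \<alpha> * J \<alpha> x)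
      = p x * (\<Sum>\<alpha>\<in>R. k \<alpha> * (2 / (norm \<alpha>)\<^sup>2) * Q \<alpha> x) * W x
         - q x * (\<Sum>\<alpha>\<in>R. k \<alpha> * (2 / (norm \<alpha>)\<^sup>2) * P \<alpha> x) * W x" .
    have "(\<Sum>b\<in>Basis. A b x) = (\<Sum>b\<in>Basis. p x * (2 * taylor2 b q x 0) * W x - q x * (2 * taylor2 b p x 0) * W x)"
      unfolding A_def by (intro sum.cong refl) (simp add: taylor2_def left_diff_distrib)
    also have "\<dots> = p x * (\<Sum>b\<in>Basis. 2 * taylor2 b q x 0) * W x - q x * (\<Sum>b\<in>Basis. 2 * taylor2 b p x 0) * W x"
      unfolding sum_subtractf sum_distrib_left sum_distrib_right by (rule refl)
    finally have Lap: "(\<Sum>b\<in>Basis. A b x) = p x * (\<Sum>b\<in>Basis. 2 * taylor2 b q x 0) * W x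
       - q x * (\<Sum>b\<in>Basis. 2 * taylor2 b p x 0) * W x" .
    have "D x = (\<Sum>b\<in>Basis. A b x) + ((\<Sum>\<alpha>\<in>R. k \<alpha> * (H \<alpha> x * W x / (\<alpha> \<bullet> x))) + (\<Sum>\<alpha>\<in>R. k \<alpha> * J \<alpha> x))"
      unfolding D_def dunkl_op_def Lap J P_def Q_def s_def by algebra
    then show ?thesis unfolding G by (simp only: add.assoc)
  qed
  have iD: "integrable lborel D" unfolding D_def by (rule Bochner_Integration.integrable_diff[OF i1 i2])
  have iGs: "integrable lborel (\<lambda>x. \<Sum>b\<in>Basis. G b x)"
    by (rule Bochner_Integration.integrable_sum) (rule iG)
  have iJs: "integrable lborel (\<lambda>x. \<Sum>\<alpha>\<in>R. k \<alpha> * J \<alpha> x)"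
    by (rule Bochner_Integration.integrable_sum) (rule integrable_mult_right, rule iJ)
  have "(\<integral>x. D x \<partial>lborel) = (\<integral>x. (\<Sum>b\<in>Basis. G b x) + (\<Sum>\<alpha>\<in>R. k \<alpha> * J \<alpha> x) \<partial>lborel)"
  proof (rule integral_cong_AE)
    show "D \<in> borel_measurable lborel" by (rule borel_measurable_integrable[OF iD])
    show "(\<lambda>x. (\<Sum>b\<in>Basis. G b x) + (\<Sum>\<alpha>\<in>R. k \<alpha> * J \<alpha> x)) \<in> borel_measurable lborel"
      by (rule borel_measurable_integrable[OF Bochner_Integration.integrable_add[OF iGs iJs]])
    show "AE x in lborel. D x = (\<Sum>b\<in>Basis. G b x) + (\<Sum>\<alpha>\<in>R. k \<alpha> * J \<alpha> x)"
      using AE_regular by eventually_elim (rule eq)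
  qed
  also have "\<dots> = (\<integral>x. (\<Sum>b\<in>Basis. G b x) \<partial>lborel) + (\<integral>x. (\<Sum>\<alpha>\<in>R. k \<alpha> * J \<alpha> x) \<partial>lborel)"
    by (rule Bochner_Integration.integral_add[OF iGs iJs])
  also have "(\<integral>x. (\<Sum>b\<in>Basis. G b x) \<partial>lborel) = (\<Sum>b\<in>Basis. (\<integral>x. G b x \<partial>lborel))"
    by (rule Bochner_Integration.integral_sum) (rule iG)
  also have "\<dots> = 0" by (simp only: G0 sum.neutral_const)
  also have "(\<integral>x. (\<Sum>\<alpha>\<in>R. k \<alpha> * J \<alpha> x) \<partial>lborel) = (\<Sum>\<alpha>\<in>R. (\<integral>x. k \<alpha> * J \<alpha> x \<partial>lborel))"
    by (rule Bochner_Integration.integral_sum) (rule integrable_mult_right, rule iJ)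
  also have "\<dots> = 0"
    by (rule sum.neutral) (simp add: J0)
  finally have "(\<integral>x. D x \<partial>lborel) = 0" by simp
  then show ?thesis unfolding D_def using Bochner_Integration.integral_diff[OF i1 i2] by simp
qed

section \<open>Weak solutions\<close>

lemma continuous_on_integrand:
  assumes "continuous_on (cball 0 r) a" "continuous_on UNIV b"
  shows "continuous_on (cball 0 r) (\<lambda>x. a x * b x * W x)"
  by (intro continuous_on_mult assms(1) continuous_on_subset[OF assms(2)] continuous_on_subset[OF continuous_weight]) auto

text \<open>Green's identity holds for the polynomial approximations, and both integrals are
  continuous in the uniform norm.\<close>
lemma graph_weak_solution:
  assumes g: "graph r w h" and hc: "continuous_on (cball 0 r) h" and \<psi>: "test_function_on (ball 0 r) \<psi>"
  shows "(LINT x:ball 0 r|lborel. w x * dunkl_laplacian R k \<psi> x * W x) = (LINT x:ball 0 r|lborel. h x * \<psi> x * W x)"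
proof -
  let ?B = "ball (0::'a) r"
  let ?I = "\<lambda>f. \<integral>x. indicator ?B x * f x \<partial>lborel"
  have C: "Ck 2 \<psi>" using \<psi> by (simp add: test_function_on_def)
  \<comment> \<open>An open set on which the test function and hence its derivatives vanish; it contains the complement of the ball.\<close>
  define U where "U = - closure {x. \<psi> x \<noteq> 0}"
  have U: "open U" "\<And>x. x \<in> U \<Longrightarrow> \<psi> x = 0" "- ball 0 r \<subseteq> U"
    using \<psi> closure_subset[of "{x. \<psi> x \<noteq> 0}"] by (auto simp: U_def test_function_on_def)
  note cL = continuous_on_dunkl_op[OF C, of R k]
  have c\<psi>: "continuous_on UNIV \<psi>" using \<psi> unfolding test_function_on_def by (metis Ck.simps(1))
  have wc: "continuous_on (cball 0 r) w" by (rule graph_continuous[OF g])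
  have c1: "continuous_on (cball 0 r) (\<lambda>x. 1 * L \<psi> x * W x)" and c2: "continuous_on (cball 0 r) (\<lambda>x. 1 * \<psi> x * W x)"
    by (rule continuous_on_integrand[OF continuous_on_const cL] continuous_on_integrand[OF continuous_on_const c\<psi>])+
  obtain K1 where K1: "K1 \<ge> 0" "\<And>x. x \<in> cball 0 r \<Longrightarrow> \<bar>1 * L \<psi> x * W x\<bar> \<le> K1"
    using continuous_on_cball_bounded[OF c1] by blast
  obtain K2 where K2: "K2 \<ge> 0" "\<And>x. x \<in> cball 0 r \<Longrightarrow> \<bar>1 * \<psi> x * W x\<bar> \<le> K2"
    using continuous_on_cball_bounded[OF c2] by blast
  define m where "m = measure lborel ?B"
  have B: "?B \<in> sets borel" by simp
  note B = B emeasure_lborel_ball_finite[of "0::'a" r]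
  have est: "\<bar>?I (\<lambda>x. a x * b x * W x) - ?I (\<lambda>x. a' x * b x * W x)\<bar> \<le> (e * K) * m"
    if a: "continuous_on (cball 0 r) a" "continuous_on (cball 0 r) a'" and b: "continuous_on UNIV b"
      and e: "\<And>x. x \<in> cball 0 r \<Longrightarrow> \<bar>a' x - a x\<bar> < e" and K: "\<And>x. x \<in> cball 0 r \<Longrightarrow> \<bar>1 * b x * W x\<bar> \<le> K" "K \<ge> 0"
    for a a' b e K
  proof -
    note i = integrable_on_ball[OF continuous_on_integrand[OF a(1) b]] integrable_on_ball[OF continuous_on_integrand[OF a(2) b]]
    have "?I (\<lambda>x. a x * b x * W x) - ?I (\<lambda>x. a' x * b x * W x)
       = (\<integral>x. indicator ?B x * (a x * b x * W x) - indicator ?B x * (a' x * b x * W x) \<partial>lborel)"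
      by (rule Bochner_Integration.integral_diff[OF i, symmetric])
    also have "\<bar>\<dots>\<bar> \<le> (e * K) * measure lborel ?B"
    proof (rule abs_integral_le_measure[OF Bochner_Integration.integrable_diff[OF i] B])
      have "\<bar>indicator ?B x * (a x * b x * W x) - indicator ?B x * (a' x * b x * W x)\<bar> \<le> e * K * indicator ?B x" for x
      proof (cases "x \<in> ?B")
        case True
        then have x: "x \<in> cball 0 r" by simp
        have "\<bar>a x * b x * W x - a' x * b x * W x\<bar> = \<bar>a' x - a x\<bar> * \<bar>1 * b x * W x\<bar>"
        proof -
          have "a x * b x * W x - a' x * b x * W x = - ((a' x - a x) * (1 * b x * W x))" by algebra
          then show ?thesis by (simp only: abs_minus_cancel abs_mult)
        qed
        also have "\<dots> \<le> e * K" using e[OF x] K(1)[OF x] K(2) by (intro mult_mono) auto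
        finally show ?thesis using True by simp
      qed simp
      then show "AE x in lborel. \<bar>indicator ?B x * (a x * b x * W x) - indicator ?B x * (a' x * b x * W x)\<bar> \<le> e * K * indicator ?B x"
        by simp
    qed
    finally show ?thesis unfolding m_def .
  qed
  have "\<bar>?I (\<lambda>x. w x * L \<psi> x * W x) - ?I (\<lambda>x. h x * \<psi> x * W x)\<bar> \<le> ((K1 + K2) * m) * e" if "e > 0" for e
  proof -
    from g that obtain p where p: "real_polynomial_function p"
      "\<And>x. x \<in> cball 0 r \<Longrightarrow> \<bar>p x - w x\<bar> < e" "\<And>x. x \<in> cball 0 r \<Longrightarrow> \<bar>L p x - h x\<bar> < e"
      unfolding graph_def by meson
    have 1: "\<bar>?I (\<lambda>x. w x * L \<psi> x * W x) - ?I (\<lambda>x. p x * L \<psi> x * W x)\<bar> \<le> (e * K1) * m"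
      by (rule est[OF wc rpf_continuous_on[OF p(1)] cL p(2) K1(2,1)])
    have 2: "\<bar>?I (\<lambda>x. h x * \<psi> x * W x) - ?I (\<lambda>x. L p x * \<psi> x * W x)\<bar> \<le> (e * K2) * m"
      by (rule est[OF hc rpf_continuous_on[OF rpf_L[OF p(1)]] c\<psi> p(3) K2(2,1)])
    have z: "(\<lambda>x. indicator ?B x * (p x * L \<psi> x * W x)) = (\<lambda>x. p x * L \<psi> x * W x)"
      "(\<lambda>x. indicator ?B x * (L p x * \<psi> x * W x)) = (\<lambda>x. L p x * \<psi> x * W x)"
      using dunkl_op_eq_0_outside(2)[OF U] U(2,3) by (fastforce simp: fun_eq_iff indicator_def)+
    have "?I (\<lambda>x. p x * L \<psi> x * W x) = ?I (\<lambda>x. L p x * \<psi> x * W x)"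
      unfolding z by (rule dunkl_green[OF Ck_rpf[OF p(1)] C U])
    with 1 2 have "\<bar>?I (\<lambda>x. w x * L \<psi> x * W x) - ?I (\<lambda>x. h x * \<psi> x * W x)\<bar> \<le> (e * K1) * m + (e * K2) * m" by linarith
    also have "\<dots> = ((K1 + K2) * m) * e" by algebra
    finally show ?thesis .
  qed
  then have "\<bar>?I (\<lambda>x. w x * L \<psi> x * W x) - ?I (\<lambda>x. h x * \<psi> x * W x)\<bar> \<le> 0" by (rule le_0_if_le_all_mult)
  then show ?thesis
    unfolding set_lebesgue_integral_def dunkl_laplacian_eq[OF C] by simp
qed

text \<open>Uniform continuity, applied to a point and its radial projection onto the sphere.\<close>
lemma small_near_sphere:
  fixes w :: "'a::euclidean_space \<Rightarrow> real"
  assumes r: "r > 0" and w: "continuous_on (cball 0 r) w" "\<And>x. x \<in> sphere 0 r \<Longrightarrow> w x = 0" and \<omega>: "\<omega> > 0"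
  obtains d where "0 < d" "d \<le> 1" "d \<le> r\<^sup>2 / 4"
    "\<And>x. x \<in> ball 0 r \<Longrightarrow> r\<^sup>2 - (norm x)\<^sup>2 \<le> 2 * d \<Longrightarrow> \<bar>w x\<bar> \<le> \<omega>"
proof -
  have "uniformly_continuous_on (cball 0 r) w"
    by (rule compact_uniformly_continuous[OF w(1) compact_cball])
  then have "\<exists>d>0. \<forall>x\<in>cball 0 r. \<forall>y\<in>cball 0 r. dist y x < d \<longrightarrow> dist (w y) (w x) < \<omega>"
    unfolding uniformly_continuous_on_def using \<omega> by (simp only:)
  then obtain d0 where d0: "d0 > 0" "\<forall>x\<in>cball 0 r. \<forall>y\<in>cball 0 r. dist y x < d0 \<longrightarrow> dist (w y) (w x) < \<omega>"
    by (elim exE conjE)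
  \<comment> \<open>The second bound keeps \<open>x\<close> away from the origin, where the projection is undefined; the last one makes the projection move \<open>x\<close> by less than \<open>d0\<close>.\<close>
  define d where "d = min 1 (min (r\<^sup>2 / 4) (d0 * r / 4))"
  have d: "0 < d" "d \<le> 1" "d \<le> r\<^sup>2 / 4" "d \<le> d0 * r / 4" using r d0(1) by (auto simp: d_def)
  have "\<bar>w x\<bar> \<le> \<omega>" if x: "x \<in> ball 0 r" "r\<^sup>2 - (norm x)\<^sup>2 \<le> 2 * d" for x
  proof -
    have nx: "norm x < r" "r\<^sup>2 - (norm x)\<^sup>2 \<le> 2 * d" using x by auto
    have "(norm x)\<^sup>2 > 0" using nx(2) d(3) zero_less_power[OF r, of 2] by linarith
    then have x0: "norm x > 0" by simp
    let ?y = "(r / norm x) *\<^sub>R x"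
    have y: "?y \<in> sphere 0 r" using x0 r by simp
    have "?y - x = ((r - norm x) / norm x) *\<^sub>R x" using x0 by (simp add: diff_divide_distrib scaleR_diff_left)
    then have y1: "dist ?y x = r - norm x" using x0 nx(1) by (simp add: dist_norm)
    have y2: "r * (r - norm x) \<le> 2 * d"
    proof -
      have "r * (r - norm x) \<le> (r + norm x) * (r - norm x)" using nx(1) by (intro mult_right_mono) auto
      also have "\<dots> = r\<^sup>2 - (norm x)\<^sup>2" by (simp add: power2_eq_square algebra_simps)
      finally show ?thesis using nx(2) by linarith
    qed
    have "2 * d < r * d0" using d(4) mult_pos_pos[OF r d0(1)] mult.commute[of r d0] by linarith
    from le_less_trans[OF y2 this] have "r * dist ?y x < r * d0" unfolding y1 .
    then have "dist ?y x < d0" using r by simp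
    moreover have "x \<in> cball 0 r" "?y \<in> cball 0 r" using y nx(1) by simp_all
    ultimately have "dist (w ?y) (w x) < \<omega>" using d0(2) by blast
    then show ?thesis using w(2)[OF y] by (simp add: dist_real_def)
  qed
  with d(1-3) show thesis by (rule that)
qed

text \<open>The cutoff has derivatives of order \<open>1 / d\<close> and \<open>1 /
  d\<^sup>2\<close>. The second-order term is multiplied by \<open>v\<close>, which is itself of
  order \<open>d\<close> on the shell because it vanishes on the sphere; hence the total error is of
  order \<open>1 / d\<close> only, and it is supported in a shell of width of order
  \<open>d\<close>.\<close>
lemma cutoff_error_bound:
  assumes r: "r > 0" and s: "real_polynomial_function s"
    and \<theta>: "\<And>t. t \<ge> 2 \<Longrightarrow> \<theta> t = 1" "\<And>t. 0 \<le> \<theta> t" "\<And>t. \<theta> t \<le> 1"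
      "\<And>t. (\<theta> has_real_derivative \<theta>' t) (at t)" "\<And>t. (\<theta>' has_real_derivative \<theta>'' t) (at t)"
      "\<And>t. t > 2 \<Longrightarrow> \<theta>' t = 0" "\<And>t. t > 2 \<Longrightarrow> \<theta>'' t = 0"
      "\<And>t. \<bar>\<theta>' t\<bar> \<le> M" "\<And>t. \<bar>\<theta>'' t\<bar> \<le> M"
  defines "v \<equiv> \<lambda>x. (r\<^sup>2 - (norm x)\<^sup>2) * s x"
  defines "u \<equiv> \<lambda>d x. \<theta> ((r\<^sup>2 - (norm x)\<^sup>2) / d) * v x"
  obtains C where "C \<ge> 0" "\<And>d x. 0 < d \<Longrightarrow> d \<le> 1 \<Longrightarrow> x \<in> ball 0 r \<Longrightarrow> x \<in> regular_points R \<Longrightarrow>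
    \<bar>L v x - L (u d) x\<bar> \<le> C / d * indicator {x\<in>ball 0 r. r\<^sup>2 - (norm x)\<^sup>2 \<le> 2 * d} x"
proof -
  have v: "real_polynomial_function v" unfolding v_def
    by (rule rpf_mult[OF real_polynomial_function_diff[OF rpf_const rpf_norm_power2] s])
  have M0: "M \<ge> 0" using \<theta>(8)[of 0] by linarith
  define q where "q = L v"
  have q: "real_polynomial_function q" unfolding q_def by (rule rpf_L[OF v])
  obtain S where S: "S \<ge> 0" "\<And>x. x \<in> cball 0 r \<Longrightarrow> \<bar>s x\<bar> \<le> S"
    using continuous_on_cball_bounded[OF rpf_continuous_on[OF s]] by blast
  obtain Q where Q: "Q \<ge> 0" "\<And>x. x \<in> cball 0 r \<Longrightarrow> \<bar>q x\<bar> \<le> Q"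
    using continuous_on_cball_bounded[OF rpf_continuous_on[OF q]] by blast
  obtain V where V: "V \<ge> 0" "\<And>x. x \<in> cball 0 r \<Longrightarrow> \<bar>partial_deriv x v x\<bar> \<le> V"
    using continuous_on_cball_bounded[OF continuous_on_euler_derivative[OF v]] by blast
  define C where "C = Q + 4 * M * V + (2 * S) * (4 * r\<^sup>2 * M + 2 * hdim * M)"
  have C0: "C \<ge> 0" using Q(1) M0 V(1) S(1) hdim_pos unfolding C_def by (intro add_nonneg_nonneg mult_nonneg_nonneg) auto
  have bnd: "\<bar>q x - L (u d) x\<bar> \<le> C / d * indicator {x\<in>ball 0 r. r\<^sup>2 - (norm x)\<^sup>2 \<le> 2 * d} x"
    if d: "0 < d" "d \<le> 1" and x: "x \<in> ball 0 r" "x \<in> regular_points R" for d x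
  proof -
    define E where "E = {x\<in>ball (0::'a) r. r\<^sup>2 - (norm x)\<^sup>2 \<le> 2 * d}"
    define \<eta> where "\<eta> t = \<theta> ((r\<^sup>2 - t) / d)" for t
    define \<eta>' where "\<eta>' t = - (\<theta>' ((r\<^sup>2 - t) / d) / d)" for t
    define \<eta>'' where "\<eta>'' t = \<theta>'' ((r\<^sup>2 - t) / d) / d\<^sup>2" for t
    have lin: "((\<lambda>t. (r\<^sup>2 - t) / d) has_real_derivative - 1 / d) (at t)" for t
      using d(1) by (auto intro!: derivative_eq_intros)
    have h1: "(\<eta> has_real_derivative \<eta>' t) (at t)" for t
      unfolding \<eta>_def[abs_def] \<eta>'_def using DERIV_chain2[OF \<theta>(4) lin] by simp
    have h2: "(\<eta>' has_real_derivative \<eta>'' t) (at t)" for t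
      unfolding \<eta>'_def[abs_def] \<eta>''_def
      using DERIV_minus[OF DERIV_cdivide[OF DERIV_chain2[OF \<theta>(5) lin], of d]] by (simp add: power2_eq_square)
    define t where "t = (r\<^sup>2 - (norm x)\<^sup>2) / d"
    have xc: "x \<in> cball 0 r" using x by simp
    have "L (u d) x = \<theta> t * q x + 4 * (- (\<theta>' t / d)) * partial_deriv x v x
        + v x * (4 * (norm x)\<^sup>2 * (\<theta>'' t / d\<^sup>2) + 2 * hdim * (- (\<theta>' t / d)))"
      using L_radial_mult[OF h1 h2 v x(2)] unfolding u_def \<eta>_def \<eta>'_def \<eta>''_def t_def q_def[symmetric] .
    then have e: "q x - L (u d) x = (1 - \<theta> t) * q x + (4 * (\<theta>' t / d)) * partial_deriv x v x
        - v x * (4 * (norm x)\<^sup>2 * (\<theta>'' t / d\<^sup>2) - 2 * hdim * (\<theta>' t / d))"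
      by algebra
    have "\<bar>q x - L (u d) x\<bar> \<le> C / d * indicator E x"
    proof (cases "x \<in> E")
      case False
      then have "t > 2" using x d(1) by (simp add: E_def t_def field_simps)
      then have "q x - L (u d) x = 0" unfolding e by (simp add: \<theta>(1,6,7))
      then show ?thesis using False by simp
    next
      case True
      have nx: "(norm x)\<^sup>2 \<le> r\<^sup>2" using xc r by (simp add: power_mono)
      have vx: "\<bar>v x\<bar> \<le> 2 * d * S"
      proof -
        have "\<bar>v x\<bar> = (r\<^sup>2 - (norm x)\<^sup>2) * \<bar>s x\<bar>" using nx by (simp add: v_def abs_mult)
        also have "\<dots> \<le> (2 * d) * S"
          using True S(2)[OF xc] d(1) by (intro mult_mono) (auto simp: E_def)
        finally show ?thesis .
      qed
      have a1: "\<bar>\<theta>' t / d\<bar> \<le> M / d" using \<theta>(8)[of t] d(1) by (simp add: divide_right_mono)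
      have a2: "\<bar>\<theta>'' t / d\<^sup>2\<bar> \<le> M / d\<^sup>2" using \<theta>(9)[of t] d(1) by (simp add: divide_right_mono)
      have T1: "\<bar>(1 - \<theta> t) * q x\<bar> \<le> Q / d"
      proof -
        have "\<bar>(1 - \<theta> t) * q x\<bar> \<le> 1 * Q" unfolding abs_mult
          using \<theta>(2,3)[of t] Q(2)[OF xc] by (intro mult_mono) auto
        also have "1 * Q \<le> Q / d"
          using d(1) mult_left_mono[OF d(2) Q(1)] by (simp add: pos_le_divide_eq)
        finally show ?thesis .
      qed
      have T2: "\<bar>(4 * (\<theta>' t / d)) * partial_deriv x v x\<bar> \<le> (4 * (M / d)) * V"
        unfolding abs_mult[of _ "partial_deriv x v x"] abs_mult[of 4]
        using a1 V(2)[OF xc] M0 d(1) by (intro mult_mono) auto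
      have T3: "\<bar>v x * (4 * (norm x)\<^sup>2 * (\<theta>'' t / d\<^sup>2) - 2 * hdim * (\<theta>' t / d))\<bar>
         \<le> (2 * d * S) * (4 * r\<^sup>2 * (M / d\<^sup>2) + 2 * hdim * (M / d))"
      proof -
        have "\<bar>4 * (norm x)\<^sup>2 * (\<theta>'' t / d\<^sup>2)\<bar> \<le> 4 * r\<^sup>2 * (M / d\<^sup>2)"
          unfolding abs_mult[of "4 * (norm x)\<^sup>2"] using nx a2 by (intro mult_mono) auto
        moreover have "\<bar>2 * hdim * (\<theta>' t / d)\<bar> \<le> 2 * hdim * (M / d)"
          unfolding abs_mult[of "2 * hdim"] using a1 hdim_pos by (intro mult_mono) auto
        ultimately have "\<bar>4 * (norm x)\<^sup>2 * (\<theta>'' t / d\<^sup>2) - 2 * hdim * (\<theta>' t / d)\<bar> \<le> 4 * r\<^sup>2 * (M / d\<^sup>2) + 2 * hdim * (M / d)"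
          by linarith
        with vx show ?thesis unfolding abs_mult[of "v x"] using d(1) S(1) by (intro mult_mono) auto
      qed
      have T4: "(2 * d * S) * (4 * r\<^sup>2 * (M / d\<^sup>2) + 2 * hdim * (M / d)) \<le> ((2 * S) * (4 * r\<^sup>2 * M + 2 * hdim * M)) / d"
      proof -
        have dd: "d * (M / d\<^sup>2) = M / d" "d * (M / d) = M" using d(1) by (simp_all add: power2_eq_square)
        have "(2 * d * S) * (4 * r\<^sup>2 * (M / d\<^sup>2) + 2 * hdim * (M / d))
           = (2 * S) * (4 * r\<^sup>2 * (d * (M / d\<^sup>2))) + (2 * S) * (2 * hdim * (d * (M / d)))"
          by (simp only: distrib_left mult_ac)
        also have "\<dots> = (2 * S) * (4 * r\<^sup>2 * M) / d + (2 * S) * (2 * hdim * M) * 1"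
          unfolding dd by simp
        also have "(2 * S) * (2 * hdim * M) * 1 \<le> (2 * S) * (2 * hdim * M) * (1 / d)"
          using d(1,2) S(1) hdim_pos M0 by (intro mult_left_mono) auto
        finally show ?thesis by (simp add: distrib_left add_divide_distrib)
      qed
      have "C / d = Q / d + (4 * (M / d)) * V + ((2 * S) * (4 * r\<^sup>2 * M + 2 * hdim * M)) / d"
        unfolding C_def by (simp add: add_divide_distrib)
      then have "\<bar>q x - L (u d) x\<bar> \<le> C / d" unfolding e using T1 T2 T3 T4 by linarith
      then show ?thesis using True by simp
    qed
    then show ?thesis unfolding E_def .
  qed
  show thesis by (rule that[OF C0]) (use bnd in \<open>simp add: q_def\<close>)
qed

text \<open>Write \<open>q = L v\<close> with a polynomial \<open>v\<close> vanishing on the sphere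
  and test with a cutoff of \<open>v\<close>. The error is of order \<open>1 / d\<close> on a shell
  of volume of order \<open>d\<close>, on which \<open>w\<close> is uniformly small, so it
  disappears in the limit.\<close>
lemma weakly_harmonic_orthogonal_polynomial:
  assumes r: "r > 0" and w: "continuous_on (cball 0 r) w" "\<And>x. x \<in> sphere 0 r \<Longrightarrow> w x = 0"
    and weak: "\<And>\<psi>. test_function_on (ball 0 r) \<psi> \<Longrightarrow> (LINT x:ball 0 r|lborel. w x * dunkl_laplacian R k \<psi> x * W x) = 0"
    and q: "real_polynomial_function q"
  shows "(\<integral>x. indicator (ball 0 r) x * (w x * q x * W x) \<partial>lborel) = 0"
proof -
  let ?B = "ball (0::'a) r"
  obtain s where s: "real_polynomial_function s" "\<And>x. L (\<lambda>x. (r\<^sup>2 - (norm x)\<^sup>2) * s x) x = q x"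
    using L_surj_ball[OF q, of r] by blast
  define v where "v = (\<lambda>x. (r\<^sup>2 - (norm x)\<^sup>2) * s x)"
  have v: "real_polynomial_function v" unfolding v_def
    by (rule rpf_mult[OF real_polynomial_function_diff[OF rpf_const rpf_norm_power2] s(1)])
  have Lv: "L v x = q x" for x unfolding v_def by (rule s(2))
  obtain \<theta> \<theta>' \<theta>'' :: "real \<Rightarrow> real" and M where \<theta>: "\<And>n. Ck n \<theta>" "\<And>t. t \<le> 1 \<Longrightarrow> \<theta> t = 0" "\<And>t. t \<ge> 2 \<Longrightarrow> \<theta> t = 1"
    "\<And>t. 0 \<le> \<theta> t" "\<And>t. \<theta> t \<le> 1"
    "\<And>t. (\<theta> has_real_derivative \<theta>' t) (at t)" "\<And>t. (\<theta>' has_real_derivative \<theta>'' t) (at t)"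
    "\<And>t. t > 2 \<Longrightarrow> \<theta>' t = 0" "\<And>t. t > 2 \<Longrightarrow> \<theta>'' t = 0"
    "\<And>t. \<bar>\<theta>' t\<bar> \<le> M" "\<And>t. \<bar>\<theta>'' t\<bar> \<le> M"
    by (rule smooth_step) (rule that, assumption+)
  obtain Wm where Wm: "Wm \<ge> 0" "\<And>x. x \<in> cball 0 r \<Longrightarrow> \<bar>W x\<bar> \<le> Wm"
    using continuous_on_cball_bounded[OF continuous_on_subset[OF continuous_weight subset_UNIV]] by blast
  obtain C where C0: "C \<ge> 0" and C: "\<And>d x. 0 < d \<Longrightarrow> d \<le> 1 \<Longrightarrow> x \<in> ball 0 r \<Longrightarrow> x \<in> regular_points R \<Longrightarrow>
      \<bar>L v x - L (\<lambda>x. \<theta> ((r\<^sup>2 - (norm x)\<^sup>2) / d) * v x) x\<bar> \<le> C / d * indicator {x\<in>ball 0 r. r\<^sup>2 - (norm x)\<^sup>2 \<le> 2 * d} x"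
    using cutoff_error_bound[OF r s(1) \<theta>(3-11)] unfolding v_def by blast
  define A where "A = measure lborel ?B * (2 * real DIM('a) / r\<^sup>2)"
  have "\<bar>\<integral>x. indicator ?B x * (w x * q x * W x) \<partial>lborel\<bar> \<le> (C * Wm * A) * \<omega>" if \<omega>: "\<omega> > 0" for \<omega>
  proof -
    obtain d where d: "0 < d" "d \<le> 1" "d \<le> r\<^sup>2 / 4"
      and wd: "\<And>x. x \<in> ?B \<Longrightarrow> r\<^sup>2 - (norm x)\<^sup>2 \<le> 2 * d \<Longrightarrow> \<bar>w x\<bar> \<le> \<omega>"
      by (rule small_near_sphere[OF r w \<omega>]) (assumption, rule that, assumption+)
    define E where "E = {x\<in>?B. r\<^sup>2 - (norm x)\<^sup>2 \<le> 2 * d}"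
    have wE: "\<bar>w x\<bar> \<le> \<omega>" if "x \<in> E" for x using that wd by (auto simp: E_def)
    define \<psi> where "\<psi> = (\<lambda>x. \<theta> ((r\<^sup>2 - (norm x)\<^sup>2) / d) * v x)"
    have \<psi>: "test_function_on ?B \<psi>" unfolding \<psi>_def by (rule test_function_cutoff[OF \<theta>(1,2) d(1) r v])
    have C\<psi>: "Ck 2 \<psi>" using \<psi> by (simp add: test_function_on_def)
    have bnd: "\<bar>q x - L \<psi> x\<bar> \<le> C / d * indicator E x" if "x \<in> ?B" "x \<in> regular_points R" for x
      using C[OF d(1,2) that] unfolding Lv \<psi>_def E_def .
    have cL: "continuous_on UNIV (L \<psi>)" by (rule continuous_on_dunkl_op[OF C\<psi>])
    have i1: "integrable lborel (\<lambda>x. indicator ?B x * (w x * q x * W x))"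
      by (rule integrable_on_ball[OF continuous_on_integrand[OF w(1) rpf_continuous_on[OF q]]])
    have i2: "integrable lborel (\<lambda>x. indicator ?B x * (w x * L \<psi> x * W x))"
      by (rule integrable_on_ball[OF continuous_on_integrand[OF w(1) cL]])
    have zero: "(\<integral>x. indicator ?B x * (w x * L \<psi> x * W x) \<partial>lborel) = 0"
      using weak[OF \<psi>] unfolding set_lebesgue_integral_def dunkl_laplacian_eq[OF C\<psi>] by simp
    have E: "E \<in> sets borel" "emeasure lborel E < \<infinity>"
    proof -
      have "closed {x::'a. r\<^sup>2 - (norm x)\<^sup>2 \<le> 2 * d}" by (intro closed_Collect_le continuous_intros)
      then have "?B \<inter> {x::'a. r\<^sup>2 - (norm x)\<^sup>2 \<le> 2 * d} \<in> sets borel" by simp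
      moreover have "E = ?B \<inter> {x. r\<^sup>2 - (norm x)\<^sup>2 \<le> 2 * d}" by (auto simp: E_def)
      ultimately show "E \<in> sets borel" by simp
      have "emeasure lborel E \<le> emeasure lborel ?B" by (rule emeasure_mono) (auto simp: E_def)
      then show "emeasure lborel E < \<infinity>" using emeasure_lborel_ball_finite[of "0::'a" r] by (rule le_less_trans)
    qed
    have "(\<integral>x. indicator ?B x * (w x * q x * W x) \<partial>lborel)
        = (\<integral>x. indicator ?B x * (w x * q x * W x) - indicator ?B x * (w x * L \<psi> x * W x) \<partial>lborel)"
      unfolding Bochner_Integration.integral_diff[OF i1 i2] zero by simp
    also have "\<bar>\<dots>\<bar> \<le> (\<omega> * (C / d) * Wm) * measure lborel E"
    proof (rule abs_integral_le_measure[OF Bochner_Integration.integrable_diff[OF i1 i2] E])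
      show "AE x in lborel. \<bar>indicator ?B x * (w x * q x * W x) - indicator ?B x * (w x * L \<psi> x * W x)\<bar>
          \<le> \<omega> * (C / d) * Wm * indicator E x"
        using AE_regular
      proof eventually_elim
        case (elim x)
        show ?case
        proof (cases "x \<in> ?B")
          case False
          then have "x \<notin> E" by (simp add: E_def)
          with False show ?thesis by simp
        next
          case True
          have "\<bar>w x * q x * W x - w x * L \<psi> x * W x\<bar> = \<bar>w x\<bar> * \<bar>q x - L \<psi> x\<bar> * \<bar>W x\<bar>"
          proof -
            have "w x * q x * W x - w x * L \<psi> x * W x = w x * (q x - L \<psi> x) * W x" by algebra
            then show ?thesis by (simp only: abs_mult)
          qed
          also have "\<dots> \<le> \<omega> * (C / d) * Wm * indicator E x"
          proof (cases "x \<in> E")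
            case xE: True
            have "\<bar>w x\<bar> * \<bar>q x - L \<psi> x\<bar> * \<bar>W x\<bar> \<le> \<omega> * (C / d) * Wm"
              using wE[OF xE] bnd[OF True elim] xE Wm True C0 d(1) \<omega> by (intro mult_mono) auto
            then show ?thesis using xE by simp
          next
            case False
            then have "\<bar>q x - L \<psi> x\<bar> \<le> 0" using bnd[OF True elim] by simp
            then show ?thesis using False by simp
          qed
          finally show ?thesis using True by simp
        qed
      qed
    qed
    also have "\<dots> \<le> (\<omega> * (C / d) * Wm) * (A * d)"
      using measure_shell_le[where 'a='a, OF r d(1,3)] C0 Wm(1) d(1) \<omega> unfolding E_def A_def
      by (intro mult_left_mono mult_nonneg_nonneg) auto
    also have "\<dots> = ((C / d) * d) * Wm * A * \<omega>" by (simp only: mult_ac)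
    also have "\<dots> = (C * Wm * A) * \<omega>" using d(1) by simp
    finally show ?thesis .
  qed
  then have "\<bar>\<integral>x. indicator ?B x * (w x * q x * W x) \<partial>lborel\<bar> \<le> 0" by (rule le_0_if_le_all_mult)
  then show ?thesis by simp
qed

text \<open>By density of the polynomials \<open>w\<close> is orthogonal to itself with respect to
  the weight, so it vanishes almost everywhere and therefore everywhere by continuity.\<close>
lemma weakly_harmonic_eq_0:
  assumes r: "r > 0" and w: "continuous_on (cball 0 r) w" "\<And>x. x \<in> sphere 0 r \<Longrightarrow> w x = 0"
    and weak: "\<And>\<psi>. test_function_on (ball 0 r) \<psi> \<Longrightarrow> (LINT x:ball 0 r|lborel. w x * dunkl_laplacian R k \<psi> x * W x) = 0"
    and x: "x \<in> cball 0 r"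
  shows "w x = 0"
proof -
  let ?B = "ball (0::'a) r"
  have cW: "continuous_on (cball 0 r) W" by (rule continuous_on_subset[OF continuous_weight subset_UNIV])
  have c: "continuous_on (cball 0 r) (\<lambda>x. w x * a x * W x)" if "continuous_on (cball 0 r) a" for a
    by (intro continuous_on_mult w(1) that cW)
  obtain K where K: "K \<ge> 0" "\<And>x. x \<in> cball 0 r \<Longrightarrow> \<bar>w x * W x\<bar> \<le> K"
    using continuous_on_cball_bounded[OF continuous_on_mult[OF w(1) cW]] by blast
  note i = integrable_on_ball[OF c[OF w(1)]]
  have "\<bar>\<integral>x. indicator ?B x * (w x * w x * W x) \<partial>lborel\<bar> \<le> (K * measure lborel ?B) * e" if e: "e > 0" for e
  proof -
    obtain q where q: "real_polynomial_function q" "\<And>x. x \<in> cball 0 r \<Longrightarrow> \<bar>w x - q x\<bar> < e"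
      using Stone_Weierstrass_real_polynomial_function[OF compact_cball w(1) e] by blast
    note i2 = integrable_on_ball[OF c[OF rpf_continuous_on[OF q(1)]]]
    have "(\<integral>x. indicator ?B x * (w x * w x * W x) \<partial>lborel)
       = (\<integral>x. indicator ?B x * (w x * w x * W x) - indicator ?B x * (w x * q x * W x) \<partial>lborel)"
    proof -
      have "(\<integral>x. indicator ?B x * (w x * q x * W x) \<partial>lborel) = 0"
        by (rule weakly_harmonic_orthogonal_polynomial[OF r w weak q(1)])
      then show ?thesis unfolding Bochner_Integration.integral_diff[OF i i2] by simp
    qed
    also have "\<bar>\<dots>\<bar> \<le> (K * e) * measure lborel ?B"
    proof (rule abs_integral_le_measure[OF Bochner_Integration.integrable_diff[OF i i2]])
      have "\<bar>indicator ?B x * (w x * w x * W x) - indicator ?B x * (w x * q x * W x)\<bar> \<le> K * e * indicator ?B x" for x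
      proof (cases "x \<in> ?B")
        case True
        then have xc: "x \<in> cball 0 r" by simp
        have "\<bar>w x * w x * W x - w x * q x * W x\<bar> = \<bar>w x * W x\<bar> * \<bar>w x - q x\<bar>"
          unfolding abs_mult[symmetric] by (rule arg_cong[where f = abs]) algebra
        also have "\<dots> \<le> K * e" using K(2)[OF xc] q(2)[OF xc] K(1) by (intro mult_mono) auto
        finally show ?thesis using True by simp
      qed simp
      then show "AE x in lborel. \<bar>indicator ?B x * (w x * w x * W x) - indicator ?B x * (w x * q x * W x)\<bar> \<le> K * e * indicator ?B x"
        by simp
      show "emeasure lborel ?B < \<infinity>" by (rule emeasure_lborel_ball_finite)
    qed simp
    also have "\<dots> = (K * measure lborel ?B) * e" by algebra
    finally show ?thesis .
  qed
  then have "\<bar>\<integral>x. indicator ?B x * (w x * w x * W x) \<partial>lborel\<bar> \<le> 0" by (rule le_0_if_le_all_mult)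
  then have "(\<integral>x. indicator ?B x * (w x * w x * W x) \<partial>lborel) = 0" by simp
  moreover have "AE x in lborel. 0 \<le> indicator ?B x * (w x * w x * W x)"
    by (simp add: weight_nonneg)
  ultimately have "AE x in lborel. indicator ?B x * (w x * w x * W x) = 0"
    using integral_nonneg_eq_0_iff_AE[OF i] by blast
  with AE_regular have "AE x in lborel. x \<in> ?B \<longrightarrow> w x = 0"
  proof eventually_elim
    case (elim x)
    show ?case
    proof
      assume "x \<in> ?B"
      then have "w x * w x * W x = 0" using elim(2) by simp
      with weight_pos[OF elim(1)] show "w x = 0" by simp
    qed
  qed
  from continuous_on_eq_0_AE[OF open_ball continuous_on_subset[OF w(1) ball_subset_cball] this]
  have "w y = 0" if "y \<in> ?B" for y using that by blast
  with w(2) x show ?thesis by (cases "norm x = r") auto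
qed

text \<open>A weak solution \<open>v\<close> is compared with the generalised solution
  \<open>z\<close> of the linear problem with right-hand side \<open>\<phi> (v x)\<close>. Their
  difference is weakly harmonic with zero boundary values, so \<open>v = z\<close>; hence
  \<open>v\<close> lies in the closure of the operator, where the maximum principle and the
  monotonicity of \<open>\<phi>\<close> give uniqueness.\<close>
theorem semilinear_dirichlet_unique_solution:
  assumes r: "r > 0" and \<phi>: "\<phi> \<in> {0..} \<rightarrow> {0..}" "locally_lipschitz_on {0..} \<phi>" "mono_on {0..} \<phi>" "\<phi> 0 = 0"
    and f: "continuous_on (sphere 0 r) f" "\<forall>x\<in>sphere 0 r. 0 \<le> f x"
  shows "\<exists>u. dunkl_dirichlet_solution R k \<phi> r f u \<and>
           (\<forall>v. dunkl_dirichlet_solution R k \<phi> r f v \<longrightarrow> (\<forall>x\<in>cball 0 r. v x = u x))"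
proof -
  have c\<phi>: "continuous_on {0..} \<phi>"
    using local_lipschitz_continuous_on[of "UNIV::real set" "{0..}" "\<lambda>_. \<phi>" 0] \<phi>(2)
    by (simp add: locally_lipschitz_on_def)
  have c: "continuous_on (cball 0 r) (\<lambda>x. \<phi> (v x))"
    if "continuous_on (cball 0 r) v" "\<forall>x\<in>cball 0 r. 0 \<le> v x" for v
    by (rule continuous_on_compose2[OF c\<phi> that(1)]) (use that(2) in auto)
  obtain u where u: "graph r u (\<lambda>x. \<phi> (u x))" "\<forall>x\<in>sphere 0 r. u x = f x" "\<forall>x\<in>cball 0 r. 0 \<le> u x"
    using semilinear_dirichlet[OF r \<phi> f] by blast
  have cu: "continuous_on (cball 0 r) u" by (rule graph_continuous[OF u(1)])
  have sol: "dunkl_dirichlet_solution R k \<phi> r f u"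
    unfolding dunkl_dirichlet_solution_def dunkl_semilinear_solution_def
  proof (intro conjI allI impI)
    show "continuous_on (ball 0 r) u" by (rule continuous_on_subset[OF cu ball_subset_cball])
    show "\<forall>x\<in>ball 0 r. 0 \<le> u x" using u(3) by simp
  qed (use cu u graph_weak_solution[OF u(1) c[OF cu u(3)]] in auto)
  have uniq: "v x = u x" if sol: "dunkl_dirichlet_solution R k \<phi> r f v" and x: "x \<in> cball 0 r" for v x
  proof -
    have v: "continuous_on (cball 0 r) v" "\<forall>x\<in>cball 0 r. 0 \<le> v x" "\<forall>x\<in>sphere 0 r. v x = f x"
      and weak: "\<And>\<psi>. test_function_on (ball 0 r) \<psi> \<Longrightarrow> (LINT x:ball 0 r|lborel. v x * dunkl_laplacian R k \<psi> x * W x)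
         = (LINT x:ball 0 r|lborel. \<phi> (v x) * \<psi> x * W x)"
      using sol unfolding dunkl_dirichlet_solution_def dunkl_semilinear_solution_def by auto
    obtain z where z: "graph r z (\<lambda>x. \<phi> (v x))" "\<forall>x\<in>sphere 0 r. z x = f x"
      using linear_dirichlet[OF r f(1) c[OF v(1,2)]] by blast
    have cz: "continuous_on (cball 0 r) z" by (rule graph_continuous[OF z(1)])
    have "v y - z y = 0" if "y \<in> cball 0 r" for y
    proof (rule weakly_harmonic_eq_0[OF r continuous_on_diff[OF v(1) cz] _ _ that])
      show "v x - z x = 0" if "x \<in> sphere 0 r" for x using v(3) z(2) that by simp
      fix \<psi> :: "'a \<Rightarrow> real" assume \<psi>: "test_function_on (ball 0 r) \<psi>"
      then have C\<psi>: "Ck 2 \<psi>" by (simp add: test_function_on_def)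
      have cL: "continuous_on UNIV (dunkl_laplacian R k \<psi>)"
        unfolding dunkl_laplacian_eq[OF C\<psi>] by (rule continuous_on_dunkl_op[OF C\<psi>])
      have si: "set_integrable lborel (ball 0 r) (\<lambda>x. a x * dunkl_laplacian R k \<psi> x * W x)"
        if "continuous_on (cball 0 r) a" for a
        using integrable_on_ball[OF continuous_on_integrand[OF that cL]] by (simp add: set_integrable_def)
      have "(LINT x:ball 0 r|lborel. (v x - z x) * dunkl_laplacian R k \<psi> x * W x)
         = (LINT x:ball 0 r|lborel. v x * dunkl_laplacian R k \<psi> x * W x - z x * dunkl_laplacian R k \<psi> x * W x)"
        by (simp only: left_diff_distrib)
      also have "\<dots> = (LINT x:ball 0 r|lborel. v x * dunkl_laplacian R k \<psi> x * W x)
         - (LINT x:ball 0 r|lborel. z x * dunkl_laplacian R k \<psi> x * W x)"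
        by (rule set_integral_diff(2)[OF si[OF v(1)] si[OF cz]])
      also have "\<dots> = 0"
        unfolding weak[OF \<psi>] graph_weak_solution[OF z(1) c[OF v(1,2)] \<psi>] by simp
      finally show "(LINT x:ball 0 r|lborel. (v x - z x) * dunkl_laplacian R k \<psi> x * W x) = 0" .
    qed
    then have gv: "graph r v (\<lambda>x. \<phi> (v x))"
      by (intro graph_cong[OF z(1)]) auto
    have mono: "\<phi> a \<le> \<phi> b" if "0 \<le> a" "a \<le> b" for a b
      using mono_onD[OF \<phi>(3), of a b] that by simp
    have "v x - u x \<le> 0 + 0 * (r\<^sup>2 / (2 * hdim))"
      by (rule graph_max_principle[OF graph_diff[OF gv u(1)] r _ _ _ x]) (use v u(2,3) mono in auto)
    moreover have "u x - v x \<le> 0 + 0 * (r\<^sup>2 / (2 * hdim))"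
      by (rule graph_max_principle[OF graph_diff[OF u(1) gv] r _ _ _ x]) (use v u(2,3) mono in auto)
    ultimately show ?thesis by simp
  qed
  from sol uniq show ?thesis by blast
qed

end

theorem theorem6p3:
  fixes R :: "'a::euclidean_space set" and k :: "'a \<Rightarrow> real"
    and \<phi> :: "real \<Rightarrow> real" and f :: "'a \<Rightarrow> real" and r :: real
  assumes "root_system R" and "multiplicity_function R k"
    and "real DIM('a) + (\<Sum>\<alpha>\<in>R. k \<alpha>) > 2"
    and "r > 0"
    and "\<phi> \<in> {0..} \<rightarrow> {0..}" and "locally_lipschitz_on {0..} \<phi>" and "mono_on {0..} \<phi>"
    and "\<phi> 0 = 0" and "\<exists>t\<in>{0..}. \<phi> t \<noteq> 0"
    and "continuous_on (sphere 0 r) f" and "\<forall>x\<in>sphere 0 r. 0 \<le> f x"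
  shows "\<exists>u. dunkl_dirichlet_solution R k \<phi> r f u \<and>
           (\<forall>v. dunkl_dirichlet_solution R k \<phi> r f v \<longrightarrow> (\<forall>x\<in>cball 0 r. v x = u x))"
proof -
  interpret dunkl_data R k by unfold_locales (rule assms)+
  show ?thesis by (rule semilinear_dirichlet_unique_solution) (rule assms)+
qed

end
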